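(* Let $\Phi$ be a stationary marked point process on $\mathbb{R}^d$ with marks in $\mathbb{M}$ whose ground process $\Phi_g$ has all finite moments, and let $\kappa$ satisfy (K1)–(K3). Then for any $0\le r\le s<\infty$ and any nonnegative integer $q$ there exists a number $\hat\beta_q^{r,s}\ge0$ such that for every convex averaging net $\{A_n\}_{n\in\mathcal{N}}$ in $\mathbb{R}^d$, \[ \frac{1}{\ell(A_n)}\mathbb{E}[\beta^{r,s}_{q,A_n}]\to\hat\beta_q^{r,s}\quad\text{as } n\to\infty. \] If moreover $\Phi$ is ergodic, then $\frac{1}{\ell(A_n)}\beta^{r,s}_{q,A_n}\to\hat\beta_q^{r,s}$ as $n\to\infty$ almost surely.
   Context: Let $\mathbb{M}$ be a complete separable metric space, $\pi:\mathbb{R}^d\times\mathbb{M}\to\mathbb{R}^d$ the projection, $\mathcal{F}(\mathbb{R}^d\times\mathbb{M})$ the finite nonempty subsets. $\kappa:\mathcal{F}(\mathbb{R}^d\times\mathbb{M})\to[0,\infty)$ is measurable and satisfies (K1) $\kappa(A)\le\kappa(B)$ if $A\subset B$; (K2) $\kappa(T_aA)=\kappa(A)$ for $T_a(x,m)=(x+a,m)$, $a\in\mathbb{R}^d$; (K3) there is an increasing $\rho:[0,\infty)\to[0,\infty)$ with $\|x-y\|\le\rho(\kappa(\{(x,m),(y,n)\}))$. For a simple marked point set $\Xi$ (finite, at most one point of $\Xi$ over each $x\in\mathbb{R}^d$), $\mathbb{K}(\Xi)=\{K(\Xi,t)\}_{t\ge0}$ with $K(\Xi,t)=\{\pi(\sigma):\emptyset\ne\sigma\subset\Xi,\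 \kappa(\sigma)\le t\}$. The $q$th $(r,s)$-persistent Betti number (over a fixed field) is $\beta_q^{r,s}(\mathbb{K}(\Xi))=\dim Z_q(K(\Xi,r))/(Z_q(K(\Xi,r))\cap B_q(K(\Xi,s)))$, i.e. the rank of the map $H_q(K(\Xi,r))\to H_q(K(\Xi,s))$ induced by inclusion. A marked point process is a point process $\Phi$ on $\mathbb{R}^d\times\mathbb{M}$ whose ground process $\Phi_g(\cdot)=\Phi(\cdot\times\mathbb{M})$ is simple; all finite moments means $\mathbb{E}[\Phi_g(A)^p]<\infty$ for bounded Borel $A$, $p\ge1$. Stationary: law invariant under $T_{a*}$, $(T_{a*}\mu)(B)=\mu(T_a^{-1}B)$; ergodic: every $T_{a*}$-invariant (mod null sets, for all $a$) event has probability $0$ or $1$. $\Phi_A(\cdot)=\Phi(\cdot\cap(A\times\mathbb{M}))$ and $\beta^{r,s}_{q,A}=\beta_q^{r,s}(\mathbb{K}(\Phi_A))$. A convex averaging net is an increasing family $\{A_n\}_{n\in\mathcal{N}}$ (indexed by a linearly ordered set) of bounded convex Borel sets with $\sup_n r(A_n)=\infty$, $r(A)$ the supremal radius of a ball contained in $A$. $\ell$ is Lebesgue measure. *)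

theory Defs
  imports "HOL-Probability.Probability" "HOL-Library.Function_Algebras"
begin

text \<open>A simplicial complex is a set of finite nonempty vertex sets.  A q-chain with
coefficients in the field 'k is represented as an alternating function on ordered
(q+1)-tuples of vertices (lists), supported on the simplices of the complex.\<close>

definition alternating :: "('v list \<Rightarrow> 'k::field) \<Rightarrow> bool" where
  "alternating c \<longleftrightarrow>
     (\<forall>xs. \<not> distinct xs \<longrightarrow> c xs = 0) \<and>
     (\<forall>xs i. Suc i < length xs \<longrightarrow> c (xs[i := xs ! Suc i, Suc i := xs ! i]) = - c xs)"

definition chains :: "'k::field itself \<Rightarrow> 'v set set \<Rightarrow> nat \<Rightarrow> ('v list \<Rightarrow> 'k) set" where
  "chains _ K q = {c. alternating c \<and> (\<forall>xs. c xs \<noteq> 0 \<longrightarrow> length xs = Suc q \<and> set xs \<in> K)}"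

definition bd :: "'v set set \<Rightarrow> ('v list \<Rightarrow> 'k::field) \<Rightarrow> ('v list \<Rightarrow> 'k)" where
  "bd K c = (\<lambda>ws. \<Sum>v\<in>\<Union>K. c (v # ws))"

definition cycles :: "'k::field itself \<Rightarrow> 'v set set \<Rightarrow> nat \<Rightarrow> ('v list \<Rightarrow> 'k) set" where
  "cycles T K q = {c \<in> chains T K q. q = 0 \<or> bd K c = 0}"

definition boundaries :: "'k::field itself \<Rightarrow> 'v set set \<Rightarrow> nat \<Rightarrow> ('v list \<Rightarrow> 'k) set" where
  "boundaries T K q = bd K ` chains T K (Suc q)"

definition fscale :: "'k::field \<Rightarrow> ('v list \<Rightarrow> 'k) \<Rightarrow> ('v list \<Rightarrow> 'k)" where
  "fscale a c = (\<lambda>xs. a * c xs)"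

text \<open>Persistent Betti number  dim Z_q(K) / (Z_q(K) \<inter> B_q(L)) = dim Z_q(K) - dim (Z_q(K) \<inter> B_q(L)).\<close>
definition pbetti :: "'k::field itself \<Rightarrow> 'v set set \<Rightarrow> 'v set set \<Rightarrow> nat \<Rightarrow> nat" where
  "pbetti T K L q =
     vector_space.dim (fscale :: 'k \<Rightarrow> _) (cycles T K q)
     - vector_space.dim (fscale :: 'k \<Rightarrow> _) (cycles T K q \<inter> boundaries T L q)"

definition Kcx :: "(('a \<times> 'm) set \<Rightarrow> real) \<Rightarrow> ('a \<times> 'm) set \<Rightarrow> real \<Rightarrow> 'a set set" where
  "Kcx \<kappa> \<Xi> t = {fst ` \<sigma> | \<sigma>. \<sigma> \<subseteq> \<Xi> \<and> \<sigma> \<noteq> {} \<and> finite \<sigma> \<and> \<kappa> \<sigma> \<le> t}"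

definition Tr :: "'a::euclidean_space \<Rightarrow> ('a \<times> 'm) \<Rightarrow> ('a \<times> 'm)" where
  "Tr a = (\<lambda>(x, m). (x + a, m))"

definition shift :: "'a::euclidean_space \<Rightarrow> ('a \<times> 'm) set \<Rightarrow> ('a \<times> 'm) set" where
  "shift a \<xi> = Tr a ` \<xi>"

definition configs :: "('a::euclidean_space \<times> 'm) set set" where
  "configs = {\<xi>. (\<forall>B. bounded B \<longrightarrow> finite (\<xi> \<inter> (B \<times> UNIV))) \<and> inj_on fst \<xi>}"

definition config_space :: "('a::euclidean_space \<times> 'm::polish_space) set measure" where
  "config_space = sigma configs
     {{\<xi> \<in> configs. card (\<xi> \<inter> B) = k} | B k. B \<in> sets (borel :: ('a \<times> 'm) measure) \<and> bounded (fst ` B)}"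

definition restr :: "('a \<times> 'm) set \<Rightarrow> 'a set \<Rightarrow> ('a \<times> 'm) set" where
  "restr \<xi> A = \<xi> \<inter> (A \<times> UNIV)"

definition stationary_mpp :: "'w measure \<Rightarrow> ('w \<Rightarrow> ('a::euclidean_space \<times> 'm::polish_space) set) \<Rightarrow> bool" where
  "stationary_mpp P \<Phi> \<longleftrightarrow>
     (\<forall>a. distr P config_space (\<lambda>\<omega>. shift a (\<Phi> \<omega>)) = distr P config_space \<Phi>)"

definition ergodic_mpp :: "'w measure \<Rightarrow> ('w \<Rightarrow> ('a::euclidean_space \<times> 'm::polish_space) set) \<Rightarrow> bool" where
  "ergodic_mpp P \<Phi> \<longleftrightarrow>
     (\<forall>B \<in> sets (config_space :: ('a \<times> 'm) set measure).
        (\<forall>a. measure (distr P config_space \<Phi>)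
               (B - {\<xi> \<in> configs. shift a \<xi> \<in> B} \<union> ({\<xi> \<in> configs. shift a \<xi> \<in> B} - B)) = 0)
        \<longrightarrow> measure (distr P config_space \<Phi>) B = 0 \<or> measure (distr P config_space \<Phi>) B = 1)"

definition finite_moments :: "'w measure \<Rightarrow> ('w \<Rightarrow> ('a::euclidean_space \<times> 'm) set) \<Rightarrow> bool" where
  "finite_moments P \<Phi> \<longleftrightarrow>
     (\<forall>A (p::nat). A \<in> sets (borel :: 'a measure) \<and> bounded A \<and> p \<ge> 1 \<longrightarrow>
        (\<integral>\<^sup>+\<omega>. ennreal (real (card (restr (\<Phi> \<omega>) A)) ^ p) \<partial>P) < \<infinity>)"

definition admissible_kappa :: "(('a::euclidean_space \<times> 'm::polish_space) set \<Rightarrow> real) \<Rightarrow> bool" where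
  "admissible_kappa \<kappa> \<longleftrightarrow>
     \<comment> \<open>values in [0,inf) on finite nonempty sets\<close>
     (\<forall>A. finite A \<and> A \<noteq> {} \<longrightarrow> \<kappa> A \<ge> 0) \<and>
     \<comment> \<open>measurability: on (R^d x M)^n for every n >= 1, via the quotient map to F\<close>
     (\<forall>n::nat\<ge>1. (\<lambda>f. \<kappa> (f ` {..<n})) \<in> borel_measurable (PiM {..<n} (\<lambda>_. (borel :: ('a \<times> 'm) measure)))) \<and>
     \<comment> \<open>(K1)\<close>
     (\<forall>A B. finite B \<and> A \<noteq> {} \<and> A \<subseteq> B \<longrightarrow> \<kappa> A \<le> \<kappa> B) \<and>
     \<comment> \<open>(K2)\<close>
     (\<forall>A a. finite A \<and> A \<noteq> {} \<longrightarrow> \<kappa> (Tr a ` A) = \<kappa> A) \<and>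
     \<comment> \<open>(K3)\<close>
     (\<exists>\<rho>::real \<Rightarrow> real. mono_on {0..} \<rho> \<and> (\<forall>t\<ge>0. \<rho> t \<ge> 0) \<and>
        (\<forall>x m y n. dist x y \<le> \<rho> (\<kappa> {(x, m), (y, n)})))"

definition convex_averaging_net :: "('n::linorder \<Rightarrow> 'a::euclidean_space set) \<Rightarrow> bool" where
  "convex_averaging_net A \<longleftrightarrow>
     mono A \<and> (\<forall>n. A n \<in> sets borel \<and> bounded (A n) \<and> convex (A n)) \<and>
     (\<forall>R. \<exists>n x. ball x R \<subseteq> A n)"

end

theory Submission
  imports Defs
begin

text \<open>Cut space into the translates of a cube of side \<open>M\<close>. Removing simplices changes a persistent Betti
  number by at most the number of removed simplices of dimension \<open>q\<close> and \<open>q + 1\<close>, and persistent Betti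
  numbers are additive over vertex-disjoint complexes. Hence the Betti number of \<open>\<Phi>\<close> in a convex set
  is the sum of the Betti numbers of the cells up to the simplices that cross a cell boundary, whose
  mean number per cell is \<open>o(M^d)\<close>, and those in cells that meet the boundary of the convex set, which
  are negligible. Taking means and letting \<open>M\<close> grow yields the limit density.

  For almost sure convergence no continuous averages are needed. The tiling may be shifted by any vector,
  so the cell Betti number may be replaced by any average of finitely many of its shifts. By ergodicity
  such an average can be chosen \<open>L\<^sup>1\<close>-close to a constant, although the action of the lattice alone need not
  be ergodic. The finite sets of lattice points near the sets of the net form a chain, hence a countable
  family (also for an uncountable index set) with bounded doubling, and a maximal inequality
  controls all errors along this family at once.\<close>

text \<open>Because the net may be uncountable, the comparison with cells is proved for every
  configuration and every bounded region, with errors that are sums of translates of fixed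
  integrable functions; one exceptional event then serves all regions. (K3) makes this possible:
  simplices of value at most s have bounded diameter, so one that crosses a cell boundary lies in a
  ball around one of few points near that boundary, and powers of point counts of these balls bound
  the number of crossing simplices. Cells at the rim of a region are few, but their contribution is
  only integrable, not bounded. It is truncated at a constant: the bounded part is controlled by the
  number of rim cells, the small excess by the maximal inequality. The covering argument produces
  difference sets whereas convexity bounds sumsets; Ruzsa's triangle inequality links the two.
  Moments enter because n points have Betti number at most n to the power q + 2, which makes it
  square integrable, as the minimization behind the mean ergodic theorem requires.\<close>

section \<open>Dimensions of finitely generated subspaces\<close>

text \<open>A copy of the locale \<open>vector_space\<close>: definitions made in the latter would be shadowed by their
  instances for its global interpretations.\<close>

locale fin_gen_vector_space = vector_space scale
  for scale :: "'a::field \<Rightarrow> 'b::ab_group_add \<Rightarrow> 'b"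
begin

text \<open>\<open>dim\<close> is the cardinality of a basis, hence 0 when the basis is infinite, so
  it is not monotone in the infinite-dimensional space of all functions on lists. Dimensions are
  therefore compared only for finitely generated sets.\<close>

definition fin_gen :: "'b set \<Rightarrow> bool" where
  "fin_gen S \<longleftrightarrow> (\<exists>V. finite V \<and> S \<subseteq> span V)"

text \<open>An upper bound for the dimension of \<open>T\<close> modulo \<open>S\<close>, stated by
  generators so that it composes and passes to linear images before any dimension is
  computed.\<close>

definition codim_le :: "nat \<Rightarrow> 'b set \<Rightarrow> 'b set \<Rightarrow> bool" where
  "codim_le n S T \<longleftrightarrow> (\<exists>V. finite V \<and> card V \<le> n \<and> T \<subseteq> span (S \<union> V))"

lemma fin_gen_subset: "fin_gen T \<Longrightarrow> S \<subseteq> T \<Longrightarrow> fin_gen S"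
  unfolding fin_gen_def by blast

lemma fin_gen_basis:
  assumes "fin_gen S"
  obtains B where "B \<subseteq> S" "finite B" "independent B" "S \<subseteq> span B" "card B = dim S"
proof -
  obtain B where B: "B \<subseteq> S" "independent B" "S \<subseteq> span B" "card B = dim S"
    using basis_exists by blast
  moreover have "finite B"
    using assms B independent_span_bound unfolding fin_gen_def by (meson subset_trans)
  ultimately show thesis using that by blast
qed

lemma dim_mono_fin_gen:
  assumes "fin_gen T" "S \<subseteq> T"
  shows "dim S \<le> dim T"
  using fin_gen_basis[OF assms(1)] assms(2) by (metis dim_le_card subset_trans)

lemma codim_le_fin_gen:
  assumes "codim_le n S T" "fin_gen S"
  shows "fin_gen T"
proof -
  obtain V W where V: "finite V" "T \<subseteq> span (S \<union> V)" and W: "finite W" "S \<subseteq> span W"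
    using assms unfolding codim_le_def fin_gen_def by blast
  have "S \<union> V \<subseteq> span (W \<union> V)"
    using W(2) by (meson Un_least Un_upper1 Un_upper2 span_mono span_superset subset_trans)
  then have "T \<subseteq> span (W \<union> V)"
    using V(2) span_minimal[OF _ subspace_span] by (meson subset_trans)
  with V W show ?thesis unfolding fin_gen_def by blast
qed

lemma dim_le_codim_le:
  assumes "codim_le n S T" "fin_gen S"
  shows "dim T \<le> dim S + n"
proof -
  obtain V where V: "finite V" "card V \<le> n" "T \<subseteq> span (S \<union> V)"
    using assms unfolding codim_le_def by blast
  obtain B where B: "finite B" "S \<subseteq> span B" "card B = dim S"
    using fin_gen_basis[OF assms(2)] by metis
  have "S \<union> V \<subseteq> span (B \<union> V)"
    using B(2) by (meson Un_least Un_upper1 Un_upper2 span_mono span_superset subset_trans)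
  then have "T \<subseteq> span (B \<union> V)"
    using V(3) span_minimal[OF _ subspace_span] by (meson subset_trans)
  then have "dim T \<le> card (B \<union> V)" using B V by (intro dim_le_card) auto
  also have "\<dots> \<le> card B + card V" by (rule card_Un_le)
  finally show ?thesis using B V by simp
qed

lemma codim_le_trans:
  assumes "codim_le m S T" "codim_le n T U"
  shows "codim_le (m + n) S U"
proof -
  obtain V W where V: "finite V" "card V \<le> m" "T \<subseteq> span (S \<union> V)"
    and W: "finite W" "card W \<le> n" "U \<subseteq> span (T \<union> W)"
    using assms unfolding codim_le_def by blast
  have "T \<union> W \<subseteq> span (S \<union> (V \<union> W))"
    using V(3) span_mono[of "S \<union> V" "S \<union> (V \<union> W)"] span_superset[of "S \<union> (V \<union> W)"] by blast
  then have "U \<subseteq> span (S \<union> (V \<union> W))"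
    using W(3) span_minimal[OF _ subspace_span] by (meson subset_trans)
  moreover have "card (V \<union> W) \<le> m + n"
    using card_Un_le[of V W] V W by linarith
  ultimately show ?thesis
    unfolding codim_le_def using V W by (meson finite_UnI)
qed

text \<open>Induction on the additional generators: each of them enlarges the intersection with
  \<open>Z\<close> by at most one dimension, although the generator itself may lie outside
  \<open>Z\<close>.\<close>

lemma codim_le_Int:
  assumes "codim_le n S T" "subspace S" "subspace Z"
  shows "codim_le n (S \<inter> Z) (T \<inter> Z)"
proof -
  have ex: "\<exists>V'. finite V' \<and> card V' \<le> card V \<and> T \<inter> Z \<subseteq> span ((S \<inter> Z) \<union> V')"
    if "finite V" "T \<subseteq> span (S \<union> V)" for V T
    using that
  proof (induction V arbitrary: T rule: finite_induct)
    case empty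
    then have "T \<subseteq> S" using assms(2) by (metis Un_empty_right span_eq_iff)
    then have "T \<inter> Z \<subseteq> span ((S \<inter> Z) \<union> {})" using span_superset[of "S \<inter> Z"] by auto
    then show ?case by (intro exI[of _ "{}"]) auto
  next
    case (insert w V)
    define S1 where "S1 = span (S \<union> V)"
    obtain V' where V': "finite V'" "card V' \<le> card V" "S1 \<inter> Z \<subseteq> span ((S \<inter> Z) \<union> V')"
      using insert.IH[of S1] unfolding S1_def by blast
    show ?case
    proof (cases "T \<inter> Z \<subseteq> S1")
      case True
      then have "T \<inter> Z \<subseteq> span ((S \<inter> Z) \<union> V')" using V' by blast
      then show ?thesis using V' insert by (intro exI[of _ V']) auto
    next
      case False
      \<comment> \<open>\<open>v\<close> takes the place of the generator \<open>w\<close>, which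
        need not belong to \<open>Z\<close>. Any other \<open>u\<close> in
        \<open>T \<inter> Z\<close> has the same direction modulo \<open>S1\<close>, so subtracting
        a multiple of \<open>v\<close> brings it into \<open>S1 \<inter> Z\<close>.\<close>
      then obtain v where v: "v \<in> T" "v \<in> Z" "v \<notin> S1" by blast
      have sub1: "subspace (S1 \<inter> Z)"
        unfolding S1_def by (intro subspace_inter assms subspace_span)
      have "T \<inter> Z \<subseteq> span (insert v (S1 \<inter> Z))"
      proof
        fix u assume u: "u \<in> T \<inter> Z"
        have T: "T \<subseteq> span (insert w S1)"
        proof -
          have "S \<union> insert w V \<subseteq> insert w S1"
            unfolding S1_def using span_superset[of "S \<union> V"] by blast
          then show ?thesis using insert.prems span_mono by blast
        qed
        obtain k where k: "v - scale k w \<in> S1"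
          using T v(1) unfolding S1_def span_insert span_span by blast
        obtain l where l: "u - scale l w \<in> S1"
          using T u unfolding S1_def span_insert span_span by blast
        have "k \<noteq> 0" using k v(3) by auto
        have sS: "subspace S1" unfolding S1_def by simp
        have "(u - scale l w) - scale (l / k) (v - scale k w) \<in> S1"
          by (intro subspace_diff[OF sS] l subspace_scale[OF sS] k)
        moreover have "(u - scale l w) - scale (l / k) (v - scale k w) = u - scale (l / k) v"
          using \<open>k \<noteq> 0\<close> by (simp add: scale_right_diff_distrib)
        moreover have "u - scale (l / k) v \<in> Z"
          using u v assms(3) by (intro subspace_diff subspace_scale) auto
        ultimately have "u - scale (l / k) v \<in> span (S1 \<inter> Z)"
          by (intro span_base) auto
        then show "u \<in> span (insert v (S1 \<inter> Z))"
          unfolding span_insert by blast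
      qed
      also have "\<dots> \<subseteq> span ((S \<inter> Z) \<union> insert v V')"
      proof (rule span_minimal)
        have "span ((S \<inter> Z) \<union> V') \<subseteq> span ((S \<inter> Z) \<union> insert v V')"
          by (intro span_mono) auto
        then show "insert v (S1 \<inter> Z) \<subseteq> span ((S \<inter> Z) \<union> insert v V')"
          using V'(3) by (auto intro: span_base)
      qed simp
      finally show ?thesis
        using V' insert(1,2) by (intro exI[of _ "insert v V'"]) (auto simp: card_insert_if)
    qed
  qed
  obtain V where "finite V" "card V \<le> n" "T \<subseteq> span (S \<union> V)"
    using assms(1) unfolding codim_le_def by blast
  with ex[of V T] show ?thesis unfolding codim_le_def by (meson order_trans)
qed

text \<open>The kernel of a functional is a hyperplane or everything: one vector on which the
  functional does not vanish generates the rest. It is applied to evaluation of a chain at one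
  ordering of a simplex.\<close>

lemma codim_le_functional:
  assumes T: "subspace T" and S: "{x \<in> T. \<phi> x = 0} \<subseteq> S"
    and add: "\<And>x y. \<phi> (x - y) = \<phi> x - \<phi> y" and sc: "\<And>a x. \<phi> (scale a x) = a * \<phi> x"
  shows "codim_le 1 S T"
proof (cases "\<exists>v\<in>T. \<phi> v \<noteq> 0")
  case True
  then obtain v where v: "v \<in> T" "\<phi> v \<noteq> 0" by blast
  have "T \<subseteq> span (S \<union> {v})"
  proof
    fix x assume x: "x \<in> T"
    have "\<phi> (x - scale (\<phi> x / \<phi> v) v) = 0" using v by (simp add: add sc)
    moreover have "x - scale (\<phi> x / \<phi> v) v \<in> T"
      using x v T by (intro subspace_diff subspace_scale) auto
    ultimately have "x - scale (\<phi> x / \<phi> v) v \<in> span S" using S by (intro span_base) auto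
    then show "x \<in> span (S \<union> {v})" by (auto simp: span_insert)
  qed
  then show ?thesis unfolding codim_le_def by (intro exI[of _ "{v}"]) auto
next
  case False
  then have "T \<subseteq> span (S \<union> {})" using S span_superset[of S] by auto
  then show ?thesis unfolding codim_le_def by (intro exI[of _ "{}"]) auto
qed

lemma dim_direct_sum:
  assumes S: "subspace S" "fin_gen S" and T: "subspace T" "fin_gen T" and ST: "S \<inter> T = {0}"
  shows "dim {x + y |x y. x \<in> S \<and> y \<in> T} = dim S + dim T"
proof -
  \<comment> \<open>Stated for arbitrary subspaces so that it can be used twice, with the two
    summands exchanged.\<close>
  have key: "a \<notin> span ((A \<union> B) - {a})"
    if a: "a \<in> A" and A: "A \<subseteq> U" "independent A" "subspace U" and B: "B \<subseteq> W" "subspace W"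
      and UW: "U \<inter> W = {0}" for a A B U W
  proof
    assume "a \<in> span ((A \<union> B) - {a})"
    moreover have "(A \<union> B) - {a} \<subseteq> (A - {a}) \<union> B" by blast
    ultimately have "a \<in> span ((A - {a}) \<union> B)" using span_mono by blast
    then obtain x y where xy: "a = x + y" "x \<in> span (A - {a})" "y \<in> span B"
      unfolding span_Un by blast
    have "span (A - {a}) \<subseteq> U" using A by (intro span_minimal) auto
    then have "y \<in> U" using xy A a subspace_diff[of U a x] by auto
    moreover have "y \<in> W" using xy(3) B span_minimal[of B W] by blast
    ultimately have "y = 0" using UW by blast
    then show False using xy a A(2) unfolding dependent_def by auto
  qed
  obtain A where A: "A \<subseteq> S" "finite A" "independent A" "S \<subseteq> span A" "card A = dim S"
    by (rule fin_gen_basis[OF S(2)])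
  obtain B where B: "B \<subseteq> T" "finite B" "independent B" "T \<subseteq> span B" "card B = dim T"
    by (rule fin_gen_basis[OF T(2)])
  have TS: "T \<inter> S = {0}" using ST by (simp add: Int_commute)
  have ind: "independent (A \<union> B)"
  proof
    assume "dependent (A \<union> B)"
    then obtain a where a: "a \<in> A \<union> B" "a \<in> span (A \<union> B - {a})"
      unfolding dependent_def by blast
    from a(1) show False
    proof
      assume "a \<in> A"
      from key[OF this A(1,3) S(1) B(1) T(1) ST] a(2) show False by contradiction
    next
      assume "a \<in> B"
      from key[OF this B(1,3) T(1) A(1) S(1) TS] a(2) show False by (simp add: Un_commute)
    qed
  qed
  have "A \<inter> B = {}"
  proof -
    have "A \<inter> B \<subseteq> {0}" using A(1) B(1) ST by auto
    moreover have "0 \<notin> A" using A(3) dependent_zero by metis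
    ultimately show ?thesis by auto
  qed
  have sp: "span A = S" "span B = T"
    by (rule span_subspace[OF A(1,4) S(1)], rule span_subspace[OF B(1,4) T(1)])
  have "{x + y |x y. x \<in> S \<and> y \<in> T} = span (A \<union> B)"
    unfolding span_Un sp ..
  then have "dim {x + y |x y. x \<in> S \<and> y \<in> T} = card (A \<union> B)"
    using dim_span_eq_card_independent[OF ind] by simp
  also have "\<dots> = card A + card B"
    using A B \<open>A \<inter> B = {}\<close> by (simp add: card_Un_disjoint)
  finally show ?thesis using A B by simp
qed

end

locale fin_gen_vector_space_pair = vs1: fin_gen_vector_space s1 + vs2: fin_gen_vector_space s2
  for s1 :: "'a::field \<Rightarrow> 'b::ab_group_add \<Rightarrow> 'b" and s2 :: "'a \<Rightarrow> 'c::ab_group_add \<Rightarrow> 'c"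
begin

sublocale vector_space_pair s1 s2 ..

lemma dim_image_le_fin_gen:
  assumes "Vector_Spaces.linear s1 s2 f" "vs1.fin_gen S"
  shows "vs2.dim (f ` S) \<le> vs1.dim S"
proof -
  obtain B where B: "B \<subseteq> S" "finite B" "vs1.independent B" "S \<subseteq> vs1.span B" "card B = vs1.dim S"
    by (rule vs1.fin_gen_basis[OF assms(2)])
  have "f ` S \<subseteq> vs2.span (f ` B)"
    unfolding linear_span_image[OF assms(1)] using B(4) by (rule image_mono)
  then have "vs2.dim (f ` S) \<le> card (f ` B)"
    using B by (intro vs2.dim_le_card) auto
  also have "\<dots> \<le> card B" using B by (intro card_image_le)
  finally show ?thesis using B by simp
qed

lemma codim_le_image:
  assumes "Vector_Spaces.linear s1 s2 f" "vs1.codim_le n S T"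
  shows "vs2.codim_le n (f ` S) (f ` T)"
proof -
  obtain V where V: "finite V" "card V \<le> n" "T \<subseteq> vs1.span (S \<union> V)"
    using assms unfolding vs1.codim_le_def by blast
  have "f ` T \<subseteq> vs2.span (f ` S \<union> f ` V)"
    unfolding image_Un[symmetric] linear_span_image[OF assms(1)] using V(3) by (rule image_mono)
  moreover have "card (f ` V) \<le> n" using V card_image_le[of V f] by linarith
  ultimately show ?thesis unfolding vs2.codim_le_def using V by (intro exI[of _ "f ` V"]) auto
qed

end

section \<open>Chains, cycles and boundaries\<close>

interpretation fs: fin_gen_vector_space "fscale :: 'k::field \<Rightarrow> ('v list \<Rightarrow> 'k) \<Rightarrow> 'v list \<Rightarrow> 'k"
  by unfold_locales (auto simp: fscale_def fun_eq_iff algebra_simps)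

interpretation fsp: fin_gen_vector_space_pair
  "fscale :: 'k::field \<Rightarrow> ('v list \<Rightarrow> 'k) \<Rightarrow> 'v list \<Rightarrow> 'k"
  "fscale :: 'k::field \<Rightarrow> ('w list \<Rightarrow> 'k) \<Rightarrow> 'w list \<Rightarrow> 'k" ..

section \<open>Alternating functions on lists\<close>

lemma alternating_distinct: "alternating c \<Longrightarrow> c xs \<noteq> 0 \<Longrightarrow> distinct xs"
  unfolding alternating_def by blast

lemma alternating_swap:
  assumes "alternating c"
  shows "c (us @ x # y # vs) = - c (us @ y # x # vs)"
proof -
  have "Suc (length us) < length (us @ y # x # vs)" by simp
  then have "c ((us @ y # x # vs)[length us := (us @ y # x # vs) ! Suc (length us),
      Suc (length us) := (us @ y # x # vs) ! length us]) = - c (us @ y # x # vs)"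
    using assms unfolding alternating_def by blast
  then show ?thesis by (simp add: nth_append list_update_append)
qed

text \<open>Each adjacent swap only changes the sign. Since just the vanishing of \<open>c\<close>
  is compared, signs of permutations never have to be tracked; the prefix \<open>us\<close> lets
  later inductions keep entries fixed.\<close>

lemma alternating_move_front:
  assumes "alternating c"
  shows "c (us @ ys @ x # vs) = 0 \<longleftrightarrow> c (us @ x # ys @ vs) = 0"
proof (induction ys arbitrary: us)
  case (Cons y ys)
  have "c (us @ (y # ys) @ x # vs) = 0 \<longleftrightarrow> c ((us @ [y]) @ ys @ x # vs) = 0" by simp
  also have "\<dots> \<longleftrightarrow> c (us @ y # x # ys @ vs) = 0" using Cons[of "us @ [y]"] by simp
  also have "\<dots> \<longleftrightarrow> c (us @ x # y # ys @ vs) = 0"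
    using alternating_swap[OF assms, of us y x "ys @ vs"] by simp
  finally show ?case by simp
qed simp

lemma alternating_perm:
  assumes "alternating c" "mset xs = mset ys"
  shows "c (us @ xs) = 0 \<longleftrightarrow> c (us @ ys) = 0"
  using assms(2)
proof (induction xs arbitrary: us ys)
  case (Cons x xs)
  then have "x \<in> set ys" by (metis list.set_intros(1) mset_eq_setD)
  then obtain ys1 ys2 where ys: "ys = ys1 @ x # ys2" by (meson split_list)
  then have "mset xs = mset (ys1 @ ys2)" using Cons.prems by simp
  then have "c ((us @ [x]) @ xs) = 0 \<longleftrightarrow> c ((us @ [x]) @ ys1 @ ys2) = 0" by (rule Cons.IH)
  then show ?case using alternating_move_front[OF assms(1), of us ys1 x ys2] ys by simp
qed simp

lemma alternating_same_set:
  assumes "alternating c" "distinct xs" "distinct ys" "set xs = set ys"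
  shows "c xs = 0 \<longleftrightarrow> c ys = 0"
  using alternating_perm[OF assms(1), of xs ys "[]"] assms set_eq_iff_mset_eq_distinct by auto

section \<open>Spaces of chains and their codimensions\<close>

lemma subspace_chains: "fs.subspace (chains T K q)"
proof -
  have "0 \<in> chains T K q" unfolding chains_def alternating_def by simp
  moreover have "c + d \<in> chains T K q" if "c \<in> chains T K q" "d \<in> chains T K q" for c d
  proof -
    have "c xs \<noteq> 0 \<or> d xs \<noteq> 0" if "(c + d) xs \<noteq> 0" for xs
    proof (rule ccontr)
      assume "\<not> (c xs \<noteq> 0 \<or> d xs \<noteq> 0)"
      with that show False by simp
    qed
    then have "\<forall>xs. (c + d) xs \<noteq> 0 \<longrightarrow> length xs = Suc q \<and> set xs \<in> K"
      using that unfolding chains_def by blast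
    moreover have "alternating (c + d)" using that unfolding chains_def alternating_def by simp
    ultimately show ?thesis unfolding chains_def by simp
  qed
  moreover have "fscale a c \<in> chains T K q" if "c \<in> chains T K q" for a c
    using that unfolding chains_def alternating_def fscale_def by auto
  ultimately show ?thesis unfolding fs.subspace_def by blast
qed

lemma chains_mono: "K \<subseteq> L \<Longrightarrow> chains T K q \<subseteq> chains T L q"
  unfolding chains_def by blast

lemma chainsD:
  assumes "c \<in> chains T K q" "c xs \<noteq> 0"
  shows "length xs = Suc q" "set xs \<in> K" "distinct xs" "card (set xs) = Suc q"
proof -
  show "length xs = Suc q" "set xs \<in> K" "distinct xs"
    using assms alternating_distinct[of c xs] unfolding chains_def by auto
  then show "card (set xs) = Suc q" using distinct_card by metis
qed

lemma chains_empty: "chains T {} q = {0}"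
proof -
  have "c = 0" if "c \<in> chains T {} q" for c
    using that unfolding chains_def by (auto simp: fun_eq_iff)
  then show ?thesis using fs.subspace_0[OF subspace_chains] by blast
qed

text \<open>An alternating function vanishes on lists with repetitions, so a q-chain sees only
  simplices with exactly \<open>Suc q\<close> vertices.\<close>

lemma chains_card_cong:
  assumes "\<And>\<sigma>. card \<sigma> = Suc q \<Longrightarrow> \<sigma> \<in> K \<longleftrightarrow> \<sigma> \<in> L"
  shows "chains T K q = chains T L q"
proof -
  have "c \<in> chains T L q" if "c \<in> chains T K q" "\<And>\<sigma>. card \<sigma> = Suc q \<Longrightarrow> \<sigma> \<in> K \<Longrightarrow> \<sigma> \<in> L" for c K L
    using that(1) that(2)[OF chainsD(4,2)[OF that(1)]] unfolding chains_def by auto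
  from this[of _ K L] this[of _ L K] show ?thesis using assms by auto
qed

text \<open>A chain that vanishes at one ordering of the new simplex vanishes at all of them, so
  evaluation at one ordering is a functional whose kernel consists of the old chains. If no list
  enumerates the new set, it carries no chains.\<close>

lemma codim_chains_insert: "fs.codim_le 1 (chains T K q) (chains T (insert \<sigma> K) q)"
proof (cases "\<exists>xs. distinct xs \<and> set xs = \<sigma>")
  case True
  then obtain xs where xs: "distinct xs" "set xs = \<sigma>" by blast
  show ?thesis
  proof (rule fs.codim_le_functional[where \<phi> = "\<lambda>c. c xs"])
    show "{c \<in> chains T (insert \<sigma> K) q. c xs = 0} \<subseteq> chains T K q"
    proof safe
      fix c :: "'b list \<Rightarrow> 'a" assume c: "c \<in> chains T (insert \<sigma> K) q" "c xs = 0"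
      have "set ys \<in> K" if "c ys \<noteq> 0" for ys
      proof -
        have "alternating c" using c(1) unfolding chains_def by simp
        then have "set ys \<noteq> \<sigma>"
          using alternating_same_set[of c xs ys] chainsD(3)[OF c(1) that] c(2) xs that by auto
        then show ?thesis using chainsD(2)[OF c(1) that] by simp
      qed
      then show "c \<in> chains T K q" using c(1) unfolding chains_def by blast
    qed
  qed (auto simp: subspace_chains fscale_def)
next
  case False
  have "c \<in> chains T K q" if c: "c \<in> chains T (insert \<sigma> K) q" for c
  proof -
    have "set xs \<in> K" if "c xs \<noteq> 0" for xs using chainsD[OF c that] False by blast
    then show ?thesis using c unfolding chains_def by auto
  qed
  then have "chains T (insert \<sigma> K) q \<subseteq> fs.span (chains T K q \<union> {})"
    using fs.span_superset[of "chains T K q"] by auto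
  then show ?thesis unfolding fs.codim_le_def by (intro exI[of _ "{}"]) auto
qed

lemma codim_chains_Un:
  assumes "finite X"
  shows "fs.codim_le (card X) (chains T K q) (chains T (K \<union> X) q)"
  using assms
proof (induction X rule: finite_induct)
  case empty
  show ?case unfolding fs.codim_le_def
    by (intro exI[of _ "{}"]) (auto intro: fs.span_base)
next
  case (insert \<sigma> X)
  from fs.codim_le_trans[OF insert.IH codim_chains_insert[of T "K \<union> X" q \<sigma>]] insert
  show ?case by simp
qed

lemma codim_chains_filter:
  assumes "finite K"
  shows "fs.codim_le (card {\<sigma> \<in> K. \<not> Q \<sigma> \<and> card \<sigma> = Suc q}) (chains T {\<sigma> \<in> K. Q \<sigma>} q) (chains T K q)"
proof -
  have "chains T K q = chains T ({\<sigma> \<in> K. Q \<sigma>} \<union> {\<sigma> \<in> K. \<not> Q \<sigma> \<and> card \<sigma> = Suc q}) q"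
    by (rule chains_card_cong) auto
  then show ?thesis using codim_chains_Un[of "{\<sigma> \<in> K. \<not> Q \<sigma> \<and> card \<sigma> = Suc q}"] assms by simp
qed

lemma fin_gen_chains:
  assumes "finite K"
  shows "fs.fin_gen (chains T K q)"
proof -
  have "fs.fin_gen (chains T {} q)"
    unfolding fs.fin_gen_def chains_empty by (intro exI[of _ "{0}"]) (auto intro: fs.span_base)
  then show ?thesis
    using fs.codim_le_fin_gen codim_chains_Un[OF assms, of T "{}" q] by simp
qed

section \<open>The boundary operator, cycles and boundaries\<close>

lemma linear_bd: "Vector_Spaces.linear fscale fscale (bd K)"
  unfolding Vector_Spaces.linear_iff
  by (auto simp: bd_def fscale_def fun_eq_iff sum.distrib sum_distrib_left fs.vector_space_axioms)

text \<open>\<open>bd\<close> sums over the vertices of its complex and thus changes with the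
  complex. Summation over one fixed finite vertex set, written \<open>bd {U}\<close>, gives a single
  linear map with which the chains of several complexes can be compared.\<close>

lemma bd_eq:
  assumes "c \<in> chains T K q" "finite U" "\<Union>K \<subseteq> U"
  shows "bd K c = bd {U} c"
proof
  fix ws
  have "c (v # ws) = 0" if "v \<notin> \<Union>K" for v
    using chainsD(2)[OF assms(1), of "v # ws"] that by force
  then show "bd K c ws = bd {U} c ws"
    unfolding bd_def using assms by (intro sum.mono_neutral_left) auto
qed

lemma cycles_eq:
  assumes "finite U" "\<Union>K \<subseteq> U"
  shows "cycles T K q = {c \<in> chains T K q. q = 0 \<or> bd {U} c = 0}"
  unfolding cycles_def using bd_eq[OF _ assms, of _ T q] by auto

lemma boundaries_eq:
  assumes "finite U" "\<Union>K \<subseteq> U"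
  shows "boundaries T K q = bd {U} ` chains T K (Suc q)"
  unfolding boundaries_def using bd_eq[OF _ assms, of _ T "Suc q"] by (auto intro: image_cong)

lemma subspace_cycles:
  fixes K :: "'v set set" and T :: "'k::field itself"
  shows "fs.subspace (cycles T K q)"
proof -
  have "cycles T K q = (if q = 0 then chains T K q else chains T K q \<inter> {c. bd K c = 0})"
    unfolding cycles_def by auto
  moreover have "fs.subspace {c :: 'v list \<Rightarrow> 'k. bd K c = 0}"
    by (rule fsp.linear_subspace_kernel[OF linear_bd])
  ultimately show ?thesis by (simp add: subspace_chains fs.subspace_inter)
qed

lemma subspace_boundaries: "fs.subspace (boundaries T K q)"
  unfolding boundaries_def
  by (rule fsp.linear_subspace_image[OF linear_bd subspace_chains])

lemma fin_gen_cycles: "finite K \<Longrightarrow> fs.fin_gen (cycles T K q)"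
  using fin_gen_chains fs.fin_gen_subset unfolding cycles_def by (metis (no_types, lifting) mem_Collect_eq subsetI)

text \<open>If a simplices of dimension q and b of dimension q + 1 are removed, the cycles lose at
  most a dimensions and the cycles that bound lose at most a + b. Both losses are nonnegative, so
  the difference of the two dimensions moves by at most a + b.\<close>

lemma pbetti_perturb:
  assumes L: "finite L" "\<And>\<sigma>. \<sigma> \<in> L \<Longrightarrow> finite \<sigma>" and KL: "K \<subseteq> L"
  shows "\<bar>real (pbetti T K L q) - real (pbetti T {\<sigma> \<in> K. Q \<sigma>} {\<sigma> \<in> L. Q \<sigma>} q)\<bar>
    \<le> real (card {\<sigma> \<in> L. \<not> Q \<sigma> \<and> (card \<sigma> = Suc q \<or> card \<sigma> = Suc (Suc q))})"
proof -
  define U where "U = \<Union>L"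
  have U: "finite U" unfolding U_def using L by auto
  define KQ LQ where "KQ = {\<sigma> \<in> K. Q \<sigma>}" and "LQ = {\<sigma> \<in> L. Q \<sigma>}"
  have sub: "\<Union>K \<subseteq> U" "\<Union>L \<subseteq> U" "\<Union>KQ \<subseteq> U" "\<Union>LQ \<subseteq> U"
    unfolding U_def KQ_def LQ_def using KL by auto
  have finK: "finite K" using L KL finite_subset by blast
  have finKQ: "finite KQ" unfolding KQ_def using finK by auto
  define Z Z0 B B0 where "Z = cycles T K q" and "Z0 = cycles T KQ q"
    and "B = boundaries T L q" and "B0 = boundaries T LQ q"
  define a b where "a = card {\<sigma> \<in> L. \<not> Q \<sigma> \<and> card \<sigma> = Suc q}"
    and "b = card {\<sigma> \<in> L. \<not> Q \<sigma> \<and> card \<sigma> = Suc (Suc q)}"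
  have sp: "fs.subspace Z" "fs.subspace Z0" "fs.subspace B" "fs.subspace B0"
    unfolding Z_def Z0_def B_def B0_def by (simp_all add: subspace_cycles subspace_boundaries)
  have fg: "fs.fin_gen Z" "fs.fin_gen Z0"
    unfolding Z_def Z0_def using finK finKQ by (simp_all add: fin_gen_cycles)
  have Z0Z: "Z0 \<subseteq> Z"
    unfolding Z_def Z0_def cycles_eq[OF U sub(1)] cycles_eq[OF U sub(3)]
    using chains_mono[of KQ K T q] KQ_def by blast
  have B0B: "B0 \<subseteq> B"
    unfolding B_def B0_def boundaries_eq[OF U sub(2)] boundaries_eq[OF U sub(4)]
    using chains_mono[of LQ L T "Suc q"] LQ_def by blast
  \<comment> \<open>Intersecting both chain spaces with \<open>Z\<close> turns them into the two
    cycle spaces, because both are cut out by the same operator \<open>bd {U}\<close>.\<close>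
  have "fs.codim_le (card {\<sigma> \<in> K. \<not> Q \<sigma> \<and> card \<sigma> = Suc q}) (chains T KQ q \<inter> Z) (chains T K q \<inter> Z)"
    unfolding KQ_def by (intro fs.codim_le_Int codim_chains_filter finK subspace_chains sp)
  moreover have "chains T KQ q \<inter> Z = Z0"
    unfolding Z_def Z0_def cycles_eq[OF U sub(1)] cycles_eq[OF U sub(3)]
    using chains_mono[of KQ K T q] KQ_def by blast
  moreover have "chains T K q \<inter> Z = Z" unfolding Z_def cycles_def by blast
  moreover have "card {\<sigma> \<in> K. \<not> Q \<sigma> \<and> card \<sigma> = Suc q} \<le> a"
    unfolding a_def using L KL by (intro card_mono) auto
  ultimately have cZ: "fs.codim_le a Z0 Z" unfolding fs.codim_le_def by fastforce
  have "fs.codim_le b (bd {U} ` chains T LQ (Suc q)) (bd {U} ` chains T L (Suc q))"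
    unfolding b_def LQ_def by (rule fsp.codim_le_image[OF linear_bd codim_chains_filter[OF L(1)]])
  then have cB: "fs.codim_le b B0 B"
    unfolding B_def B0_def boundaries_eq[OF U sub(2)] boundaries_eq[OF U sub(4)] .
  \<comment> \<open>One factor changes at a time: first the boundaries grow inside the smaller cycle
    space, then the cycles grow inside the larger boundary space.\<close>
  have c1: "fs.codim_le b (B0 \<inter> Z0) (B \<inter> Z0)" using cB sp by (intro fs.codim_le_Int)
  have c2: "fs.codim_le a (Z0 \<inter> B) (Z \<inter> B)" using cZ sp by (intro fs.codim_le_Int)
  have fg2: "fs.fin_gen (Z0 \<inter> B0)" "fs.fin_gen (Z \<inter> B)"
    by (rule fs.fin_gen_subset[OF fg(2) Int_lower1], rule fs.fin_gen_subset[OF fg(1) Int_lower1])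
  have c3: "fs.codim_le (b + a) (Z0 \<inter> B0) (Z \<inter> B)"
    using fs.codim_le_trans[OF _ c2, of b "Z0 \<inter> B0"] c1 by (simp add: Int_commute)
  note d = fs.dim_le_codim_le[OF cZ fg(2)] fs.dim_le_codim_le[OF c3 fg2(1)]
    fs.dim_mono_fin_gen[OF fg(1) Z0Z] fs.dim_mono_fin_gen[OF fg2(2), of "Z0 \<inter> B0"]
    fs.dim_mono_fin_gen[OF fg(1), of "Z \<inter> B"] fs.dim_mono_fin_gen[OF fg(2), of "Z0 \<inter> B0"]
  have "Z0 \<inter> B0 \<subseteq> Z \<inter> B" using Z0Z B0B by blast
  then have "\<bar>real (fs.dim Z - fs.dim (Z \<inter> B)) - real (fs.dim Z0 - fs.dim (Z0 \<inter> B0))\<bar> \<le> real (a + b)"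
    using d by simp
  also have "a + b = card ({\<sigma> \<in> L. \<not> Q \<sigma> \<and> card \<sigma> = Suc q} \<union> {\<sigma> \<in> L. \<not> Q \<sigma> \<and> card \<sigma> = Suc (Suc q)})"
    unfolding a_def b_def using L by (intro card_Un_disjoint[symmetric]) auto
  also have "{\<sigma> \<in> L. \<not> Q \<sigma> \<and> card \<sigma> = Suc q} \<union> {\<sigma> \<in> L. \<not> Q \<sigma> \<and> card \<sigma> = Suc (Suc q)}
    = {\<sigma> \<in> L. \<not> Q \<sigma> \<and> (card \<sigma> = Suc q \<or> card \<sigma> = Suc (Suc q))}" by blast
  finally show ?thesis
    unfolding pbetti_def Z_def Z0_def B_def B0_def KQ_def LQ_def .
qed

lemma pbetti_empty:
  fixes T :: "'k::field itself"
  shows "pbetti T ({} :: 'v set set) {} q = 0"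
proof -
  have "cycles T ({} :: 'v set set) q \<subseteq> {0}" unfolding cycles_def chains_empty by blast
  then have "cycles T ({} :: 'v set set) q \<subseteq> fs.span {}" by simp
  then have "fs.dim (cycles T ({} :: 'v set set) q) \<le> card ({} :: ('v list \<Rightarrow> 'k) set)"
    by (rule fs.dim_le_card) simp
  then show ?thesis unfolding pbetti_def by simp
qed

section \<open>Additivity over disjoint unions\<close>

text \<open>The projection of chains of a disjoint union onto one summand. The empty list passes the
  inclusion test for every \<open>V\<close>, so it is excluded separately.\<close>

definition cut :: "'v set \<Rightarrow> ('v list \<Rightarrow> 'k::field) \<Rightarrow> ('v list \<Rightarrow> 'k)" where
  "cut V c = (\<lambda>xs. if xs \<noteq> [] \<and> set xs \<subseteq> V then c xs else 0)"

lemma alternating_cut: "alternating c \<Longrightarrow> alternating (cut V c)"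
  unfolding alternating_def cut_def by (auto simp: set_swap)

text \<open>Cutting at the vertex set of the first complex commutes with the boundary operator, so
  cycles, and cycles that bound, are direct sums. Dimensions add, and the truncated subtractions in
  \<open>pbetti\<close> are exact.\<close>

lemma pbetti_Un:
  assumes L1: "finite L1" "\<And>\<sigma>. \<sigma> \<in> L1 \<Longrightarrow> finite \<sigma>" "K1 \<subseteq> L1"
    and L2: "finite L2" "\<And>\<sigma>. \<sigma> \<in> L2 \<Longrightarrow> finite \<sigma>" "K2 \<subseteq> L2"
    and disj: "\<Union>L1 \<inter> \<Union>L2 = {}"
  shows "pbetti T (K1 \<union> K2) (L1 \<union> L2) q = pbetti T K1 L1 q + pbetti T K2 L2 q"
proof -
  define U V where "U = \<Union>L1 \<union> \<Union>L2" and "V = \<Union>L1"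
  have U: "finite U" unfolding U_def using L1 L2 by auto
  have sub: "\<Union>K1 \<subseteq> U" "\<Union>K2 \<subseteq> U" "\<Union>(K1 \<union> K2) \<subseteq> U" "\<Union>L1 \<subseteq> U" "\<Union>L2 \<subseteq> U" "\<Union>(L1 \<union> L2) \<subseteq> U"
    unfolding U_def using L1 L2 by auto
  note eqs = cycles_eq[OF U sub(1)] cycles_eq[OF U sub(2)] cycles_eq[OF U sub(3)]
    boundaries_eq[OF U sub(4)] boundaries_eq[OF U sub(5)] boundaries_eq[OF U sub(6)]
  have in1: "\<sigma> \<subseteq> V \<longleftrightarrow> \<sigma> \<in> A1" if "\<sigma> \<noteq> {}" "\<sigma> \<in> A1 \<union> A2" "A1 \<subseteq> L1" "A2 \<subseteq> L2" for \<sigma> A1 A2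
    using that disj unfolding V_def by blast
  have cut1: "cut V c \<in> chains T A1 j" "c - cut V c \<in> chains T A2 j"
    if c: "c \<in> chains T (A1 \<union> A2) j" and A: "A1 \<subseteq> L1" "A2 \<subseteq> L2" for c A1 A2 j
  proof -
    have s: "set xs \<in> A1 \<union> A2" "length xs = Suc j" "set xs \<noteq> {}" "set xs \<subseteq> V \<longleftrightarrow> set xs \<in> A1"
      if "c xs \<noteq> 0" for xs
    proof -
      show *: "set xs \<in> A1 \<union> A2" "length xs = Suc j" using chainsD[OF c that] by blast+
      then show **: "set xs \<noteq> {}" by (cases xs) auto
      show "set xs \<subseteq> V \<longleftrightarrow> set xs \<in> A1" by (rule in1[OF ** *(1) A])
    qed
    have ac: "alternating c" using c unfolding chains_def by blast
    show "cut V c \<in> chains T A1 j"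
      using s ac alternating_cut unfolding chains_def by (auto simp: cut_def split: if_splits)
    have "c - cut V c \<in> chains T (A1 \<union> A2) j"
      using \<open>cut V c \<in> chains T A1 j\<close> chains_mono[of A1 "A1 \<union> A2" T j] c
      by (intro fs.subspace_diff subspace_chains) auto
    moreover have "set xs \<in> A2" if "(c - cut V c) xs \<noteq> 0" for xs
      using that s[of xs] by (auto simp: cut_def split: if_splits)
    ultimately show "c - cut V c \<in> chains T A2 j" unfolding chains_def by auto
  qed
  have bdcut: "bd {U} (cut V c) = cut V (bd {U} c)" if c: "c \<in> chains T (L1 \<union> L2) (Suc j)" for c j
  proof
    fix ws
    show "bd {U} (cut V c) ws = cut V (bd {U} c) ws"
    proof (cases "ws = []")
      case True
      \<comment> \<open>Chains of positive degree live on lists of length at least 2, so the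
        boundary vanishes at the empty list and the exclusion in \<open>cut\<close> does no
        harm.\<close>
      have "c [v] = 0" for v using chainsD(1)[OF c, of "[v]"] by auto
      then show ?thesis using True by (simp add: bd_def cut_def cong: if_cong)
    next
      case ws: False
      show ?thesis
      proof (cases "set ws \<subseteq> V")
        case True
        have "cut V c (v # ws) = c (v # ws)" for v
        proof (cases "c (v # ws) = 0")
          case False
          then have "set (v # ws) \<in> L1 \<union> L2" by (rule chainsD(2)[OF c])
          \<comment> \<open>A simplex that has one vertex in \<open>V\<close> cannot belong to the
            second complex; the tail \<open>ws\<close> is nonempty and supplies this vertex.\<close>
          moreover have "set (v # ws) \<notin> L2"
          proof
            assume "set (v # ws) \<in> L2"
            then have "set ws \<subseteq> \<Union>L2" by auto
            moreover have "hd ws \<in> set ws" using ws by simp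
            ultimately show False using True disj unfolding V_def by blast
          qed
          ultimately have "set (v # ws) \<subseteq> V" unfolding V_def by blast
          then show ?thesis by (simp add: cut_def)
        qed (simp add: cut_def)
        then show ?thesis using True ws by (simp add: bd_def cut_def)
      qed (auto simp: bd_def cut_def)
    qed
  qed
  have zero_int: "chains T K1 q \<inter> chains T K2 q = {0}"
  proof -
    have "c = 0" if "c \<in> chains T K1 q" "c \<in> chains T K2 q" for c
    proof
      fix xs show "c xs = 0 xs"
      proof (rule ccontr)
        assume "c xs \<noteq> 0 xs"
        then have n: "c xs \<noteq> 0" by simp
        have "set xs \<in> L1" "set xs \<in> L2" "length xs = Suc q"
          using chainsD[OF that(1) n] chainsD[OF that(2) n] L1 L2 by auto
        then have "hd xs \<in> \<Union>L1 \<inter> \<Union>L2" by (cases xs) auto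
        then show False using disj by blast
      qed
    qed
    then show ?thesis using fs.subspace_0[OF subspace_chains] by blast
  qed
  define Z1 Z2 Z B1 B2 B where "Z1 = cycles T K1 q" and "Z2 = cycles T K2 q" and "Z = cycles T (K1 \<union> K2) q"
    and "B1 = boundaries T L1 q" and "B2 = boundaries T L2 q" and "B = boundaries T (L1 \<union> L2) q"
  have sp: "fs.subspace Z1" "fs.subspace Z2" "fs.subspace Z" "fs.subspace B1" "fs.subspace B2" "fs.subspace B"
    unfolding Z1_def Z2_def Z_def B1_def B2_def B_def by (simp_all add: subspace_cycles subspace_boundaries)
  have fg: "fs.fin_gen Z1" "fs.fin_gen Z2" "fs.fin_gen Z"
    unfolding Z1_def Z2_def Z_def using L1 L2 finite_subset by (auto intro!: fin_gen_cycles)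
  have mono: "Z1 \<subseteq> Z" "Z2 \<subseteq> Z" "B1 \<subseteq> B" "B2 \<subseteq> B"
    unfolding Z1_def Z2_def Z_def B1_def B2_def B_def eqs
    using chains_mono[of K1 "K1 \<union> K2" T q] chains_mono[of K2 "K1 \<union> K2" T q]
      chains_mono[of L1 "L1 \<union> L2" T "Suc q"] chains_mono[of L2 "L1 \<union> L2" T "Suc q"] by blast+
  have sp4: "bd {U} (x - y) = bd {U} x - bd {U} y" for x y
    using fsp.linear_diff[OF linear_bd] by blast
  have cutZ: "cut V c \<in> Z1 \<and> c - cut V c \<in> Z2" if c: "c \<in> Z" for c
  proof -
    have cc: "c \<in> chains T (K1 \<union> K2) q" and cb: "q = 0 \<or> bd {U} c = 0"
      using c unfolding Z_def eqs by auto
    have "q = 0 \<or> bd {U} (cut V c) = 0"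
    proof (cases q)
      case (Suc j)
      have "c \<in> chains T (L1 \<union> L2) (Suc j)"
        using cc chains_mono[of "K1 \<union> K2" "L1 \<union> L2"] L1 L2 Suc by blast
      from bdcut[OF this] cb Suc show ?thesis by (auto simp: cut_def fun_eq_iff)
    qed simp
    then show ?thesis
      using cut1[OF cc L1(3) L2(3)] cb unfolding Z1_def Z2_def eqs by (auto simp: sp4)
  qed
  have cutB: "cut V c \<in> B1 \<and> c - cut V c \<in> B2" if c: "c \<in> B" for c
  proof -
    obtain e where e: "e \<in> chains T (L1 \<union> L2) (Suc q)" "c = bd {U} e"
      using c unfolding B_def eqs by blast
    from cut1[OF e(1) order_refl order_refl] bdcut[OF e(1)] e(2)
    show ?thesis unfolding B1_def B2_def eqs by (metis image_eqI sp4)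
  qed
  have z: "Z1 \<inter> Z2 = {0}"
    using zero_int sp fs.subspace_0 unfolding Z1_def Z2_def cycles_def by blast
  have decZ: "Z = {x + y |x y. x \<in> Z1 \<and> y \<in> Z2}"
  proof
    show "Z \<subseteq> {x + y |x y. x \<in> Z1 \<and> y \<in> Z2}"
    proof
      fix c assume "c \<in> Z"
      then have "cut V c \<in> Z1" "c - cut V c \<in> Z2" "c = cut V c + (c - cut V c)" using cutZ by auto
      then show "c \<in> {x + y |x y. x \<in> Z1 \<and> y \<in> Z2}" by blast
    qed
    show "{x + y |x y. x \<in> Z1 \<and> y \<in> Z2} \<subseteq> Z"
      using mono sp fs.subspace_add by blast
  qed
  have decB: "Z \<inter> B = {x + y |x y. x \<in> Z1 \<inter> B1 \<and> y \<in> Z2 \<inter> B2}"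
  proof
    show "Z \<inter> B \<subseteq> {x + y |x y. x \<in> Z1 \<inter> B1 \<and> y \<in> Z2 \<inter> B2}"
    proof
      fix c assume "c \<in> Z \<inter> B"
      then have "cut V c \<in> Z1 \<inter> B1" "c - cut V c \<in> Z2 \<inter> B2" "c = cut V c + (c - cut V c)"
        using cutZ cutB by auto
      then show "c \<in> {x + y |x y. x \<in> Z1 \<inter> B1 \<and> y \<in> Z2 \<inter> B2}" by blast
    qed
    show "{x + y |x y. x \<in> Z1 \<inter> B1 \<and> y \<in> Z2 \<inter> B2} \<subseteq> Z \<inter> B"
    proof safe
      fix x y assume "x \<in> Z1" "x \<in> B1" "y \<in> Z2" "y \<in> B2"
      then show "x + y \<in> Z" "x + y \<in> B" using mono sp fs.subspace_add by blast+
    qed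
  qed
  have "fs.dim Z = fs.dim Z1 + fs.dim Z2"
    unfolding decZ using sp fg z by (intro fs.dim_direct_sum)
  moreover have "fs.dim (Z \<inter> B) = fs.dim (Z1 \<inter> B1) + fs.dim (Z2 \<inter> B2)"
    unfolding decB
  proof (intro fs.dim_direct_sum fs.subspace_inter sp)
    show "fs.fin_gen (Z1 \<inter> B1)" "fs.fin_gen (Z2 \<inter> B2)"
      by (rule fs.fin_gen_subset[OF fg(1) Int_lower1], rule fs.fin_gen_subset[OF fg(2) Int_lower1])
    show "Z1 \<inter> B1 \<inter> (Z2 \<inter> B2) = {0}" using z sp fs.subspace_0 by blast
  qed
  moreover have "fs.dim (Z1 \<inter> B1) \<le> fs.dim Z1" "fs.dim (Z2 \<inter> B2) \<le> fs.dim Z2"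
    using fg by (auto intro: fs.dim_mono_fin_gen)
  ultimately show ?thesis
    unfolding pbetti_def Z1_def[symmetric] Z2_def[symmetric] Z_def[symmetric]
      B1_def[symmetric] B2_def[symmetric] B_def[symmetric] by simp
qed

lemma pbetti_UN:
  assumes "finite D" "\<And>z. z \<in> D \<Longrightarrow> finite (L z)" "\<And>z \<sigma>. z \<in> D \<Longrightarrow> \<sigma> \<in> L z \<Longrightarrow> finite \<sigma>"
    and "\<And>z. z \<in> D \<Longrightarrow> K z \<subseteq> L z"
    and "\<And>z w. z \<in> D \<Longrightarrow> w \<in> D \<Longrightarrow> z \<noteq> w \<Longrightarrow> \<Union>(L z) \<inter> \<Union>(L w) = {}"
  shows "pbetti T (\<Union>z\<in>D. K z) (\<Union>z\<in>D. L z) q = (\<Sum>z\<in>D. pbetti T (K z) (L z) q)"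
  using assms
proof (induction D rule: finite_induct)
  case empty
  show ?case using pbetti_empty by simp
next
  case (insert z D)
  have "pbetti T (K z \<union> (\<Union>z\<in>D. K z)) (L z \<union> (\<Union>z\<in>D. L z)) q
    = pbetti T (K z) (L z) q + pbetti T (\<Union>z\<in>D. K z) (\<Union>z\<in>D. L z) q"
  proof (rule pbetti_Un)
    have "\<Union>(L z) \<inter> \<Union>(L w) = {}" if "w \<in> D" for w
      using insert.prems(4)[of z w] that insert.hyps by blast
    then show "\<Union>(L z) \<inter> \<Union>(\<Union>z\<in>D. L z) = {}" by blast
    show "(\<Union>z\<in>D. K z) \<subseteq> (\<Union>z\<in>D. L z)"
      using insert.prems(3) by (intro UN_mono) auto
    show "finite \<sigma>" if "\<sigma> \<in> (\<Union>z\<in>D. L z)" for \<sigma>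
      using that insert.prems(2) by blast
  qed (use insert in auto)
  moreover have "pbetti T (\<Union>z\<in>D. K z) (\<Union>z\<in>D. L z) q = (\<Sum>z\<in>D. pbetti T (K z) (L z) q)"
    using insert.prems by (intro insert.IH) auto
  ultimately show ?case using insert.hyps by simp
qed

section \<open>Invariance under relabelling of vertices\<close>

text \<open>Chains are transported by composition with the inverse \<open>g\<close> of the
  relabelling, which avoids sums over fibres. Outside \<open>W\<close> the map \<open>g\<close>
  carries no information, hence the cut-off.\<close>

definition relabel :: "('w \<Rightarrow> 'v) \<Rightarrow> 'w set \<Rightarrow> ('v list \<Rightarrow> 'k::field) \<Rightarrow> ('w list \<Rightarrow> 'k)" where
  "relabel g W c = (\<lambda>ys. if set ys \<subseteq> W then c (map g ys) else 0)"

lemma linear_relabel: "Vector_Spaces.linear fscale fscale (relabel g W)"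
  unfolding Vector_Spaces.linear_iff
  by (auto simp: relabel_def fscale_def fun_eq_iff fs.vector_space_axioms)

lemma relabel_chains:
  assumes c: "c \<in> chains T K q" and K: "\<Union>K \<subseteq> U"
    and bij: "\<And>u. u \<in> U \<Longrightarrow> f u \<in> W \<and> g (f u) = u" "\<And>w. w \<in> W \<Longrightarrow> g w \<in> U \<and> f (g w) = w"
  shows "relabel g W c \<in> chains T ((`) f ` K) q"
proof -
  have alt: "alternating c" using c unfolding chains_def by blast
  have inj: "inj_on g W" using bij(2) by (metis inj_onI)
  have "alternating (relabel g W c)"
    unfolding alternating_def
  proof (intro conjI allI impI)
    fix ys :: "'c list" assume "\<not> distinct ys"
    then have "\<not> distinct (map g ys)" by (simp add: distinct_map)
    then show "relabel g W c ys = 0" using alt unfolding alternating_def relabel_def by auto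
  next
    fix ys :: "'c list" and i assume i: "Suc i < length ys"
    have "c ((map g ys)[i := map g ys ! Suc i, Suc i := map g ys ! i]) = - c (map g ys)"
      using alt i unfolding alternating_def by (metis length_map)
    then show "relabel g W c (ys[i := ys ! Suc i, Suc i := ys ! i]) = - relabel g W c ys"
      using i by (simp add: relabel_def map_update set_swap)
  qed
  moreover have "length ys = Suc q \<and> set ys \<in> (`) f ` K" if ne: "relabel g W c ys \<noteq> 0" for ys
  proof -
    have ys: "set ys \<subseteq> W" "c (map g ys) \<noteq> 0" using ne by (auto simp: relabel_def split: if_splits)
    have "f ` (g ` set ys) = (\<lambda>y. y) ` set ys"
      unfolding image_image using ys(1) bij(2) by (intro image_cong) auto
    then have "set ys = f ` (g ` set ys)" by simp
    then show ?thesis using chainsD[OF c ys(2)] by auto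
  qed
  ultimately show ?thesis unfolding chains_def by blast
qed

lemma relabel_bd:
  assumes bij: "\<And>u. u \<in> U \<Longrightarrow> f u \<in> W \<and> g (f u) = u" "\<And>w. w \<in> W \<Longrightarrow> g w \<in> U \<and> f (g w) = w"
  shows "bd {W} (relabel g W c) = relabel g W (bd {U} c)"
proof
  fix ws
  have "(\<Sum>w\<in>W. c (g w # map g ws)) = (\<Sum>u\<in>U. c (u # map g ws))"
    using bij by (intro sum.reindex_bij_witness[of _ f g]) auto
  then show "bd {W} (relabel g W c) ws = relabel g W (bd {U} c) ws"
    by (auto simp: bd_def relabel_def)
qed

text \<open>Only inequalities in one direction are proved; \<open>pbetti_relabel\<close> applies
  them to the bijection and to its inverse.\<close>

lemma relabel_dims:
  fixes f :: "'v \<Rightarrow> 'w"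
  assumes L: "finite L" "\<And>\<sigma>. \<sigma> \<in> L \<Longrightarrow> finite \<sigma>" and KL: "K \<subseteq> L" and U: "U = \<Union>L"
    and bij: "\<And>u. u \<in> U \<Longrightarrow> f u \<in> W \<and> g (f u) = u" "\<And>w. w \<in> W \<Longrightarrow> g w \<in> U \<and> f (g w) = w"
  shows "fs.dim (cycles T K q) \<le> fs.dim (cycles T ((`) f ` K) q)"
    and "fs.dim (cycles T K q \<inter> boundaries T L q)
      \<le> fs.dim (cycles T ((`) f ` K) q \<inter> boundaries T ((`) f ` L) q)"
proof -
  have finU: "finite U" using L U by auto
  have W: "W = f ` U"
  proof (intro equalityI subsetI)
    fix w assume "w \<in> W"
    then have "g w \<in> U" "w = f (g w)" using bij(2)[of w] by auto
    then show "w \<in> f ` U" by blast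
  qed (use bij(1) in blast)
  have finW: "finite W" using W finU by simp
  have sub: "\<Union>K \<subseteq> U" "\<Union>L \<subseteq> U" "\<Union>((`) f ` K) \<subseteq> W" "\<Union>((`) f ` L) \<subseteq> W"
    using U KL W by auto
  have fl: "finite ((`) f ` K)" using L KL finite_subset by blast
  have inv: "relabel f U (relabel g W c) = c" if c: "c \<in> chains T K j" for c :: "'v list \<Rightarrow> 'a" and j
  proof
    fix xs
    have "map (g \<circ> f) xs = xs" if "set xs \<subseteq> U" using bij(1) that by (intro map_idI) auto
    moreover have "set xs \<subseteq> U" if "c xs \<noteq> 0" using chainsD(2)[OF c that] sub(1) by blast
    ultimately show "relabel f U (relabel g W c) xs = c xs"
      using W by (auto simp: relabel_def)
  qed
  have rb: "bd {W} (relabel g W c) = relabel g W (bd {U} c)" for c :: "'v list \<Rightarrow> 'a"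
    by (rule relabel_bd[OF bij])
  have cyc: "relabel g W c \<in> cycles T ((`) f ` K) q" if c: "c \<in> cycles T K q" for c
  proof -
    have c': "c \<in> chains T K q" "q = 0 \<or> bd {U} c = 0"
      using c unfolding cycles_eq[OF finU sub(1)] by blast+
    have "relabel g W (0 :: 'v list \<Rightarrow> 'a) = 0" by (rule fsp.linear_0[OF linear_relabel])
    then have "q = 0 \<or> bd {W} (relabel g W c) = 0" using c'(2) rb[of c] by metis
    with relabel_chains[OF c'(1) sub(1) bij] show ?thesis
      unfolding cycles_eq[OF finW sub(3)] by blast
  qed
  have bnd: "relabel g W c \<in> boundaries T ((`) f ` L) q" if c: "c \<in> boundaries T L q" for c
  proof -
    obtain e where e: "e \<in> chains T L (Suc q)" "c = bd {U} e"
      using c unfolding boundaries_eq[OF finU sub(2)] by blast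
    with relabel_chains[OF e(1) sub(2) bij] rb[of e] show ?thesis
      unfolding boundaries_eq[OF finW sub(4)] by (intro image_eqI[of _ _ "relabel g W e"]) auto
  qed
  have cc: "cycles T K q \<subseteq> chains T K q" unfolding cycles_def by blast
  \<comment> \<open>Transporting there and back is the identity on chains of \<open>K\<close>, so
    \<open>S\<close> is contained in a linear image of \<open>S'\<close>.\<close>
  have key: "fs.dim S \<le> fs.dim S'" if S: "S \<subseteq> chains T K q" and S': "fs.fin_gen S'" and
    r: "\<And>c. c \<in> S \<Longrightarrow> relabel g W c \<in> S'" for S :: "('v list \<Rightarrow> 'a) set" and S'
  proof -
    have "S \<subseteq> relabel f U ` S'"
    proof
      fix c assume "c \<in> S"
      then have "c = relabel f U (relabel g W c)" "relabel g W c \<in> S'" using inv S r by auto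
      then show "c \<in> relabel f U ` S'" by blast
    qed
    moreover have "fs.fin_gen (relabel f U ` S')"
    proof -
      obtain V where "finite V" "S' \<subseteq> fs.span V" using S' unfolding fs.fin_gen_def by blast
      then have "finite (relabel f U ` V)" "relabel f U ` S' \<subseteq> fs.span (relabel f U ` V)"
        unfolding fsp.linear_span_image[OF linear_relabel] by (auto intro: image_mono)
      then show ?thesis unfolding fs.fin_gen_def by blast
    qed
    ultimately have "fs.dim S \<le> fs.dim (relabel f U ` S')"
      by (intro fs.dim_mono_fin_gen)
    also have "\<dots> \<le> fs.dim S'"
      by (rule fsp.dim_image_le_fin_gen[OF linear_relabel S'])
    finally show ?thesis .
  qed
  show "fs.dim (cycles T K q) \<le> fs.dim (cycles T ((`) f ` K) q)"
    using cc cyc fin_gen_cycles[OF fl] by (intro key) auto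
  show "fs.dim (cycles T K q \<inter> boundaries T L q)
      \<le> fs.dim (cycles T ((`) f ` K) q \<inter> boundaries T ((`) f ` L) q)"
    using cc cyc bnd by (intro key fs.fin_gen_subset[OF fin_gen_cycles[OF fl] Int_lower1]) auto
qed

lemma pbetti_relabel:
  fixes f :: "'v \<Rightarrow> 'w"
  assumes L: "finite L" "\<And>\<sigma>. \<sigma> \<in> L \<Longrightarrow> finite \<sigma>" and KL: "K \<subseteq> L" and inj: "inj_on f (\<Union>L)"
  shows "pbetti T ((`) f ` K) ((`) f ` L) q = pbetti T K L q"
proof -
  define g where "g = inv_into (\<Union>L) f"
  have b1: "f u \<in> f ` \<Union>L \<and> g (f u) = u" if "u \<in> \<Union>L" for u
    using that inj inv_into_f_f[OF inj that] unfolding g_def by auto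
  have b2: "g w \<in> \<Union>L \<and> f (g w) = w" if "w \<in> f ` \<Union>L" for w
    using that f_inv_into_f[OF that] inv_into_into[OF that] unfolding g_def by auto
  have inv2: "(`) g ` (`) f ` M = M" if "M \<subseteq> L" for M
  proof -
    have "g ` f ` \<sigma> = \<sigma>" if "\<sigma> \<in> M" for \<sigma>
    proof -
      have "\<sigma> \<subseteq> \<Union>L" using that \<open>M \<subseteq> L\<close> by blast
      then have "g ` f ` \<sigma> = (\<lambda>y. y) ` \<sigma>"
        unfolding image_image using b1 by (intro image_cong) auto
      then show ?thesis by simp
    qed
    then have "(`) g ` (`) f ` M = (\<lambda>y. y) ` M"
      unfolding image_image by (intro image_cong) auto
    then show ?thesis by simp
  qed
  have U2: "f ` \<Union>L = \<Union>((`) f ` L)" by blast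
  note d1 = relabel_dims[OF L KL refl b1 b2, where T = T and q = q]
  have "finite ((`) f ` L)" "\<And>\<sigma>. \<sigma> \<in> (`) f ` L \<Longrightarrow> finite \<sigma>" "(`) f ` K \<subseteq> (`) f ` L"
    using L KL by auto
  note d2 = relabel_dims[OF this U2 b2 b1, where T = T and q = q, unfolded inv2[OF KL] inv2[OF order_refl]]
  show ?thesis unfolding pbetti_def using d1 d2 by (metis order_antisym)
qed

section \<open>Lattice points of convex sets\<close>

definition lattice :: "real \<Rightarrow> 'a::euclidean_space set" where
  "lattice M = {z. \<forall>b\<in>Basis. \<exists>k::int. z \<bullet> b = M * k}"

definition cell :: "real \<Rightarrow> 'a::euclidean_space \<Rightarrow> 'a set" where
  "cell M z = {x. \<forall>b\<in>Basis. z \<bullet> b \<le> x \<bullet> b \<and> x \<bullet> b < z \<bullet> b + M}"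

text \<open>Once \<open>R\<close> is at least \<open>M * DIM('a)\<close>, the cells at these points
  cover \<open>A\<close>, while the cells at \<open>inner_pts\<close> lie inside \<open>A\<close>.
  The difference of the two sets is the rim.\<close>

definition near_pts :: "real \<Rightarrow> real \<Rightarrow> 'a::euclidean_space set \<Rightarrow> 'a set" where
  "near_pts M R A = {z \<in> lattice M. ball z R \<inter> A \<noteq> {}}"

definition inner_pts :: "real \<Rightarrow> real \<Rightarrow> 'a::euclidean_space set \<Rightarrow> 'a set" where
  "inner_pts M R A = {z \<in> lattice M. ball z R \<subseteq> A}"

section \<open>Half-open cubes as a tiling, and their volume\<close>

lemma lattice_add: "z \<in> lattice M \<Longrightarrow> w \<in> lattice M \<Longrightarrow> z + w \<in> lattice M"
  unfolding lattice_def by (auto simp: inner_add_left) (metis of_int_add distrib_left)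

lemma cell_shift: "x \<in> cell M z \<longleftrightarrow> x - z \<in> cell M 0"
  unfolding cell_def by (auto simp: inner_diff_left)

lemma ex_cell:
  assumes "M > 0"
  obtains z where "z \<in> lattice M" "x \<in> cell M z"
proof -
  define z where "z = (\<Sum>b\<in>Basis. (M * \<lfloor>x \<bullet> b / M\<rfloor>) *\<^sub>R b)"
  have zb: "z \<bullet> b = M * \<lfloor>x \<bullet> b / M\<rfloor>" if "b \<in> Basis" for b
    unfolding z_def using that by (simp add: inner_sum_left_Basis)
  have "M * \<lfloor>t / M\<rfloor> \<le> t \<and> t < M * \<lfloor>t / M\<rfloor> + M" for t
  proof -
    have "of_int \<lfloor>t / M\<rfloor> \<le> t / M" "t / M < of_int \<lfloor>t / M\<rfloor> + 1" by linarith+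
    then show ?thesis using assms by (simp add: le_divide_eq divide_less_eq algebra_simps)
  qed
  then have "x \<in> cell M z" unfolding cell_def using zb by auto
  moreover have "z \<in> lattice M" unfolding lattice_def using zb by auto
  ultimately show thesis using that by blast
qed

lemma cell_unique:
  assumes "M > 0" "z \<in> lattice M" "w \<in> lattice M" "x \<in> cell M z" "x \<in> cell M w"
  shows "z = w"
proof (rule euclidean_eqI)
  fix b :: 'a assume b: "b \<in> Basis"
  have *: "k = \<lfloor>x \<bullet> b / M\<rfloor>" if "M * of_int k \<le> x \<bullet> b" "x \<bullet> b < M * of_int k + M" for k :: int
    using that assms(1) by (intro floor_unique[symmetric]) (auto simp: field_simps)
  obtain k l :: int where "z \<bullet> b = M * k" "w \<bullet> b = M * l"
    using assms b unfolding lattice_def by blast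
  with assms(4,5) b have "M * k \<le> x \<bullet> b" "x \<bullet> b < M * k + M" "M * l \<le> x \<bullet> b" "x \<bullet> b < M * l + M"
    unfolding cell_def by force+
  then have "k = l" using *[of k] *[of l] by simp
  then show "z \<bullet> b = w \<bullet> b" by (simp add: \<open>z \<bullet> b = M * k\<close> \<open>w \<bullet> b = M * l\<close>)
qed

lemma dist_cell:
  assumes "x \<in> cell M (z :: 'a::euclidean_space)" "M > 0"
  shows "dist z x < M * DIM('a)"
proof -
  have "norm (x - z) \<le> (\<Sum>b\<in>Basis. \<bar>(x - z) \<bullet> b\<bar>)" by (rule norm_le_l1)
  also have "\<dots> < (\<Sum>b\<in>(Basis :: 'a set). M)"
    using assms(1) by (intro sum_strict_mono) (auto simp: cell_def inner_diff_left)
  finally show ?thesis by (simp add: dist_norm norm_minus_commute mult.commute)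
qed

lemma cell_measure:
  fixes z :: "'a::euclidean_space"
  assumes "M > 0"
  shows "cell M z \<in> sets borel" "emeasure lborel (cell M z) = ennreal (M ^ DIM('a))"
    "measure lborel (cell M z) = M ^ DIM('a)"
proof -
  define u where "u = z + (\<Sum>b\<in>Basis. M *\<^sub>R b)"
  have ub: "u \<bullet> b = z \<bullet> b + M" if "b \<in> Basis" for b
    unfolding u_def using that by (simp add: inner_add_left inner_sum_left_Basis)
  have "cell M z = (\<Inter>b\<in>Basis. {x. z \<bullet> b \<le> x \<bullet> b} \<inter> {x. x \<bullet> b < z \<bullet> b + M})"
    unfolding cell_def by auto
  moreover have "{x. z \<bullet> b \<le> x \<bullet> b} \<inter> {x. x \<bullet> b < z \<bullet> b + M} \<in> sets borel" for b :: 'a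
    by measurable
  ultimately show s: "cell M z \<in> sets borel" by (auto intro!: sets.finite_INT)
  have sub: "box z u \<subseteq> cell M z" "cell M z \<subseteq> cbox z u"
    unfolding cell_def box_def cbox_def using ub by (auto intro: less_imp_le)
  have "(\<Prod>b\<in>(Basis :: 'a set). (u - z) \<bullet> b) = M ^ DIM('a)"
    using ub by (simp add: inner_diff_left)
  then have v: "emeasure lborel (box z u) = ennreal (M ^ DIM('a))"
      "emeasure lborel (cbox z u) = ennreal (M ^ DIM('a))"
    using assms ub by (simp_all add: emeasure_lborel_box emeasure_lborel_cbox)
  show e: "emeasure lborel (cell M z) = ennreal (M ^ DIM('a))"
    using emeasure_mono[OF sub(1), of lborel] emeasure_mono[OF sub(2), of lborel] s v
    by (simp add: order_antisym)
  then show "measure lborel (cell M z) = M ^ DIM('a)"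
    using assms by (simp add: measure_def)
qed

lemma emeasure_lborel_bounded:
  fixes A :: "'a::euclidean_space set"
  assumes "A \<in> sets borel" "bounded A"
  shows "emeasure lborel A < \<infinity>"
proof -
  obtain a where "A \<subseteq> cbox (- a) a" using bounded_subset_cbox_symmetric[OF assms(2)] by blast
  then have "emeasure lborel A \<le> emeasure lborel (cbox (- a) a)" by (intro emeasure_mono) auto
  also have "\<dots> < \<infinity>" by (rule emeasure_lborel_cbox_finite)
  finally show ?thesis .
qed

lemma measure_lborel_mono_bounded:
  fixes A :: "'a::euclidean_space set"
  assumes "A \<subseteq> B" "A \<in> sets borel" "B \<in> sets borel" "bounded B"
  shows "measure lborel A \<le> measure lborel B"
  using assms emeasure_lborel_bounded[OF assms(3,4)]
  by (intro measure_mono_fmeasurable) (auto simp: fmeasurable_def)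

lemma card_cells:
  fixes F :: "'a::euclidean_space set" and M :: real
  assumes "M > 0" "finite F" "F \<subseteq> lattice M"
  shows "measure lborel (\<Union>z\<in>F. cell M z) = card F * M ^ DIM('a)"
proof -
  have "measure lborel (\<Union>z\<in>F. cell M z) = (\<Sum>z\<in>F. measure lborel (cell M z))"
  proof (intro measure_finite_Union)
    show "disjoint_family_on (cell M) F"
      unfolding disjoint_family_on_def using assms cell_unique[of M] by (metis disjoint_iff subsetD)
  qed (use assms in \<open>auto simp: cell_measure(1,2)\<close>)
  then show ?thesis using assms by (simp add: cell_measure)
qed

lemma bounded_cell: "(M::real) > 0 \<Longrightarrow> bounded (cell M (z :: 'a::euclidean_space))"
  by (rule bounded_subset[of "ball z (M * DIM('a))"]) (auto simp: dist_cell)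

text \<open>A packing argument: the disjoint cells at finitely many lattice points of
  \<open>S\<close> fit into a slightly larger ball, whose volume bounds their number.\<close>

lemma finite_lattice_bounded:
  fixes S :: "'a::euclidean_space set" and M :: real
  assumes "M > 0" "bounded S"
  shows "finite (lattice M \<inter> S)"
proof -
  obtain e x where e: "S \<subseteq> ball x e" using assms(2) by (meson bounded_subset_ballD)
  define B where "B = ball x (e + M * DIM('a))"
  have "card F \<le> nat \<lceil>measure lborel B / M ^ DIM('a)\<rceil>" if F: "F \<subseteq> lattice M \<inter> S" "finite F" for F
  proof -
    have "cell M z \<subseteq> B" if "z \<in> F" for z
    proof
      fix y assume "y \<in> cell M z"
      then have "dist z y < M * DIM('a)" using dist_cell assms(1) by blast
      moreover have "dist x z < e" using that F e by auto
      ultimately show "y \<in> B" unfolding B_def using dist_triangle[of x y z] by auto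
    qed
    then have "measure lborel (\<Union>z\<in>F. cell M z) \<le> measure lborel B"
      using F(2) cell_measure(1)[OF assms(1)]
      by (intro measure_lborel_mono_bounded) (auto simp: B_def)
    then have "card F * M ^ DIM('a) \<le> measure lborel B"
      using card_cells[OF assms(1) F(2)] F(1) by auto
    then have "card F \<le> measure lborel B / M ^ DIM('a)" using assms(1) by (simp add: field_simps)
    then show ?thesis by linarith
  qed
  then show ?thesis using finite_if_finite_subsets_card_bdd by blast
qed

section \<open>Lattice points near and inside a set\<close>

lemma finite_near_pts:
  assumes "M > 0" "bounded A"
  shows "finite (near_pts M R A)"
proof -
  obtain e where e: "A \<subseteq> ball 0 e" using assms(2) by (meson bounded_subset_ballD)
  have "near_pts M R A \<subseteq> lattice M \<inter> ball 0 (e + R)"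
  proof
    fix z assume "z \<in> near_pts M R A"
    then obtain a where "z \<in> lattice M" "dist z a < R" "a \<in> A" unfolding near_pts_def by auto
    with e show "z \<in> lattice M \<inter> ball 0 (e + R)"
      using dist_triangle[of 0 z a] by (auto simp: dist_commute dest!: subsetD)
  qed
  then show ?thesis by (rule finite_subset[OF _ finite_lattice_bounded[OF assms(1) bounded_ball]])
qed

lemma inner_pts_subset_near_pts: "R > 0 \<Longrightarrow> inner_pts M R A \<subseteq> near_pts M R A"
  unfolding near_pts_def inner_pts_def using centre_in_ball by blast

lemma near_pts_subset_lattice: "near_pts M R A \<subseteq> lattice M"
  unfolding near_pts_def by blast

lemma near_pts_mono: "A \<subseteq> B \<Longrightarrow> near_pts M R A \<subseteq> near_pts M R B"
  unfolding near_pts_def by blast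

text \<open>For convex \<open>A\<close> and k = t / \<rho>, the sum of \<open>A\<close> and k times
  \<open>A\<close> is (1 + k) times \<open>A\<close>, and k times the inscribed ball has radius t.
  Hence the t-neighbourhood of \<open>A\<close> lies in its homothetic image with centre
  \<open>c\<close> and ratio 1 + k.\<close>

lemma homothety_outer:
  fixes A :: "'a::euclidean_space set"
  assumes "convex A" "ball c \<rho> \<subseteq> A" "\<rho> > 0" "t > 0" "a \<in> A" "dist a x < t"
  shows "x \<in> (\<lambda>y. (1 + t / \<rho>) *\<^sub>R y + (- (t / \<rho>)) *\<^sub>R c) ` A"
proof -
  define k where "k = t / \<rho>"
  have k: "k > 0" unfolding k_def using assms by simp
  \<comment> \<open>The displacement from \<open>a\<close> to \<open>x\<close>, magnified to the
    scale of the inscribed ball; it still ends inside that ball.\<close>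
  define w where "w = c + (1 / k) *\<^sub>R (x - a)"
  have "norm (x - a) < t" using assms(6) by (simp add: dist_norm norm_minus_commute)
  then have "norm (x - a) / k < \<rho>" using assms by (simp add: k_def field_simps)
  then have "norm ((1 / k) *\<^sub>R (x - a)) < \<rho>" using k by simp
  then have "w \<in> A" using assms(2) unfolding w_def by (auto simp: dist_norm)
  define y where "y = (1 / (1 + k)) *\<^sub>R a + (k / (1 + k)) *\<^sub>R w"
  have "y \<in> A" unfolding y_def
    using assms(1,5) \<open>w \<in> A\<close> k by (intro convexD) (auto simp: field_simps)
  moreover have "(1 + k) *\<^sub>R y = a + k *\<^sub>R w"
    unfolding y_def using k by (simp add: scaleR_add_right)
  then have "x = (1 + k) *\<^sub>R y + (- k) *\<^sub>R c"
    unfolding w_def using k by (simp add: scaleR_add_right)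
  ultimately show ?thesis unfolding k_def by blast
qed

text \<open>The dual statement: after contraction towards \<open>c\<close>, a displacement of length
  less than t is the fraction t / \<rho> of a displacement inside the inscribed ball, so the
  displaced point is a convex combination of two points of \<open>A\<close>.\<close>

lemma homothety_inner:
  fixes A :: "'a::euclidean_space set"
  assumes "convex A" "ball c \<rho> \<subseteq> A" "0 < t" "t < \<rho>" "y \<in> A"
  shows "ball ((1 - t / \<rho>) *\<^sub>R y + (t / \<rho>) *\<^sub>R c) t \<subseteq> A"
proof
  fix x assume x: "x \<in> ball ((1 - t / \<rho>) *\<^sub>R y + (t / \<rho>) *\<^sub>R c) t"
  define k where "k = t / \<rho>"
  have k: "k > 0" "k < 1" unfolding k_def using assms by auto
  define e where "e = x - ((1 - k) *\<^sub>R y + k *\<^sub>R c)"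
  have "norm e < t" using x unfolding e_def k_def by (simp add: dist_norm norm_minus_commute)
  then have "norm e / k < \<rho>" using assms by (simp add: k_def field_simps)
  then have "norm ((1 / k) *\<^sub>R e) < \<rho>" using k by simp
  then have "c + (1 / k) *\<^sub>R e \<in> A" using assms(2) by (auto simp: dist_norm)
  then have "(1 - k) *\<^sub>R y + k *\<^sub>R (c + (1 / k) *\<^sub>R e) \<in> A"
    using assms(1,5) k by (intro convexD) auto
  moreover have "(1 - k) *\<^sub>R y + k *\<^sub>R (c + (1 / k) *\<^sub>R e) = x"
    unfolding e_def using k by (simp add: scaleR_add_right)
  ultimately show "x \<in> A" by simp
qed

lemma affine_image_measure:
  fixes A :: "'a::euclidean_space set"
  assumes "A \<in> sets borel" "bounded A" "m \<noteq> 0"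
  shows "(\<lambda>y. m *\<^sub>R y + v) ` A \<in> sets borel" "bounded ((\<lambda>y. m *\<^sub>R y + v) ` A)"
    "measure lborel ((\<lambda>y. m *\<^sub>R y + v) ` A) = \<bar>m\<bar> ^ DIM('a) * measure lborel A"
proof -
  have eq: "(\<lambda>y. m *\<^sub>R y + v) ` A = (\<lambda>x. (1 / m) *\<^sub>R (x - v)) -` A \<inter> space borel"
  proof safe
    fix x assume "(1 / m) *\<^sub>R (x - v) \<in> A"
    moreover have "x = m *\<^sub>R ((1 / m) *\<^sub>R (x - v)) + v" using assms(3) by simp
    ultimately show "x \<in> (\<lambda>y. m *\<^sub>R y + v) ` A" by blast
  qed (use assms in auto)
  show s: "(\<lambda>y. m *\<^sub>R y + v) ` A \<in> sets borel"
    unfolding eq by (rule measurable_sets[OF _ assms(1)]) measurable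
  have "(\<lambda>y. m *\<^sub>R y + v) ` A = (\<lambda>y. v + y) ` (\<lambda>y. m *\<^sub>R y) ` A"
    by (auto simp: image_image add.commute)
  then show "bounded ((\<lambda>y. m *\<^sub>R y + v) ` A)"
    using assms by (simp add: bounded_translation bounded_scaling)
  show "measure lborel ((\<lambda>y. m *\<^sub>R y + v) ` A) = \<bar>m\<bar> ^ DIM('a) * measure lborel A"
    using measure_lebesgue_affine[of m v A] s assms(1) by (simp add: measure_completion add.commute)
qed

text \<open>Disjoint cells of equal volume turn a count of lattice points into a volume, which is
  compared with that of an affine copy of \<open>A\<close> containing, or contained in, the
  cells.\<close>

lemma lattice_sandwich:
  fixes A :: "'a::euclidean_space set" and M :: real
  assumes "A \<in> sets borel" "bounded A" "M > 0" "finite F" "F \<subseteq> lattice M" "m \<noteq> 0"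
  shows "(\<And>z. z \<in> F \<Longrightarrow> cell M z \<subseteq> (\<lambda>y. m *\<^sub>R y + v) ` A) \<Longrightarrow>
      card F * M ^ DIM('a) \<le> \<bar>m\<bar> ^ DIM('a) * measure lborel A"
    and "(\<lambda>y. m *\<^sub>R y + v) ` A \<subseteq> (\<Union>z\<in>F. cell M z) \<Longrightarrow>
      \<bar>m\<bar> ^ DIM('a) * measure lborel A \<le> card F * M ^ DIM('a)"
  unfolding affine_image_measure(3)[OF assms(1,2,6), of v, symmetric] card_cells[OF assms(3-5), symmetric]
  using affine_image_measure(1,2)[OF assms(1,2,6), of v] cell_measure(1)[OF assms(3)] assms(4)
  by (intro measure_lborel_mono_bounded; auto simp: bounded_cell[OF assms(3)] subset_iff)+

context
  fixes A :: "'a::euclidean_space set" and M R \<rho> :: real and c :: 'a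
  assumes A: "A \<in> sets borel" "bounded A" "convex A" and M: "M > 0"
    and R: "M * DIM('a) \<le> R" and ball: "ball c \<rho> \<subseteq> A" and rho: "2 * R < \<rho>"
begin

lemma cell_radius_pos: "R > 0"
  using M R by (metis DIM_positive less_le_trans mult_pos_pos of_nat_0_less_iff)

lemma inradius_pos: "\<rho> > 0"
  using cell_radius_pos rho by simp

lemma convex_measure_pos: "measure lborel A > 0"
proof -
  have "measure lborel (ball c \<rho>) \<le> measure lborel A"
    using A ball by (intro measure_lborel_mono_bounded) auto
  moreover have "measure lborel (ball c \<rho>) > 0"
    using content_ball_pos[OF inradius_pos, of c] by simp
  ultimately show ?thesis by linarith
qed

text \<open>The distance 2 * R is made up of the way from a point of the cell to its lattice point
  and from there to \<open>A\<close>.\<close>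

lemma card_near_pts_le: "card (near_pts M R A) * M ^ DIM('a) \<le> (1 + 2 * R / \<rho>) ^ DIM('a) * measure lborel A"
proof -
  have incl: "cell M z \<subseteq> (\<lambda>y. (1 + 2 * R / \<rho>) *\<^sub>R y + (- (2 * R / \<rho>)) *\<^sub>R c) ` A" if z: "z \<in> near_pts M R A" for z
  proof
    fix x assume "x \<in> cell M z"
    then have "dist z x < R" using dist_cell[OF _ M] R by fastforce
    moreover obtain a where "a \<in> A" "dist z a < R" using z unfolding near_pts_def by auto
    moreover have "dist a x < 2 * R"
      using dist_triangle[of a x z] \<open>dist z x < R\<close> \<open>dist z a < R\<close> by (simp add: dist_commute)
    ultimately show "x \<in> (\<lambda>y. (1 + 2 * R / \<rho>) *\<^sub>R y + (- (2 * R / \<rho>)) *\<^sub>R c) ` A"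
      using A(3) ball inradius_pos cell_radius_pos by (intro homothety_outer[of A c \<rho> "2 * R" a x]) auto
  qed
  have "1 + 2 * R / \<rho> > 0" using cell_radius_pos inradius_pos by (simp add: add_pos_pos)
  then have m: "1 + 2 * R / \<rho> \<noteq> 0" by simp
  have "card (near_pts M R A) * M ^ DIM('a) \<le> \<bar>1 + 2 * R / \<rho>\<bar> ^ DIM('a) * measure lborel A"
    by (rule lattice_sandwich(1)[OF A(1,2) M finite_near_pts[OF M A(2)] near_pts_subset_lattice m incl])
  then show ?thesis using \<open>1 + 2 * R / \<rho> > 0\<close> by simp
qed

lemma card_inner_pts_ge: "(1 - 2 * R / \<rho>) ^ DIM('a) * measure lborel A \<le> card (inner_pts M R A) * M ^ DIM('a)"
proof -
  have fin: "finite (inner_pts M R A)"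
    by (rule finite_subset[OF inner_pts_subset_near_pts[OF cell_radius_pos] finite_near_pts[OF M A(2)]])
  have "(\<lambda>y. (1 - 2 * R / \<rho>) *\<^sub>R y + (2 * R / \<rho>) *\<^sub>R c) ` A \<subseteq> (\<Union>z\<in>inner_pts M R A. cell M z)"
  proof
    fix x assume "x \<in> (\<lambda>y. (1 - 2 * R / \<rho>) *\<^sub>R y + (2 * R / \<rho>) *\<^sub>R c) ` A"
    then obtain y where y: "y \<in> A" "x = (1 - 2 * R / \<rho>) *\<^sub>R y + (2 * R / \<rho>) *\<^sub>R c" by blast
    have b: "ball x (2 * R) \<subseteq> A"
      unfolding y(2) using cell_radius_pos rho by (intro homothety_inner A(3) ball y) auto
    obtain z where z: "z \<in> lattice M" "x \<in> cell M z" using ex_cell[OF M] by blast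
    have "dist z x < R" using dist_cell[OF z(2) M] R by linarith
    then have "dist x y < 2 * R" if "dist z y < R" for y
      using that dist_triangle[of x y z] by (simp add: dist_commute)
    then have "ball z R \<subseteq> ball x (2 * R)" by auto
    then show "x \<in> (\<Union>z\<in>inner_pts M R A. cell M z)" using z b unfolding inner_pts_def by blast
  qed
  moreover have pos: "1 - 2 * R / \<rho> > 0" using rho inradius_pos by simp
  moreover have "1 - 2 * R / \<rho> \<noteq> 0" using pos by linarith
  moreover have "inner_pts M R A \<subseteq> lattice M" unfolding inner_pts_def by blast
  ultimately have "\<bar>1 - 2 * R / \<rho>\<bar> ^ DIM('a) * measure lborel A \<le> card (inner_pts M R A) * M ^ DIM('a)"
    by (intro lattice_sandwich(2)[OF A(1,2) M fin, of _ "(2 * R / \<rho>) *\<^sub>R c"])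
  then show ?thesis using \<open>1 - 2 * R / \<rho> > 0\<close> by simp
qed

lemma card_near_pts_ge: "measure lborel A \<le> card (near_pts M R A) * M ^ DIM('a)"
proof -
  have "A \<subseteq> (\<Union>z\<in>near_pts M R A. cell M z)"
  proof
    fix x assume x: "x \<in> A"
    obtain z where z: "z \<in> lattice M" "x \<in> cell M z" using ex_cell[OF M] by blast
    have "dist z x < R" using dist_cell[OF z(2) M] R by linarith
    then have "x \<in> ball z R \<inter> A" using x by simp
    then show "x \<in> (\<Union>z\<in>near_pts M R A. cell M z)" using z unfolding near_pts_def by blast
  qed
  then have "\<bar>1\<bar> ^ DIM('a) * measure lborel A \<le> card (near_pts M R A) * M ^ DIM('a)"
    by (intro lattice_sandwich(2)[OF A(1,2) M finite_near_pts[OF M A(2)] near_pts_subset_lattice, of _ 0]) auto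
  then show ?thesis by simp
qed

lemma near_pts_nonempty: "near_pts M R A \<noteq> {}"
  using card_near_pts_ge convex_measure_pos by auto

text \<open>By convexity the midpoint of two points of \<open>A\<close> is in \<open>A\<close>, so
  half of any point in a cell at a sum \<open>z + w\<close> is close to \<open>A\<close>. Such cells
  thus lie in a copy of \<open>A\<close> enlarged by 2 * (1 + 2 * R / \<rho>), which is less than 4
  because 2 * R is less than \<rho>.\<close>

lemma near_pts_doubling:
  "card {z + w |z w. z \<in> near_pts M R A \<and> w \<in> near_pts M R A} \<le> 4 ^ DIM('a) * card (near_pts M R A)"
proof -
  let ?D = "near_pts M R A"
  let ?S = "{z + w |z w. z \<in> ?D \<and> w \<in> ?D}"
  have fin: "finite ?S"
    using finite_near_pts[OF M A(2), of R] by (auto intro!: finite_image_set2)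
  have sub: "?S \<subseteq> lattice M" unfolding near_pts_def using lattice_add by blast
  have incl: "cell M u \<subseteq> (\<lambda>y. (2 * (1 + 2 * R / \<rho>)) *\<^sub>R y + (- (4 * R / \<rho>)) *\<^sub>R c) ` A" if u: "u \<in> ?S" for u
  proof
    fix x assume x: "x \<in> cell M u"
    obtain z w where zw: "u = z + w" "z \<in> ?D" "w \<in> ?D" using u by blast
    obtain a where a: "a \<in> A" "dist z a < R" using zw unfolding near_pts_def by auto
    obtain b where b: "b \<in> A" "dist w b < R" using zw unfolding near_pts_def by auto
    have "dist u x < R" using dist_cell[OF x M] R by linarith
    have m: "(1 / 2) *\<^sub>R a + (1 / 2) *\<^sub>R b \<in> A" using a b by (intro convexD[OF A(3)]) auto
    have "a + b - x = (a - z) + (b - w) + (u - x)" unfolding zw by simp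
    then have "norm (a + b - x) \<le> norm (a - z) + norm (b - w) + norm (u - x)"
      by (metis norm_triangle_ineq norm_triangle_mono order_refl)
    \<comment> \<open>Three errors below \<open>R\<close> are rounded up to 4 * R, so that halving
      yields the distance 2 * R used in the other estimates.\<close>
    then have "norm (a + b - x) < 4 * R"
      using a(2) b(2) \<open>dist u x < R\<close> cell_radius_pos by (simp add: dist_norm norm_minus_commute)
    moreover have "((1 / 2) *\<^sub>R a + (1 / 2) *\<^sub>R b) - (1 / 2) *\<^sub>R x = (1 / 2) *\<^sub>R (a + b - x)"
      by (simp add: algebra_simps)
    ultimately have "dist ((1 / 2) *\<^sub>R a + (1 / 2) *\<^sub>R b) ((1 / 2) *\<^sub>R x) < 2 * R"
      by (simp add: dist_norm)
    then have "(1 / 2) *\<^sub>R x \<in> (\<lambda>y. (1 + 2 * R / \<rho>) *\<^sub>R y + (- (2 * R / \<rho>)) *\<^sub>R c) ` A"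
      using A(3) ball inradius_pos cell_radius_pos m by (intro homothety_outer) auto
    then obtain y where y: "y \<in> A" "(1 / 2) *\<^sub>R x = (1 + 2 * R / \<rho>) *\<^sub>R y + (- (2 * R / \<rho>)) *\<^sub>R c"
      by blast
    then have "2 *\<^sub>R ((1 / 2) *\<^sub>R x) = 2 *\<^sub>R ((1 + 2 * R / \<rho>) *\<^sub>R y + (- (2 * R / \<rho>)) *\<^sub>R c)" by simp
    then have "x = (2 * (1 + 2 * R / \<rho>)) *\<^sub>R y + (- (4 * R / \<rho>)) *\<^sub>R c"
      by (simp add: scaleR_diff_right)
    then show "x \<in> (\<lambda>y. (2 * (1 + 2 * R / \<rho>)) *\<^sub>R y + (- (4 * R / \<rho>)) *\<^sub>R c) ` A" using y(1) by blast
  qed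
  have q: "1 + 2 * R / \<rho> > 0" "2 * R / \<rho> < 1" using cell_radius_pos inradius_pos rho by (auto simp: add_pos_pos)
  then have m: "2 * (1 + 2 * R / \<rho>) \<noteq> 0" by simp
  have "card ?S * M ^ DIM('a) \<le> \<bar>2 * (1 + 2 * R / \<rho>)\<bar> ^ DIM('a) * measure lborel A"
    by (rule lattice_sandwich(1)[OF A(1,2) M fin sub m incl])
  also have "\<dots> \<le> 4 ^ DIM('a) * measure lborel A"
    using q by (intro mult_right_mono power_mono) auto
  also have "\<dots> \<le> 4 ^ DIM('a) * (card ?D * M ^ DIM('a))"
    using card_near_pts_ge by (intro mult_left_mono) auto
  finally have "real (card ?S) \<le> 4 ^ DIM('a) * real (card ?D)" using M by simp
  then have "real (card ?S) \<le> real (4 ^ DIM('a) * card ?D)" by simp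
  then show ?thesis unfolding of_nat_le_iff .
qed

end

text \<open>The threshold depends on the inscribed ball alone, not on the shape of the set. The
  tolerance is split into halves because the rim count is the difference of an upper and a lower
  estimate.\<close>

lemma near_pts_asymptotics:
  fixes M R e :: real
  assumes M: "M > 0" and R: "M * DIM('a) \<le> R" and e: "e > 0"
  obtains \<rho>0 where "2 * R < \<rho>0" "\<And>(A :: 'a::euclidean_space set) c. A \<in> sets borel \<Longrightarrow> bounded A \<Longrightarrow> convex A \<Longrightarrow>
    ball c \<rho>0 \<subseteq> A \<Longrightarrow> measure lborel A > 0 \<and> measure lborel A \<le> card (near_pts M R A) * M ^ DIM('a) \<and>
      card (near_pts M R A) * M ^ DIM('a) \<le> (1 + e) * measure lborel A \<and>
      card (near_pts M R A - inner_pts M R A) * M ^ DIM('a) \<le> e * measure lborel A"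
proof -
  have lim: "((\<lambda>\<rho>. (1 + 2 * R / \<rho>) ^ DIM('a)) \<longlongrightarrow> (1 + 0) ^ DIM('a)) at_top"
    "((\<lambda>\<rho>. (1 - 2 * R / \<rho>) ^ DIM('a)) \<longlongrightarrow> (1 - 0) ^ DIM('a)) at_top"
    by (intro tendsto_power tendsto_add tendsto_diff tendsto_const
        tendsto_divide_0[OF tendsto_const] filterlim_at_top_imp_at_infinity filterlim_ident)+
  have "eventually (\<lambda>\<rho>. (1 + 2 * R / \<rho>) ^ DIM('a) < 1 + e / 2) at_top"
    "eventually (\<lambda>\<rho>. (1 - 2 * R / \<rho>) ^ DIM('a) > 1 - e / 2) at_top"
    using order_tendstoD(2)[OF lim(1), of "1 + e / 2"] order_tendstoD(1)[OF lim(2), of "1 - e / 2"] e by auto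
  then have "eventually (\<lambda>\<rho>. (1 + 2 * R / \<rho>) ^ DIM('a) < 1 + e / 2 \<and>
      (1 - 2 * R / \<rho>) ^ DIM('a) > 1 - e / 2 \<and> \<rho> > 2 * R) at_top"
    using eventually_gt_at_top[of "2 * R"] by eventually_elim auto
  then obtain \<rho>0 where \<rho>: "(1 + 2 * R / \<rho>0) ^ DIM('a) < 1 + e / 2" "(1 - 2 * R / \<rho>0) ^ DIM('a) > 1 - e / 2"
    "2 * R < \<rho>0"
    by (metis (mono_tags, lifting) eventually_at_top_linorder order_refl)
  have "measure lborel A > 0 \<and> measure lborel A \<le> card (near_pts M R A) * M ^ DIM('a) \<and>
      card (near_pts M R A) * M ^ DIM('a) \<le> (1 + e) * measure lborel A \<and>
      card (near_pts M R A - inner_pts M R A) * M ^ DIM('a) \<le> e * measure lborel A"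
    if A: "A \<in> sets borel" "bounded A" "convex A" "ball c \<rho>0 \<subseteq> A" for A :: "'a set" and c
  proof -
    note AA = A(1-3) M R A(4) \<rho>(3)
    let ?v = "measure lborel A"
    have v: "?v > 0" by (rule convex_measure_pos[OF AA])
    have "card (near_pts M R A) * M ^ DIM('a) \<le> (1 + e / 2) * ?v"
      using card_near_pts_le[OF AA] \<rho>(1) v by (smt (verit) mult_right_mono)
    moreover have "(1 - e / 2) * ?v \<le> card (inner_pts M R A) * M ^ DIM('a)"
      using card_inner_pts_ge[OF AA] \<rho>(2) v by (smt (verit) mult_right_mono)
    moreover have "R > 0" by (rule cell_radius_pos[OF AA])
    then have "card (near_pts M R A - inner_pts M R A) = card (near_pts M R A) - real (card (inner_pts M R A))"
      using inner_pts_subset_near_pts[of R M A] finite_near_pts[OF M A(2), of R]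
      by (simp add: card_Diff_subset finite_subset card_mono of_nat_diff)
    then have "card (near_pts M R A - inner_pts M R A) * M ^ DIM('a)
        = card (near_pts M R A) * M ^ DIM('a) - card (inner_pts M R A) * M ^ DIM('a)"
      by (simp add: left_diff_distrib)
    moreover have "e * ?v > 0" using e v by simp
    ultimately show ?thesis
      using v card_near_pts_ge[OF AA] by (simp add: algebra_simps)
  qed
  then show thesis using that[OF \<rho>(3)] by blast
qed

lemma convex_cell: "convex (cell M z)"
proof -
  have "cell M z = (\<Inter>b\<in>Basis. {x. b \<bullet> x \<ge> z \<bullet> b} \<inter> {x. b \<bullet> x < z \<bullet> b + M})"
    unfolding cell_def by (auto simp: inner_commute)
  then show ?thesis
    by (auto intro!: convex_INT convex_Int convex_halfspace_ge convex_halfspace_lt)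
qed

text \<open>A large cell is itself a convex set of large inradius; this allows its own boundary
  layer to be counted by \<open>near_pts_asymptotics\<close>.\<close>

lemma ball_in_cell:
  assumes "M > 0"
  shows "ball (z + (\<Sum>b\<in>Basis. (M / 2) *\<^sub>R b)) (M / 2) \<subseteq> cell M (z :: 'a::euclidean_space)"
proof
  fix x assume x: "x \<in> ball (z + (\<Sum>b\<in>Basis. (M / 2) *\<^sub>R b)) (M / 2)"
  define c where "c = z + (\<Sum>b\<in>Basis. (M / 2) *\<^sub>R b)"
  have "\<bar>x \<bullet> b - (z \<bullet> b + M / 2)\<bar> < M / 2" if b: "b \<in> Basis" for b
  proof -
    have "c \<bullet> b = z \<bullet> b + M / 2"
      unfolding c_def using b by (simp add: inner_add_left inner_sum_left_Basis)
    moreover have "\<bar>(x - c) \<bullet> b\<bar> \<le> norm (x - c)" using b by (rule Basis_le_norm)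
    ultimately show ?thesis
      using x by (simp add: c_def[symmetric] dist_norm norm_minus_commute inner_diff_left)
  qed
  then have "z \<bullet> b \<le> x \<bullet> b \<and> x \<bullet> b < z \<bullet> b + M" if "b \<in> Basis" for b
    using that by (smt (verit) field_sum_of_halves)
  then show "x \<in> cell M z" unfolding cell_def by blast
qed

section \<open>Measurability on the space of configurations\<close>

lemma space_config_space: "space config_space = configs"
  unfolding config_space_def by (rule space_measure_of) auto

lemma sets_config_space_card:
  assumes "B \<in> sets borel" "bounded (fst ` B)"
  shows "{\<xi> \<in> configs. card (\<xi> \<inter> B) = k} \<in> sets config_space"
proof -
  have "{{\<xi> \<in> configs. card (\<xi> \<inter> B) = k} | B k. B \<in> sets (borel :: ('a \<times> 'b) measure) \<and> bounded (fst ` B)} \<subseteq> Pow configs"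
    by auto
  then show ?thesis
    unfolding config_space_def using assms by (auto simp: sets_measure_of intro!: sigma_sets.Basic)
qed

lemma measurable_card_Int:
  assumes "B \<in> sets borel" "bounded (fst ` B)"
  shows "(\<lambda>\<xi>. card (\<xi> \<inter> B)) \<in> measurable config_space (count_space UNIV)"
proof (rule measurableI)
  fix X :: "nat set" assume "X \<in> sets (count_space UNIV)"
  have "(\<lambda>\<xi>. card (\<xi> \<inter> B)) -` X \<inter> space config_space = (\<Union>k\<in>X. {\<xi> \<in> configs. card (\<xi> \<inter> B) = k})"
    unfolding space_config_space by auto
  then show "(\<lambda>\<xi>. card (\<xi> \<inter> B)) -` X \<inter> space config_space \<in> sets config_space"
    using sets_config_space_card[OF assms] by (auto intro!: sets.countable_UN)
qed simp

lemma cylinder_borel: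
  fixes A :: "'a::euclidean_space set"
  assumes "A \<in> sets borel"
  shows "A \<times> (UNIV :: 'm::polish_space set) \<in> sets borel"
proof -
  have "(fst :: 'a \<times> 'm \<Rightarrow> 'a) \<in> borel_measurable borel"
    by (intro borel_measurable_continuous_onI continuous_intros)
  then have "fst -` A \<inter> space borel \<in> sets (borel :: ('a \<times> 'm) measure)"
    using assms by (rule measurable_sets)
  moreover have "fst -` A \<inter> space (borel :: ('a \<times> 'm) measure) = A \<times> UNIV" by auto
  ultimately show ?thesis by simp
qed

lemma measurable_card_restr_Int:
  assumes "A \<in> sets borel" "bounded A" "B \<in> sets borel"
  shows "(\<lambda>\<xi>. card (restr \<xi> A \<inter> B)) \<in> measurable config_space (count_space UNIV)"
proof -
  have "restr \<xi> A \<inter> B = \<xi> \<inter> (A \<times> UNIV \<inter> B)" for \<xi> :: "('a \<times> 'b) set"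
    unfolding restr_def by auto
  moreover have "A \<times> UNIV \<inter> B \<in> sets borel"
    using cylinder_borel[OF assms(1)] assms(3) by blast
  moreover have "bounded (fst ` (A \<times> UNIV \<inter> B))"
    by (rule bounded_subset[OF assms(2)]) auto
  ultimately show ?thesis using measurable_card_Int by simp
qed

lemma measurable_card_restr:
  assumes "A \<in> sets borel" "bounded A"
  shows "(\<lambda>\<xi> :: ('a::euclidean_space \<times> 'm::polish_space) set. card (restr \<xi> A)) \<in> measurable config_space (count_space UNIV)"
  using measurable_card_restr_Int[OF assms, of UNIV] by simp

lemma finite_restr: "\<xi> \<in> configs \<Longrightarrow> bounded A \<Longrightarrow> finite (restr \<xi> A)"
  unfolding configs_def restr_def by blast

lemma inj_on_fst_config: "\<xi> \<in> configs \<Longrightarrow> inj_on fst \<xi>"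
  unfolding configs_def by blast

lemma inj_on_fst_restr: "\<xi> \<in> configs \<Longrightarrow> inj_on fst (restr \<xi> A)"
  using inj_on_subset[OF inj_on_fst_config] unfolding restr_def by blast

section \<open>Translations of configurations\<close>

lemma Tr_Tr: "Tr a (Tr b p) = Tr (a + b) p"
  unfolding Tr_def by (cases p) (simp add: algebra_simps)

lemma inj_Tr: "inj_on (Tr a) S"
  unfolding Tr_def by (auto simp: inj_on_def)

lemma shift_shift: "shift a (shift b \<xi>) = shift (a + b) \<xi>"
  unfolding shift_def by (simp add: image_image Tr_Tr)

lemma shift_Int: "shift a \<xi> \<inter> B = Tr a ` (\<xi> \<inter> Tr a -` B)"
  unfolding shift_def by auto

lemma restr_shift: "restr (shift a \<xi>) A = shift a (restr \<xi> ((\<lambda>x. x - a) ` A))"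
proof -
  have "p \<in> Tr a -` (A \<times> UNIV) \<longleftrightarrow> p \<in> (\<lambda>x. x - a) ` A \<times> UNIV" for p :: "'a \<times> 'b"
    unfolding Tr_def by (cases p) (auto simp: image_iff eq_diff_eq)
  then have "Tr a -` (A \<times> UNIV) = (\<lambda>x. x - a) ` A \<times> (UNIV :: 'b set)" by (intro set_eqI)
  then show ?thesis unfolding restr_def by (simp only: shift_Int) (simp add: shift_def)
qed

lemma shift_configs:
  assumes "\<xi> \<in> configs"
  shows "shift a \<xi> \<in> configs"
proof -
  have "finite (shift a \<xi> \<inter> (B \<times> UNIV))" if "bounded B" for B
  proof -
    have "bounded ((\<lambda>x. x - a) ` B)"
      using bounded_translation_minus[OF that, of a] by simp
    then have "finite (restr (shift a \<xi>) B)"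
      unfolding restr_shift using finite_restr[OF assms] by (simp add: shift_def)
    then show ?thesis by (simp add: restr_def)
  qed
  moreover have "inj_on fst (shift a \<xi>)"
    using inj_on_fst_config[OF assms] unfolding shift_def Tr_def inj_on_def by force
  ultimately show ?thesis unfolding configs_def by blast
qed

lemma Tr_borel: "Tr a \<in> borel_measurable (borel :: ('a::euclidean_space \<times> 'm::polish_space) measure)"
  unfolding Tr_def case_prod_beta by (intro borel_measurable_continuous_onI continuous_intros)

lemma measurable_shift:
  "shift a \<in> measurable (config_space :: ('a::euclidean_space \<times> 'm::polish_space) set measure) config_space"
proof (subst (2) config_space_def, rule measurable_measure_of)
  fix Y assume "Y \<in> {{\<xi> \<in> configs. card (\<xi> \<inter> B) = k} | B k. B \<in> sets (borel :: ('a \<times> 'm) measure) \<and> bounded (fst ` B)}"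
  then obtain B k where B: "B \<in> sets borel" "bounded (fst ` B)" and Y: "Y = {\<xi> \<in> configs. card (\<xi> \<inter> B) = k}"
    by blast
  have "Tr a -` B \<inter> space borel \<in> sets borel" using Tr_borel B(1) by (rule measurable_sets)
  then have B': "Tr a -` B \<in> sets borel" by simp
  have "fst ` (Tr a -` B) \<subseteq> (\<lambda>x. x - a) ` (fst ` B)"
    unfolding Tr_def by (force simp: image_iff)
  then have bd: "bounded (fst ` (Tr a -` B))"
    by (rule bounded_subset[rotated]) (use bounded_translation_minus[OF B(2), of a] in simp)
  have "card (shift a \<xi> \<inter> B) = card (\<xi> \<inter> Tr a -` B)" for \<xi>
    unfolding shift_Int by (rule card_image[OF inj_Tr])
  then have "shift a -` Y \<inter> configs = {\<xi> \<in> configs. card (\<xi> \<inter> Tr a -` B) = k}"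
    unfolding Y using shift_configs by auto
  then show "shift a -` Y \<inter> space config_space \<in> sets config_space"
    using sets_config_space_card[OF B' bd, of k] by (simp add: space_config_space)
qed (use shift_configs in \<open>auto simp: space_config_space\<close>)

text \<open>The \<sigma>-algebra is generated by counts of single points only. For a box the number
  of tuples is a product of such counts, and a Dynkin argument extends measurability to all
  measurable sets of tuples. Values are real because the complement step subtracts.\<close>

lemma measurable_card_tuples:
  fixes A :: "'a::euclidean_space set" and G :: "(nat \<Rightarrow> 'a \<times> 'm::polish_space) set"
  assumes A: "A \<in> sets borel" "bounded A" and G: "G \<in> sets (PiM {..<N} (\<lambda>_. borel))"
  shows "(\<lambda>\<xi>. real (card ((\<Pi>\<^sub>E i\<in>{..<N}. restr \<xi> A) \<inter> G))) \<in> borel_measurable config_space"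
proof -
  define E where "E = {(\<Pi>\<^sub>E i\<in>{..<N}. X i) |X. X \<in> (\<Pi> j\<in>{..<N}. sets (borel :: ('a \<times> 'm) measure))}"
  define \<Omega> where "\<Omega> = (\<Pi>\<^sub>E i\<in>{..<N}. UNIV :: ('a \<times> 'm) set)"
  have alg: "prod_algebra {..<N} (\<lambda>_. borel :: ('a \<times> 'm) measure) = E"
    unfolding E_def by (rule prod_algebra_eq_finite) simp
  have int: "Int_stable E" using Int_stable_prod_algebra alg by metis
  have sub: "E \<subseteq> Pow \<Omega>" unfolding E_def \<Omega>_def by (auto simp: PiE_def)
  have sets: "sets (PiM {..<N} (\<lambda>_. borel :: ('a \<times> 'm) measure)) = sigma_sets \<Omega> E"
    unfolding sets_PiM alg \<Omega>_def by simp
  define T where "T \<xi> = (\<Pi>\<^sub>E i\<in>{..<N}. restr \<xi> A)" for \<xi> :: "('a \<times> 'm) set"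
  have fin: "finite (T \<xi>)" if "\<xi> \<in> space config_space" for \<xi>
    unfolding T_def using that finite_restr A(2) by (intro finite_PiE) (auto simp: space_config_space)
  have T_sub: "T \<xi> \<subseteq> \<Omega>" for \<xi> unfolding T_def \<Omega>_def by auto
  have basic0: "(\<lambda>\<xi>. real (card (T \<xi> \<inter> X))) \<in> borel_measurable config_space" if "X \<in> E" for X
  proof -
    obtain Y where Y: "X = (\<Pi>\<^sub>E i\<in>{..<N}. Y i)" "\<And>i. i < N \<Longrightarrow> Y i \<in> sets borel"
      using \<open>X \<in> E\<close> unfolding E_def by (auto simp: Pi_iff)
    have "real (card (T \<xi> \<inter> X)) = (\<Prod>i<N. real (card (restr \<xi> A \<inter> Y i)))" for \<xi>
      unfolding T_def Y(1) PiE_Int by (simp add: card_PiE)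
    moreover have "(\<lambda>\<xi>. real (card (restr \<xi> A \<inter> Y i))) \<in> borel_measurable config_space" if "i < N" for i
      by (rule measurable_compose[OF measurable_card_restr_Int[OF A Y(2)[OF that]]]) simp
    ultimately show ?thesis by simp
  qed
  have "G \<in> sigma_sets \<Omega> E" using G sets by simp
  from int sub this have "(\<lambda>\<xi>. real (card (T \<xi> \<inter> G))) \<in> borel_measurable config_space"
  proof (induction rule: sigma_sets_induct_disjoint)
    case (basic X)
    then show ?case by (rule basic0)
  next
    case (compl X)
    have "\<Omega> \<in> E" unfolding E_def \<Omega>_def by (auto intro!: exI[of _ "\<lambda>_. UNIV"])
    from basic0[OF this] have "(\<lambda>\<xi>. real (card (T \<xi> \<inter> \<Omega>)) - real (card (T \<xi> \<inter> X))) \<in> borel_measurable config_space"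
      using compl by simp
    moreover have "real (card (T \<xi> \<inter> \<Omega>)) - real (card (T \<xi> \<inter> X)) = real (card (T \<xi> \<inter> (\<Omega> - X)))"
      if "\<xi> \<in> space config_space" for \<xi>
    proof -
      have "T \<xi> \<inter> \<Omega> = (T \<xi> \<inter> X) \<union> (T \<xi> \<inter> (\<Omega> - X))"
        using T_sub[of \<xi>] by blast
      moreover have "card ((T \<xi> \<inter> X) \<union> (T \<xi> \<inter> (\<Omega> - X))) = card (T \<xi> \<inter> X) + card (T \<xi> \<inter> (\<Omega> - X))"
        using fin[OF that] by (intro card_Un_disjoint) auto
      ultimately show ?thesis by simp
    qed
    ultimately show ?case by (simp cong: measurable_cong)
  next
    case (union X)
    have "(\<lambda>i. real (card (T \<xi> \<inter> X i))) sums real (card (T \<xi> \<inter> (\<Union>i. X i)))"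
      if "\<xi> \<in> space config_space" for \<xi>
    proof -
      have f: "finite (T \<xi>)" using fin that .
      \<comment> \<open>Counting measure on the finitely many tuples supplies countable additivity
        of the counts.\<close>
      interpret finite_measure "count_space (T \<xi>)" using f by (rule finite_measure_count_space)
      have "(\<lambda>i. measure (count_space (T \<xi>)) (T \<xi> \<inter> X i)) sums measure (count_space (T \<xi>)) (\<Union>i. T \<xi> \<inter> X i)"
        using union(1) by (intro finite_measure_UNION) (auto simp: disjoint_family_on_def)
      moreover have "(\<Union>i. T \<xi> \<inter> X i) = T \<xi> \<inter> (\<Union>i. X i)" by blast
      moreover have "measure (count_space (T \<xi>)) (T \<xi> \<inter> Y) = real (card (T \<xi> \<inter> Y))" for Y
        using f by (simp add: measure_def emeasure_count_space_finite)
      ultimately show ?thesis by simp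
    qed
    then have "real (card (T \<xi> \<inter> (\<Union>i. X i))) = (\<Sum>i. real (card (T \<xi> \<inter> X i)))"
      if "\<xi> \<in> space config_space" for \<xi> using that sums_unique by blast
    moreover have "(\<lambda>\<xi>. \<Sum>i. real (card (T \<xi> \<inter> X i))) \<in> borel_measurable config_space"
      using union(3) by (intro borel_measurable_suminf)
    ultimately show ?case by (simp cong: measurable_cong)
  qed simp
  then show ?thesis unfolding T_def .
qed

section \<open>Measurability of persistent Betti numbers\<close>

text \<open>With indices instead of points as vertices the complex takes only finitely many values,
  so any function of it is measurable as soon as each value is taken on a measurable set of
  tuples.\<close>

definition index_cx :: "(('a \<times> 'm) set \<Rightarrow> real) \<Rightarrow> (nat \<Rightarrow> 'a \<times> 'm) \<Rightarrow> nat \<Rightarrow> real \<Rightarrow> nat set set" where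
  "index_cx \<kappa> f N t = {J. J \<subseteq> {..<N} \<and> J \<noteq> {} \<and> \<kappa> (f ` J) \<le> t}"

lemma Kcx_image: "Kcx \<kappa> (f ` {..<N}) t = (`) (fst \<circ> f) ` index_cx \<kappa> f N t"
proof (intro equalityI subsetI)
  fix \<tau> assume "\<tau> \<in> Kcx \<kappa> (f ` {..<N}) t"
  then obtain \<sigma> where \<sigma>: "\<tau> = fst ` \<sigma>" "\<sigma> \<subseteq> f ` {..<N}" "\<sigma> \<noteq> {}" "\<kappa> \<sigma> \<le> t"
    unfolding Kcx_def by blast
  obtain J where "J \<subseteq> {..<N}" "\<sigma> = f ` J" using \<sigma>(2) by (meson subset_imageE)
  then show "\<tau> \<in> (`) (fst \<circ> f) ` index_cx \<kappa> f N t"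
    using \<sigma> unfolding index_cx_def by (auto simp: image_comp)
next
  fix \<tau> assume "\<tau> \<in> (`) (fst \<circ> f) ` index_cx \<kappa> f N t"
  then obtain J where J: "\<tau> = fst ` (f ` J)" "J \<subseteq> {..<N}" "J \<noteq> {}" "\<kappa> (f ` J) \<le> t"
    unfolding index_cx_def by (auto simp: image_comp)
  moreover have "finite (f ` J)" using finite_subset[OF J(2)] by simp
  ultimately show "\<tau> \<in> Kcx \<kappa> (f ` {..<N}) t" unfolding Kcx_def by blast
qed

lemma index_cx_props:
  "finite (index_cx \<kappa> f N t)" "\<sigma> \<in> index_cx \<kappa> f N t \<Longrightarrow> finite \<sigma>" "\<Union>(index_cx \<kappa> f N t) \<subseteq> {..<N}"
  "index_cx \<kappa> f N t \<subseteq> Pow {..<N}"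
proof -
  show *: "index_cx \<kappa> f N t \<subseteq> Pow {..<N}" unfolding index_cx_def by blast
  then show "finite (index_cx \<kappa> f N t)" by (rule finite_subset) simp
  show "\<Union>(index_cx \<kappa> f N t) \<subseteq> {..<N}" using * by blast
  show "\<sigma> \<in> index_cx \<kappa> f N t \<Longrightarrow> finite \<sigma>" using * finite_subset[of \<sigma> "{..<N}"] by auto
qed

lemma pbetti_Kcx_image:
  assumes "inj_on f {..<N}" "inj_on fst (f ` {..<N})" "r \<le> s"
  shows "pbetti T (Kcx \<kappa> (f ` {..<N}) r) (Kcx \<kappa> (f ` {..<N}) s) q
    = pbetti T (index_cx \<kappa> f N r) (index_cx \<kappa> f N s) q"
  unfolding Kcx_image
proof (rule pbetti_relabel)
  show "inj_on (fst \<circ> f) (\<Union>(index_cx \<kappa> f N s))"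
    using comp_inj_on[OF assms(1,2)] index_cx_props(3) by (rule inj_on_subset)
  show "index_cx \<kappa> f N r \<subseteq> index_cx \<kappa> f N s" unfolding index_cx_def using assms(3) by auto
  show "finite (index_cx \<kappa> f N s)" by (rule index_cx_props(1))
  show "finite \<sigma>" if "\<sigma> \<in> index_cx \<kappa> f N s" for \<sigma> using that by (rule index_cx_props(2))
qed

text \<open>Admissibility speaks of all coordinates of a tuple; a general index set \<open>J\<close>
  is handled by first selecting its coordinates.\<close>

lemma measurable_kappa_image:
  fixes \<kappa> :: "('a::euclidean_space \<times> 'm::polish_space) set \<Rightarrow> real"
  assumes \<kappa>: "admissible_kappa \<kappa>" and J: "J \<subseteq> {..<N::nat}" "J \<noteq> {}"
  shows "(\<lambda>f. \<kappa> (f ` J)) \<in> borel_measurable (PiM {..<N} (\<lambda>_. borel))"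
proof -
  define n where "n = card J"
  have "finite J" using finite_subset[OF J(1)] by simp
  then have "n \<ge> 1" unfolding n_def using J(2) by (simp add: Suc_leI card_gt_0_iff)
  obtain e where e: "bij_betw e {..<n} J"
    using ex_bij_betw_nat_finite[OF \<open>finite J\<close>] unfolding n_def atLeast0LessThan by blast
  have "e i \<in> {..<N}" if "i < n" for i
    using bij_betw_apply[OF e, of i] J(1) that by auto
  then have "(\<lambda>f. \<lambda>i\<in>{..<n}. f (e i)) \<in> measurable (PiM {..<N} (\<lambda>_. borel :: ('a \<times> 'm) measure)) (PiM {..<n} (\<lambda>_. borel))"
    by (intro measurable_restrict measurable_component_singleton) auto
  moreover have "(\<lambda>f. \<kappa> (f ` {..<n})) \<in> borel_measurable (PiM {..<n} (\<lambda>_. borel :: ('a \<times> 'm) measure))"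
    using \<kappa> \<open>n \<ge> 1\<close> unfolding admissible_kappa_def by blast
  ultimately have "(\<lambda>f. \<kappa> ((\<lambda>i\<in>{..<n}. f (e i)) ` {..<n})) \<in> borel_measurable (PiM {..<N} (\<lambda>_. borel :: ('a \<times> 'm) measure))"
    by (rule measurable_compose)
  moreover have "(\<lambda>i\<in>{..<n}. f (e i)) ` {..<n} = f ` J" for f :: "nat \<Rightarrow> 'a \<times> 'm"
    using e unfolding bij_betw_def by (auto simp: image_image[symmetric])
  ultimately show ?thesis by simp
qed

lemma measurable_index_cx:
  fixes \<kappa> :: "('a::euclidean_space \<times> 'm::polish_space) set \<Rightarrow> real"
  assumes \<kappa>: "admissible_kappa \<kappa>"
  shows "(\<lambda>f. index_cx \<kappa> f N t) \<in> measurable (PiM {..<N} (\<lambda>_. borel)) (count_space (Pow (Pow {..<N})))"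
proof (subst measurable_count_space_eq2)
  let ?P = "PiM {..<N} (\<lambda>_. borel :: ('a \<times> 'm) measure)"
  have "{f \<in> space ?P. index_cx \<kappa> f N t = U} \<in> sets ?P" if U: "U \<subseteq> Pow {..<N}" for U
  proof -
    have "{f \<in> space ?P. J \<in> index_cx \<kappa> f N t \<longleftrightarrow> J \<in> U} \<in> sets ?P" if J: "J \<in> Pow {..<N}" for J
    proof (cases "J = {}")
      case True
      then show ?thesis by (simp add: index_cx_def)
    next
      case False
      have "{f \<in> space ?P. \<kappa> (f ` J) \<le> t} \<in> sets ?P"
        using measurable_kappa_image[OF \<kappa> _ False, of N] J by simp
      moreover have "{f \<in> space ?P. J \<in> index_cx \<kappa> f N t \<longleftrightarrow> J \<in> U} =
        (if J \<in> U then {f \<in> space ?P. \<kappa> (f ` J) \<le> t} else space ?P - {f \<in> space ?P. \<kappa> (f ` J) \<le> t})"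
        using J False unfolding index_cx_def by auto
      ultimately show ?thesis by auto
    qed
    then have "(\<Inter>J\<in>Pow {..<N}. {f \<in> space ?P. J \<in> index_cx \<kappa> f N t \<longleftrightarrow> J \<in> U}) \<in> sets ?P"
      by (intro sets.finite_INT) auto
    moreover have "(\<Inter>J\<in>Pow {..<N}. {f \<in> space ?P. J \<in> index_cx \<kappa> f N t \<longleftrightarrow> J \<in> U}) = {f \<in> space ?P. index_cx \<kappa> f N t = U}"
    proof -
      have "index_cx \<kappa> f N t = U \<longleftrightarrow> (\<forall>J\<in>Pow {..<N}. J \<in> index_cx \<kappa> f N t \<longleftrightarrow> J \<in> U)" for f
        using U index_cx_props(4)[of \<kappa> f N t] by blast
      then show ?thesis by auto
    qed
    ultimately show ?thesis by simp
  qed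
  moreover have "(\<lambda>f. index_cx \<kappa> f N t) -` {U} \<inter> space ?P = {f \<in> space ?P. index_cx \<kappa> f N t = U}" for U
    by blast
  moreover have "index_cx \<kappa> f N t \<in> Pow (Pow {..<N})" for f
    by (rule PowI) (rule index_cx_props(4))
  ultimately show "(\<lambda>f. index_cx \<kappa> f N t) \<in> space ?P \<rightarrow> Pow (Pow {..<N}) \<and>
      (\<forall>U\<in>Pow (Pow {..<N}). (\<lambda>f. index_cx \<kappa> f N t) -` {U} \<inter> space ?P \<in> sets ?P)"
    by (simp del: Pow_iff) (simp add: Pow_iff)
qed simp

lemma sets_inj_on_tuples:
  "{f \<in> space (PiM {..<N} (\<lambda>_. borel :: ('b::{second_countable_topology,t2_space}) measure)). inj_on f {..<N::nat}} \<in> sets (PiM {..<N} (\<lambda>_. borel))"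
proof -
  let ?P = "PiM {..<N} (\<lambda>_. borel :: 'b measure)"
  have "{f \<in> space ?P. f i \<noteq> f j} \<in> sets ?P" if "i < N" "j < N" for i j
  proof -
    have "(\<lambda>f. (f i, f j)) \<in> measurable ?P borel"
      using that by (intro borel_measurable_Pair measurable_component_singleton) auto
    moreover have "- {p. fst p = snd p} \<in> sets (borel :: ('b \<times> 'b) measure)"
      by (intro borel_open open_Compl closed_Collect_eq continuous_intros)
    ultimately have "(\<lambda>f. (f i, f j)) -` (- {p. fst p = snd p}) \<inter> space ?P \<in> sets ?P"
      by (rule measurable_sets)
    moreover have "(\<lambda>f. (f i, f j)) -` (- {p. fst p = snd p}) \<inter> space ?P = {f \<in> space ?P. f i \<noteq> f j}" by auto
    ultimately show ?thesis by simp
  qed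
  then have "{f \<in> space ?P. f i = f j \<longrightarrow> i = j} \<in> sets ?P" if "i \<in> {..<N}" "j \<in> {..<N}" for i j
    using that by (cases "i = j") simp_all
  then show ?thesis
    unfolding inj_on_def by (intro sets.sets_Collect_finite_All finite_lessThan)
qed

text \<open>No measurable enumeration of the points is chosen. All enumerations give the same Betti
  number, so this number is k exactly if the count of injective enumerations with index Betti number
  k is positive, and that count is measurable.\<close>

lemma measurable_pbetti:
  fixes \<kappa> :: "('a::euclidean_space \<times> 'm::polish_space) set \<Rightarrow> real"
  assumes \<kappa>: "admissible_kappa \<kappa>" and rs: "r \<le> s" and A: "A \<in> sets borel" "bounded A"
  shows "(\<lambda>\<xi>. pbetti F (Kcx \<kappa> (restr \<xi> A) r) (Kcx \<kappa> (restr \<xi> A) s) q) \<in> measurable config_space (count_space UNIV)"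
proof -
  let ?b = "\<lambda>\<xi>. pbetti F (Kcx \<kappa> (restr \<xi> A) r) (Kcx \<kappa> (restr \<xi> A) s) q"
  let ?P = "\<lambda>N. PiM {..<N} (\<lambda>_. borel :: ('a \<times> 'm) measure)"
  define h where "h N f = pbetti F (index_cx \<kappa> f N r) (index_cx \<kappa> f N s) q" for N f
  have h: "h N \<in> measurable (?P N) (count_space UNIV)" for N
  proof -
    have c: "countable (Pow (Pow {..<N}))" by (intro countable_finite) simp
    have "(\<lambda>f. pbetti F U (index_cx \<kappa> f N s) q) \<in> measurable (?P N) (count_space UNIV)" for U
      by (rule measurable_compose_countable'[OF measurable_const measurable_index_cx[OF \<kappa>] c]) simp
    then have "(\<lambda>f. pbetti F (index_cx \<kappa> f N r) (index_cx \<kappa> f N s) q) \<in> measurable (?P N) (count_space UNIV)"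
      by (rule measurable_compose_countable'[OF _ measurable_index_cx[OF \<kappa>] c])
    then show ?thesis unfolding h_def .
  qed
  \<comment> \<open>Injectivity together with exactly N available points forces a tuple to enumerate
    the configuration.\<close>
  define G where "G N k = {f \<in> space (?P N). inj_on f {..<N}} \<inter> (h N -` {k} \<inter> space (?P N))" for N k
  have G: "G N k \<in> sets (?P N)" for N k
    unfolding G_def by (rule sets.Int[OF sets_inj_on_tuples measurable_sets[OF h]]) simp
  define T where "T N \<xi> = (\<Pi>\<^sub>E i\<in>{..<N}. restr \<xi> A)" for N :: nat and \<xi> :: "('a \<times> 'm) set"
  have Tval: "h N f = ?b \<xi>" if "\<xi> \<in> configs" "f \<in> T N \<xi>" "inj_on f {..<N}" "card (restr \<xi> A) = N" for f N \<xi>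
  proof -
    have sub: "f ` {..<N} \<subseteq> restr \<xi> A"
      using PiE_mem[OF that(2)[unfolded T_def]] by (rule image_subsetI)
    have "card (f ` {..<N}) = card (restr \<xi> A)" using card_image[OF that(3)] that(4) by simp
    then have "f ` {..<N} = restr \<xi> A" by (rule card_subset_eq[OF finite_restr[OF that(1) A(2)] sub])
    then show ?thesis
      using pbetti_Kcx_image[OF that(3) _ rs, of F \<kappa> q] inj_on_fst_restr[OF that(1), of A]
      unfolding h_def by metis
  qed
  have Tex: "\<exists>f\<in>T N \<xi>. inj_on f {..<N}" if xi: "\<xi> \<in> configs" and cN: "card (restr \<xi> A) = N" for N \<xi>
  proof -
    obtain e where e: "bij_betw e {..<N} (restr \<xi> A)"
      using ex_bij_betw_nat_finite[OF finite_restr[OF xi A(2)]] cN unfolding atLeast0LessThan by blast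
    have "restrict e {..<N} \<in> T N \<xi>"
      unfolding T_def using bij_betw_apply[OF e] by (intro restrict_PiE_iff[THEN iffD2] ballI)
    moreover have "inj_on (restrict e {..<N}) {..<N}"
      using bij_betw_imp_inj_on[OF e] by (simp add: inj_on_restrict_eq)
    ultimately show ?thesis by blast
  qed
  have eq: "{\<xi> \<in> configs. ?b \<xi> = k} = (\<Union>N. {\<xi> \<in> configs. card (restr \<xi> A) = N} \<inter> {\<xi> \<in> configs. real (card (T N \<xi> \<inter> G N k)) > 0})" for k
  proof (intro equalityI subsetI)
    fix \<xi> assume "\<xi> \<in> {\<xi> \<in> configs. ?b \<xi> = k}"
    then have \<xi>: "\<xi> \<in> configs" "?b \<xi> = k" by auto
    define N where "N = card (restr \<xi> A)"
    obtain f where f: "f \<in> T N \<xi>" "inj_on f {..<N}" using Tex[OF \<xi>(1), of N] N_def by blast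
    have "f \<in> space (?P N)" using f(1) PiE_mono[of "{..<N}" "\<lambda>_. restr \<xi> A" "\<lambda>_. UNIV"]
      unfolding T_def space_PiM space_borel by blast
    moreover have "h N f = k" using Tval[OF \<xi>(1) f] \<xi>(2) N_def by simp
    ultimately have "f \<in> T N \<xi> \<inter> G N k" using f unfolding G_def by simp
    moreover have "finite (T N \<xi> \<inter> G N k)"
      unfolding T_def using finite_restr[OF \<xi>(1) A(2)] by (intro finite_Int disjI1 finite_PiE) auto
    ultimately have "card (T N \<xi> \<inter> G N k) > 0" by (auto simp: card_gt_0_iff)
    then show "\<xi> \<in> (\<Union>N. {\<xi> \<in> configs. card (restr \<xi> A) = N} \<inter> {\<xi> \<in> configs. real (card (T N \<xi> \<inter> G N k)) > 0})"
      using \<xi>(1) N_def by auto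
  next
    fix \<xi> assume "\<xi> \<in> (\<Union>N. {\<xi> \<in> configs. card (restr \<xi> A) = N} \<inter> {\<xi> \<in> configs. real (card (T N \<xi> \<inter> G N k)) > 0})"
    then obtain N where N: "\<xi> \<in> configs" "card (restr \<xi> A) = N" "card (T N \<xi> \<inter> G N k) > 0" by auto
    then have "T N \<xi> \<inter> G N k \<noteq> {}" by (simp add: card_gt_0_iff)
    then obtain f where f: "f \<in> T N \<xi>" "f \<in> G N k" by blast
    then have "inj_on f {..<N}" "h N f = k" unfolding G_def by auto
    then have "?b \<xi> = k" using Tval[OF N(1) f(1) _ N(2)] by simp
    then show "\<xi> \<in> {\<xi> \<in> configs. ?b \<xi> = k}" using N(1) by blast
  qed
  have S1: "{\<xi> \<in> configs :: ('a \<times> 'm) set set. card (restr \<xi> A) = N} \<in> sets config_space" for N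
  proof -
    have "(\<lambda>\<xi>. card (restr \<xi> A)) -` {N} \<inter> space config_space \<in> sets (config_space :: ('a \<times> 'm) set measure)"
      by (rule measurable_sets[OF measurable_card_restr[OF A]]) simp
    moreover have "(\<lambda>\<xi>. card (restr \<xi> A)) -` {N} \<inter> space config_space = {\<xi> \<in> configs :: ('a \<times> 'm) set set. card (restr \<xi> A) = N}"
      unfolding space_config_space by auto
    ultimately show ?thesis by simp
  qed
  have S2: "{\<xi> \<in> configs. real (card (T N \<xi> \<inter> G N k)) > 0} \<in> sets config_space" for N k
  proof -
    have "(\<lambda>\<xi>. real (card (T N \<xi> \<inter> G N k))) \<in> borel_measurable config_space"
      unfolding T_def by (rule measurable_card_tuples[OF A G])
    then have "{\<xi> \<in> space config_space. real (card (T N \<xi> \<inter> G N k)) > 0} \<in> sets config_space" by measurable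
    then show ?thesis by (simp only: space_config_space)
  qed
  have "{\<xi> \<in> configs. ?b \<xi> = k} \<in> sets config_space" for k
    unfolding eq by (intro sets.countable_UN image_subsetI sets.Int S1 S2)
  then have "(\<Union>k\<in>X. {\<xi> \<in> configs. ?b \<xi> = k}) \<in> sets config_space" for X
    by (intro sets.countable_UN' countableI_type image_subsetI)
  moreover have "?b -` X \<inter> space config_space = (\<Union>k\<in>X. {\<xi> \<in> configs. ?b \<xi> = k})" for X
    unfolding space_config_space by auto
  ultimately show ?thesis by (intro measurableI) auto
qed

section \<open>Covering and sumset inequalities\<close>

lemma ex_maximal_card:
  assumes "finite B" "B \<noteq> {}"
  shows "\<exists>w\<in>B. \<forall>v\<in>B. card (D v) \<le> card (D w)"
proof -
  have "Max ((\<lambda>v. card (D v)) ` B) \<in> (\<lambda>v. card (D v)) ` B" using assms by (intro Max_in) auto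
  then obtain w where w: "w \<in> B" "card (D w) = Max ((\<lambda>v. card (D v)) ` B)" by auto
  then have "\<forall>v\<in>B. card (D v) \<le> card (D w)" using assms by auto
  then show ?thesis using w by blast
qed

text \<open>Greedy choice of a largest set. As the sets are nested, \<open>D v\<close> lies in the
  chosen \<open>D w\<close>, so if the two translates meet then \<open>v\<close> belongs to the
  translate by \<open>w\<close> of the difference set of \<open>D w\<close>.\<close>

lemma vitali_selection:
  fixes B :: "'g::ab_group_add set" and D :: "'g \<Rightarrow> 'g set"
  assumes "finite B" "\<And>w. w \<in> B \<Longrightarrow> finite (D w) \<and> D w \<noteq> {}"
    and "\<And>v w. v \<in> B \<Longrightarrow> w \<in> B \<Longrightarrow> D v \<subseteq> D w \<or> D w \<subseteq> D v"
  shows "\<exists>S\<subseteq>B. (\<forall>v\<in>S. \<forall>w\<in>S. v \<noteq> w \<longrightarrow> (+) v ` D v \<inter> (+) w ` D w = {}) \<and>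
    B \<subseteq> (\<Union>w\<in>S. (+) w ` {x - y |x y. x \<in> D w \<and> y \<in> D w})"
  using assms
proof (induction B rule: finite_psubset_induct)
  case (psubset B)
  show ?case
  proof (cases "B = {}")
    case False
    then obtain w where w: "w \<in> B" "\<And>v. v \<in> B \<Longrightarrow> card (D v) \<le> card (D w)"
      using ex_maximal_card[OF psubset.hyps] by blast
    have Dvw: "D v \<subseteq> D w" if v: "v \<in> B" for v
    proof (cases "D v \<subseteq> D w")
      case False
      then have "D w \<subseteq> D v" using psubset.prems(2)[OF v w(1)] by blast
      then have "D w = D v"
        using card_subset_eq[of "D v" "D w"] psubset.prems(1)[OF v] card_mono[of "D v" "D w"] w(2)[OF v]
        by simp
      then show ?thesis by simp
    qed
    define B' where "B' = {v \<in> B. (+) v ` D v \<inter> (+) w ` D w = {}}"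
    have "w \<notin> B'" unfolding B'_def using psubset.prems(1)[OF w(1)] by auto
    then have "B' \<subset> B" unfolding B'_def using w(1) by blast
    moreover have "B' \<subseteq> B" unfolding B'_def by blast
    ultimately have B': "B' \<subset> B" "\<And>v. v \<in> B' \<Longrightarrow> v \<in> B" by blast+
    have "\<exists>S\<subseteq>B'. (\<forall>v\<in>S. \<forall>w\<in>S. v \<noteq> w \<longrightarrow> (+) v ` D v \<inter> (+) w ` D w = {}) \<and>
      B' \<subseteq> (\<Union>w\<in>S. (+) w ` {x - y |x y. x \<in> D w \<and> y \<in> D w})"
      by (rule psubset.IH[OF B'(1)]) (use psubset.prems(1) psubset.prems(2) B'(2) in blast)+
    then obtain S where S: "S \<subseteq> B'" "\<forall>v\<in>S. \<forall>w\<in>S. v \<noteq> w \<longrightarrow> (+) v ` D v \<inter> (+) w ` D w = {}"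
      "B' \<subseteq> (\<Union>w\<in>S. (+) w ` {x - y |x y. x \<in> D w \<and> y \<in> D w})"
      by blast
    have cov: "v \<in> (+) w ` {x - y |x y. x \<in> D w \<and> y \<in> D w}" if v: "v \<in> B" "v \<notin> B'" for v
    proof -
      obtain x y where xy: "x \<in> D v" "y \<in> D w" "v + x = w + y"
        using v unfolding B'_def by auto
      have "v = (v + x) - x" by simp
      also have "\<dots> = w + (y - x)" unfolding xy(3) by simp
      finally have "v = w + (y - x)" .
      moreover have "y - x \<in> {x - y |x y. x \<in> D w \<and> y \<in> D w}" using xy Dvw[OF v(1)] by blast
      ultimately show ?thesis by blast
    qed
    show ?thesis
    proof (intro exI[of _ "insert w S"] conjI)
      show "insert w S \<subseteq> B" using S(1) w(1) \<open>B' \<subseteq> B\<close> by blast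
      have "(+) v ` D v \<inter> (+) w ` D w = {}" if "v \<in> S" for v
        using that S(1) unfolding B'_def by blast
      then show "\<forall>v\<in>insert w S. \<forall>u\<in>insert w S. v \<noteq> u \<longrightarrow> (+) v ` D v \<inter> (+) u ` D u = {}"
        using S(2) by (simp add: Int_commute)
      show "B \<subseteq> (\<Union>w\<in>insert w S. (+) w ` {x - y |x y. x \<in> D w \<and> y \<in> D w})"
      proof
        fix v assume v: "v \<in> B"
        show "v \<in> (\<Union>w\<in>insert w S. (+) w ` {x - y |x y. x \<in> D w \<and> y \<in> D w})"
        proof (cases "v \<in> B'")
          case True
          then have "v \<in> (\<Union>w\<in>S. (+) w ` {x - y |x y. x \<in> D w \<and> y \<in> D w})" by (rule subsetD[OF S(3)])
          then show ?thesis by (rule subsetD[OF UN_mono[OF subset_insertI subset_refl]])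
        next
          case False
          from cov[OF v this] show ?thesis by (rule UN_I[OF insertI1])
        qed
      qed
    qed
  qed (intro exI[of _ "{}"], simp)
qed

text \<open>Fix for each difference u a representation x - y. The pair (d + x, d + y) of sums
  determines u as the difference of its entries, and then d, so sending (d, u) to this pair is
  injective.\<close>

lemma ruzsa_triangle:
  fixes D :: "'g::ab_group_add set"
  assumes "finite D"
  shows "card D * card {x - y |x y. x \<in> D \<and> y \<in> D} \<le> (card {x + y |x y. x \<in> D \<and> y \<in> D})\<^sup>2"
proof -
  let ?A = "{x - y |x y. x \<in> D \<and> y \<in> D}" and ?S = "{x + y |x y. x \<in> D \<and> y \<in> D}"
  have fin: "finite ?S" using assms by (intro finite_image_set2) auto
  have "\<exists>p. fst p \<in> D \<and> snd p \<in> D \<and> u = fst p - snd p" if u: "u \<in> ?A" for u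
  proof -
    obtain x y where "u = x - y" "x \<in> D" "y \<in> D" using u by blast
    then show ?thesis by (intro exI[of _ "(x, y)"]) simp
  qed
  then have "\<forall>u\<in>?A. \<exists>p. fst p \<in> D \<and> snd p \<in> D \<and> u = fst p - snd p" by (rule ballI)
  from bchoice[OF this] obtain s
    where "\<forall>u\<in>?A. fst (s u) \<in> D \<and> snd (s u) \<in> D \<and> u = fst (s u) - snd (s u)" by (rule exE)
  then have s: "fst (s u) \<in> D \<and> snd (s u) \<in> D \<and> u = fst (s u) - snd (s u)" if "u \<in> ?A" for u
    using that by (rule bspec)
  define \<phi> where "\<phi> = (\<lambda>(d, u). (d + fst (s u), d + snd (s u)))"
  have "inj_on \<phi> (D \<times> ?A)"
  proof (rule inj_onI)
    fix p p' assume p: "p \<in> D \<times> ?A" "p' \<in> D \<times> ?A" "\<phi> p = \<phi> p'"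
    obtain d u d' u' where dec: "p = (d, u)" "p' = (d', u')" by (cases p, cases p') simp
    have uu: "u \<in> ?A" "u' \<in> ?A" using p(1,2) unfolding dec by simp_all
    have e: "d + fst (s u) = d' + fst (s u')" "d + snd (s u) = d' + snd (s u')"
      using p(3) unfolding \<phi>_def dec by auto
    have "u = (d + fst (s u)) - (d + snd (s u))" "u' = (d' + fst (s u')) - (d' + snd (s u'))"
      using s[OF uu(1)] s[OF uu(2)] by simp_all
    then have "u = u'" unfolding e by simp
    then show "p = p'" using e dec by simp
  qed
  moreover have "\<phi> ` (D \<times> ?A) \<subseteq> ?S \<times> ?S"
  proof (rule image_subsetI)
    fix p assume p: "p \<in> D \<times> ?A"
    then obtain d u where du: "p = (d, u)" "d \<in> D" "u \<in> ?A" by (rule SigmaE)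
    have "d + fst (s u) \<in> ?S" "d + snd (s u) \<in> ?S" using s[OF du(3)] du(2) by blast+
    then show "\<phi> p \<in> ?S \<times> ?S" unfolding \<phi>_def du(1) by simp
  qed
  ultimately have "card (D \<times> ?A) \<le> card (?S \<times> ?S)"
    using fin by (intro card_inj_on_le[of \<phi>]) auto
  then show ?thesis by (simp add: card_cartesian_product power2_eq_square)
qed

text \<open>The covering lemma needs differences, but a convex set need not resemble its reflection,
  whereas its sumset is a dilate. The volume bound for sumsets is therefore converted, at the price
  of squaring the constant.\<close>

lemma card_differences_le:
  fixes D :: "'g::ab_group_add set"
  assumes "finite D" "card {x + y |x y. x \<in> D \<and> y \<in> D} \<le> C * card D"
  shows "card {x - y |x y. x \<in> D \<and> y \<in> D} \<le> C\<^sup>2 * card D"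
proof (cases "D = {}")
  case False
  have "card D * card {x - y |x y. x \<in> D \<and> y \<in> D} \<le> (C * card D)\<^sup>2"
    using ruzsa_triangle[OF assms(1)] power_mono[OF assms(2), of 2] by linarith
  also have "\<dots> = card D * (C\<^sup>2 * card D)" by (simp add: power2_eq_square algebra_simps)
  finally show ?thesis using False assms(1) by (simp add: card_gt_0_iff)
qed simp

section \<open>A maximal inequality for chains of finite sets\<close>

locale pmp_action = prob_space M for M :: "'x measure" +
  fixes T :: "'g::ab_group_add \<Rightarrow> 'x \<Rightarrow> 'x"
  assumes meas [measurable]: "T a \<in> measurable M M"
    and distr_T: "distr M M (T a) = M"
    and T_add: "x \<in> space M \<Longrightarrow> T a (T b x) = T (a + b) x"
begin

lemma T_space: "x \<in> space M \<Longrightarrow> T a x \<in> space M"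
  using measurable_space[OF meas] .

lemma integral_T:
  fixes f :: "'x \<Rightarrow> real"
  assumes "f \<in> borel_measurable M"
  shows "(\<integral>x. f (T a x) \<partial>M) = (\<integral>x. f x \<partial>M)"
  using integral_distr[OF meas assms, of a] by (simp add: distr_T)

lemma integrable_T:
  fixes f :: "'x \<Rightarrow> real"
  assumes "integrable M f"
  shows "integrable M (\<lambda>x. f (T a x))"
  using integrable_distr[OF meas, of a f] assms by (simp add: distr_T)

text \<open>A level set of the maximal function, the supremum of the averages along the members of
  the family.\<close>

definition exceed :: "('x \<Rightarrow> real) \<Rightarrow> real \<Rightarrow> 'g set set \<Rightarrow> 'x set" where
  "exceed g c \<D> = {x \<in> space M. \<exists>D\<in>\<D>. c * card D < (\<Sum>z\<in>D. g (T z x))}"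

lemma sets_exceed:
  assumes "g \<in> borel_measurable M" "countable \<D>"
  shows "exceed g c \<D> \<in> sets M"
proof -
  have [measurable]: "g \<in> borel_measurable M" by fact
  have "exceed g c \<D> = (\<Union>D\<in>\<D>. {x \<in> space M. c * card D < (\<Sum>z\<in>D. g (T z x))})"
    unfolding exceed_def by blast
  also have "\<dots> \<in> sets M" using assms(2) by (intro sets.countable_UN'') measurable
  finally show ?thesis .
qed

text \<open>Transference: along the orbit of a point the covering lemma bounds the number of visits
  to the level set, and integration brings the bound back to the space. Two factors \<open>C\<close>
  come from the difference sets, the third from the sumset of the largest set.\<close>

lemma maximal_inequality_finite:
  assumes g: "integrable M g" "\<And>x. g x \<ge> 0" and c: "c > 0"
    and fin: "finite \<D>" "\<D> \<noteq> {}" "\<And>D. D \<in> \<D> \<Longrightarrow> finite D \<and> D \<noteq> {}"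
    and chain: "\<And>D E. D \<in> \<D> \<Longrightarrow> E \<in> \<D> \<Longrightarrow> D \<subseteq> E \<or> E \<subseteq> D"
    and dbl: "\<And>D. D \<in> \<D> \<Longrightarrow> card {x + y |x y. x \<in> D \<and> y \<in> D} \<le> C * card D"
  shows "c * prob (exceed g c \<D>) \<le> real C ^ 3 * expectation g"
proof -
  have gm [measurable]: "g \<in> borel_measurable M" using g(1) by simp
  define E where "E = exceed g c \<D>"
  have E [measurable]: "E \<in> sets M"
    unfolding E_def by (rule sets_exceed[OF gm countable_finite[OF fin(1)]])
  \<comment> \<open>The window of orbit points to be examined: for \<open>w\<close> in
    \<open>W\<close>, every translate of a member by \<open>w\<close> stays inside the sumset
    \<open>WW\<close>.\<close>
  obtain W where W: "W \<in> \<D>" "\<And>D. D \<in> \<D> \<Longrightarrow> D \<subseteq> W"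
  proof -
    obtain W where W: "W \<in> \<D>" "\<And>D. D \<in> \<D> \<Longrightarrow> card D \<le> card W"
      using ex_maximal_card[OF fin(1,2), of "\<lambda>D. D"] by blast
    have "D \<subseteq> W" if D: "D \<in> \<D>" for D
      using chain[OF D W(1)] card_subset_eq[of D W] fin(3)[OF D] W(2)[OF D] card_mono[of D W]
      by (metis order_antisym subset_refl)
    then show thesis using that W(1) by blast
  qed
  have finW: "finite W" "W \<noteq> {}" using fin(3)[OF W(1)] by auto
  define WW where "WW = {x + y |x y. x \<in> W \<and> y \<in> W}"
  have finWW: "finite WW" unfolding WW_def using finW(1) by (intro finite_image_set2) auto
  have pointwise: "c * (\<Sum>w\<in>W. indicator E (T w x)) \<le> real C ^ 2 * (\<Sum>u\<in>WW. g (T u x))"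
    if x: "x \<in> space M" for x
  proof -
    define B where "B = {w \<in> W. T w x \<in> E}"
    have finB: "finite B" unfolding B_def using finW(1) by simp
    have "\<forall>w\<in>B. \<exists>D\<in>\<D>. c * card D < (\<Sum>z\<in>D. g (T z (T w x)))"
      unfolding B_def E_def exceed_def by blast
    then have "\<forall>w\<in>B. \<exists>D. D \<in> \<D> \<and> c * card D < (\<Sum>z\<in>D. g (T z (T w x)))" by blast
    from bchoice[OF this] obtain D
      where "\<forall>w\<in>B. D w \<in> \<D> \<and> c * card (D w) < (\<Sum>z\<in>D w. g (T z (T w x)))" by (rule exE)
    then have D: "D w \<in> \<D>" "c * card (D w) < (\<Sum>z\<in>D w. g (T z (T w x)))" if "w \<in> B" for w
      using that by simp_all
    have Dfin: "finite (D w)" if "w \<in> B" for w using fin(3)[OF D(1)[OF that]] by simp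
    have "\<exists>S\<subseteq>B. (\<forall>v\<in>S. \<forall>w\<in>S. v \<noteq> w \<longrightarrow> (+) v ` D v \<inter> (+) w ` D w = {}) \<and>
      B \<subseteq> (\<Union>w\<in>S. (+) w ` {x - y |x y. x \<in> D w \<and> y \<in> D w})"
      by (rule vitali_selection[OF finB fin(3)[OF D(1)] chain[OF D(1) D(1)]])
    then obtain S where S: "S \<subseteq> B" "\<forall>v\<in>S. \<forall>w\<in>S. v \<noteq> w \<longrightarrow> (+) v ` D v \<inter> (+) w ` D w = {}"
      "B \<subseteq> (\<Union>w\<in>S. (+) w ` {x - y |x y. x \<in> D w \<and> y \<in> D w})" by (elim exE conjE)
    have finS: "finite S" by (rule finite_subset[OF S(1) finB])
    have "card B \<le> card (\<Union>w\<in>S. (+) w ` {x - y |x y. x \<in> D w \<and> y \<in> D w})"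
    proof (rule card_mono[OF _ S(3)])
      show "finite (\<Union>w\<in>S. (+) w ` {x - y |x y. x \<in> D w \<and> y \<in> D w})"
      proof (intro finite_UN_I finS finite_imageI)
        fix w assume "w \<in> S"
        then have "finite (D w)" using Dfin S(1) by auto
        then show "finite {x - y |x y. x \<in> D w \<and> y \<in> D w}" by (intro finite_image_set2) auto
      qed
    qed
    also have "\<dots> \<le> (\<Sum>w\<in>S. card ((+) w ` {x - y |x y. x \<in> D w \<and> y \<in> D w}))"
      by (rule card_UN_le[OF finS])
    also have "\<dots> = (\<Sum>w\<in>S. card {x - y |x y. x \<in> D w \<and> y \<in> D w})"
      by (intro sum.cong refl card_image) simp
    also have "\<dots> \<le> (\<Sum>w\<in>S. C\<^sup>2 * card (D w))"
    proof (intro sum_mono card_differences_le)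
      fix w assume "w \<in> S"
      then have "w \<in> B" using S(1) by auto
      then show "finite (D w)" "card {x + y |x y. x \<in> D w \<and> y \<in> D w} \<le> C * card (D w)"
        using Dfin dbl[OF D(1)] by simp_all
    qed
    finally have cB: "card B \<le> (\<Sum>w\<in>S. C\<^sup>2 * card (D w))" .
    have "c * card B \<le> c * (\<Sum>w\<in>S. C\<^sup>2 * card (D w))"
      using cB c by (intro mult_left_mono) (auto simp: of_nat_le_iff simp del: of_nat_sum of_nat_mult)
    also have "\<dots> = real C ^ 2 * (\<Sum>w\<in>S. c * card (D w))"
      by (simp add: sum_distrib_left algebra_simps)
    also have "\<dots> \<le> real C ^ 2 * (\<Sum>w\<in>S. \<Sum>u\<in>(+) w ` D w. g (T u x))"
    proof (intro mult_left_mono sum_mono)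
      fix w assume w: "w \<in> S"
      have "c * card (D w) \<le> (\<Sum>z\<in>D w. g (T (z + w) x))"
        using D(2)[of w] w S(1) T_add[OF x] by (auto intro: less_imp_le)
      also have "\<dots> = (\<Sum>u\<in>(+) w ` D w. g (T u x))"
        by (subst sum.reindex) (auto simp: add.commute)
      finally show "c * card (D w) \<le> (\<Sum>u\<in>(+) w ` D w. g (T u x))" .
    qed simp
    also have "(\<Sum>w\<in>S. \<Sum>u\<in>(+) w ` D w. g (T u x)) = (\<Sum>u\<in>(\<Union>w\<in>S. (+) w ` D w). g (T u x))"
      using finS S(1,2) Dfin by (intro sum.UNION_disjoint[symmetric]) auto
    also have "real C ^ 2 * \<dots> \<le> real C ^ 2 * (\<Sum>u\<in>WW. g (T u x))"
    proof (intro mult_left_mono sum_mono2 finWW)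
      have "w + z \<in> WW" if "w \<in> S" "z \<in> D w" for w z
      proof -
        have "w \<in> B" using that(1) S(1) by auto
        then have "w \<in> W" unfolding B_def by simp
        moreover have "z \<in> W" using that(2) W(2)[OF D(1)[OF \<open>w \<in> B\<close>]] by auto
        ultimately show ?thesis unfolding WW_def by blast
      qed
      then show "(\<Union>w\<in>S. (+) w ` D w) \<subseteq> WW" by blast
    qed (use g(2) in auto)
    also have "real (card B) = (\<Sum>w\<in>W. indicator E (T w x))"
      unfolding B_def using finW(1) by (simp add: indicator_def sum.If_cases Int_def)
    finally show ?thesis .
  qed
  have Tm: "(\<lambda>x. indicator E (T w x) :: real) \<in> borel_measurable M" for w by measurable
  have int_ind: "integrable M (\<lambda>x. indicator E (T w x) :: real)" for w
    by (rule integrable_T) (auto intro!: integrable_real_indicator simp: emeasure_eq_measure)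
  \<comment> \<open>Invariance gives each summand the same integral, so the size of \<open>W\<close>
    will cancel against that of \<open>WW\<close> up to the doubling constant.\<close>
  have "c * (card W * prob E) = (\<integral>x. c * (\<Sum>w\<in>W. indicator E (T w x)) \<partial>M)"
    using int_ind integral_T[of "indicator E"] by simp
  also have "\<dots> \<le> (\<integral>x. real C ^ 2 * (\<Sum>u\<in>WW. g (T u x)) \<partial>M)"
    using pointwise int_ind integrable_T[OF g(1)]
    by (intro integral_mono integrable_mult_right integrable_sum) auto
  also have "\<dots> = real C ^ 2 * (card WW * expectation g)"
    using integrable_T[OF g(1)] integral_T[OF gm] by simp
  also have "\<dots> \<le> real C ^ 2 * ((C * card W) * expectation g)"
  proof (intro mult_left_mono mult_right_mono)
    have "card WW \<le> C * card W" unfolding WW_def by (rule dbl[OF W(1)])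
    then show "real (card WW) \<le> real (C * card W)" by (rule of_nat_mono)
    show "expectation g \<ge> 0" using g(2) by (intro Bochner_Integration.integral_nonneg) auto
  qed simp
  also have "\<dots> = card W * (real C ^ 3 * expectation g)"
    by (simp add: power2_eq_square power3_eq_cube)
  finally have "card W * (c * prob E) \<le> card W * (real C ^ 3 * expectation g)"
    by (simp add: algebra_simps)
  moreover have "card W > 0" using finW by (simp add: card_gt_0_iff)
  ultimately show ?thesis unfolding E_def by simp
qed

text \<open>Comparable finite sets of equal size coincide, so \<open>card\<close> embeds the chain
  into the natural numbers.\<close>

lemma countable_chain:
  assumes "\<And>D. D \<in> \<D> \<Longrightarrow> finite (D :: 'g set)" "\<And>D E. D \<in> \<D> \<Longrightarrow> E \<in> \<D> \<Longrightarrow> D \<subseteq> E \<or> E \<subseteq> D"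
  shows "countable \<D>"
proof -
  have "inj_on card \<D>"
    using assms by (intro inj_onI) (metis card_subset_eq)
  then show ?thesis using countableI_type[of "card ` \<D>"] countable_image_inj_on by blast
qed

text \<open>The constant of the finite case is independent of the number of sets, so the family can
  be exhausted by finite ones and continuity from below applies.\<close>

lemma maximal_inequality:
  assumes g: "integrable M g" "\<And>x. g x \<ge> 0" and c: "c > 0"
    and fin: "\<And>D. D \<in> \<D> \<Longrightarrow> finite D \<and> D \<noteq> {}"
    and chain: "\<And>D E. D \<in> \<D> \<Longrightarrow> E \<in> \<D> \<Longrightarrow> D \<subseteq> E \<or> E \<subseteq> D"
    and dbl: "\<And>D. D \<in> \<D> \<Longrightarrow> card {x + y |x y. x \<in> D \<and> y \<in> D} \<le> C * card D"
  shows "exceed g c \<D> \<in> events" "c * prob (exceed g c \<D>) \<le> real C ^ 3 * expectation g"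
proof -
  have gm: "g \<in> borel_measurable M" using g(1) by simp
  have count: "countable \<D>" by (rule countable_chain) (use fin chain in blast)+
  show "exceed g c \<D> \<in> events" by (rule sets_exceed[OF gm count])
  show "c * prob (exceed g c \<D>) \<le> real C ^ 3 * expectation g"
  proof (cases "\<D> = {}")
    case True
    have "expectation g \<ge> 0" using g(2) by (intro Bochner_Integration.integral_nonneg) auto
    then show ?thesis using True by (simp add: exceed_def)
  next
    case False
    define \<D>n where "\<D>n n = from_nat_into \<D> ` {..n}" for n :: nat
    have sub: "\<D>n n \<subseteq> \<D>" for n unfolding \<D>n_def using from_nat_into[OF False] by blast
    have un: "(\<Union>n. \<D>n n) = \<D>"
    proof -
      have "(\<Union>n. from_nat_into \<D> ` {..n}) = range (from_nat_into \<D>)" by auto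
      then show ?thesis unfolding \<D>n_def using range_from_nat_into[OF False count] by simp
    qed
    have mono: "exceed g c (\<D>n m) \<subseteq> exceed g c (\<D>n n)" if "m \<le> n" for m n
    proof -
      have "\<D>n m \<subseteq> \<D>n n" unfolding \<D>n_def using that by (intro image_mono) auto
      then show ?thesis unfolding exceed_def by blast
    qed
    have "(\<Union>n. exceed g c (\<D>n n)) = exceed g c \<D>"
      unfolding exceed_def un[symmetric] by blast
    moreover have "range (\<lambda>n. exceed g c (\<D>n n)) \<subseteq> events"
      using sets_exceed[OF gm countable_subset[OF sub count]] by blast
    ultimately have "(\<lambda>n. prob (exceed g c (\<D>n n))) \<longlonglongrightarrow> prob (exceed g c \<D>)"
      using finite_Lim_measure_incseq[of "\<lambda>n. exceed g c (\<D>n n)"] mono by (simp add: incseq_def)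
    then have lim: "(\<lambda>n. c * prob (exceed g c (\<D>n n))) \<longlonglongrightarrow> c * prob (exceed g c \<D>)"
      by (intro tendsto_intros)
    have bound: "c * prob (exceed g c (\<D>n n)) \<le> real C ^ 3 * expectation g" for n
    proof (rule maximal_inequality_finite[OF g c])
      show "finite (\<D>n n)" "\<D>n n \<noteq> {}" unfolding \<D>n_def by auto
    qed (use sub[of n] fin chain dbl in blast)+
    show ?thesis by (rule LIMSEQ_le_const2[OF lim]) (use bound in simp)
  qed
qed

section \<open>The mean ergodic theorem\<close>

text \<open>Averages of finitely many shifts with dyadic weights. Midpoints suffice for the
  parallelogram identity, and the inductive form lets \<open>approximates\<close> be carried through
  clause by clause.\<close>

inductive mix :: "('x \<Rightarrow> real) \<Rightarrow> ('x \<Rightarrow> real) \<Rightarrow> bool" for f where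
  base: "mix f f"
| shift: "mix f u \<Longrightarrow> mix f (\<lambda>x. u (T a x))"
| mid: "mix f u \<Longrightarrow> mix f v \<Longrightarrow> mix f (\<lambda>x. (u x + v x) / 2)"

lemma integrable_of_square:
  fixes f :: "'x \<Rightarrow> real"
  assumes "f \<in> borel_measurable M" "integrable M (\<lambda>x. (f x)\<^sup>2)"
  shows "integrable M f"
proof (rule Bochner_Integration.integrable_bound)
  show "integrable M (\<lambda>x. 1 + (f x)\<^sup>2)" using assms(2) by simp
  have "\<bar>t\<bar> \<le> 1 + t\<^sup>2" for t :: real
    using zero_le_power2[of "\<bar>t\<bar> - 1"] zero_le_power2[of t] by (simp add: power2_diff)
  then show "AE x in M. norm (f x) \<le> norm (1 + (f x)\<^sup>2)" by (simp add: abs_le_iff)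
qed (use assms in simp)

lemma integrable_square_add:
  fixes f g :: "'x \<Rightarrow> real"
  assumes [measurable]: "f \<in> borel_measurable M" "g \<in> borel_measurable M"
    and "integrable M (\<lambda>x. (f x)\<^sup>2)" "integrable M (\<lambda>x. (g x)\<^sup>2)"
  shows "integrable M (\<lambda>x. (a * f x + b * g x)\<^sup>2)"
proof (rule Bochner_Integration.integrable_bound)
  show "integrable M (\<lambda>x. 2 * a\<^sup>2 * (f x)\<^sup>2 + 2 * b\<^sup>2 * (g x)\<^sup>2)" using assms by simp
  have "(s + t)\<^sup>2 \<le> 2 * s\<^sup>2 + 2 * t\<^sup>2" for s t :: real
    using zero_le_power2[of "s - t"] by (simp add: power2_eq_square algebra_simps)
  then have "(a * f x + b * g x)\<^sup>2 \<le> 2 * (a * f x)\<^sup>2 + 2 * (b * g x)\<^sup>2" for x .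
  then show "AE x in M. norm ((a * f x + b * g x)\<^sup>2) \<le> norm (2 * a\<^sup>2 * (f x)\<^sup>2 + 2 * b\<^sup>2 * (g x)\<^sup>2)"
    by (intro always_eventually allI) (simp add: power_mult_distrib mult.assoc)
qed measurable

lemma mix_props:
  assumes "mix f u" "f \<in> borel_measurable M" "integrable M (\<lambda>x. (f x)\<^sup>2)"
  shows "u \<in> borel_measurable M \<and> integrable M (\<lambda>x. (u x)\<^sup>2) \<and> expectation u = expectation f"
  using assms(1)
proof (induction rule: mix.induct)
  case base
  then show ?case using assms by simp
next
  case (shift u a)
  have [measurable]: "u \<in> borel_measurable M" using shift by simp
  have "(\<lambda>x. u (T a x)) \<in> borel_measurable M" by measurable
  then show ?case using shift integrable_T[of "\<lambda>x. (u x)\<^sup>2" a] integral_T[of u a] by simp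
next
  case (mid u v)
  note p = conjunct1[OF mid.IH(1)] conjunct1[OF mid.IH(2)] conjunct1[OF conjunct2[OF mid.IH(1)]]
    conjunct1[OF conjunct2[OF mid.IH(2)]] conjunct2[OF conjunct2[OF mid.IH(1)]] conjunct2[OF conjunct2[OF mid.IH(2)]]
  have eq: "(u x + v x) / 2 = 1/2 * u x + 1/2 * v x" for x by (simp add: add_divide_distrib)
  have i: "integrable M u" "integrable M v" using integrable_of_square p by blast+
  then have "expectation (\<lambda>x. 1/2 * u x + 1/2 * v x) = expectation f" using p(5,6) by simp
  moreover have "(\<lambda>x. 1/2 * u x + 1/2 * v x) \<in> borel_measurable M"
    using p(1,2) by (intro borel_measurable_add borel_measurable_times borel_measurable_const)
  ultimately show ?case
    unfolding eq using integrable_square_add[OF p(1-4), of "1/2" "1/2"] by blast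
qed

text \<open>The elementary bound of |w| by (w^2 + d^2) / (2 d) replaces the Cauchy-Schwarz
  inequality; it yields 5 d / 2, rounded up to 3 d.\<close>

lemma expectation_abs_le:
  fixes w :: "'x \<Rightarrow> real"
  assumes "w \<in> borel_measurable M" "integrable M (\<lambda>x. (w x)\<^sup>2)" "expectation (\<lambda>x. (w x)\<^sup>2) \<le> 4 * d\<^sup>2" "d > 0"
  shows "expectation (\<lambda>x. \<bar>w x\<bar>) \<le> 3 * d"
proof -
  have wi: "integrable M w" by (rule integrable_of_square[OF assms(1,2)])
  have "\<bar>w x\<bar> \<le> ((w x)\<^sup>2 + d\<^sup>2) / (2 * d)" for x
  proof -
    have "2 * d * \<bar>w x\<bar> \<le> (w x)\<^sup>2 + d\<^sup>2"
      using zero_le_power2[of "\<bar>w x\<bar> - d"] by (simp add: power2_diff mult_ac)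
    then show ?thesis using assms(4) by (simp add: pos_le_divide_eq mult_ac)
  qed
  then have "expectation (\<lambda>x. \<bar>w x\<bar>) \<le> expectation (\<lambda>x. ((w x)\<^sup>2 + d\<^sup>2) / (2 * d))"
    using assms(2) wi by (intro integral_mono) auto
  also have "\<dots> = (expectation (\<lambda>x. (w x)\<^sup>2) + d\<^sup>2) / (2 * d)"
    using assms(2) by (simp add: prob_space)
  also have "\<dots> \<le> (6 * d\<^sup>2) / (2 * d)"
    using assms(3,4) zero_le_power2[of d] by (intro divide_right_mono) linarith+
  also have "\<dots> = 3 * d" using assms(4) by (simp add: power2_eq_square)
  finally show ?thesis .
qed

definition ergodic_action :: bool where
  "ergodic_action \<longleftrightarrow> (\<forall>B\<in>events.
     (\<forall>a. prob (B - {x \<in> space M. T a x \<in> B} \<union> ({x \<in> space M. T a x \<in> B} - B)) = 0) \<longrightarrow> prob B = 0 \<or> prob B = 1)"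

text \<open>The set where \<open>h\<close> is at most its mean is invariant up to null sets, hence
  trivial. Either way \<open>h\<close> minus its mean has constant sign almost everywhere and
  integral 0, so it vanishes.\<close>

lemma invariant_AE_const:
  fixes h :: "'x \<Rightarrow> real"
  assumes erg: ergodic_action and h: "integrable M h" and inv: "\<And>a. AE x in M. h (T a x) = h x"
  shows "AE x in M. h x = expectation h"
proof -
  have [measurable]: "h \<in> borel_measurable M" using h by simp
  define c where "c = expectation h"
  define B where "B = {x \<in> space M. h x \<le> c}"
  have B [measurable]: "B \<in> events" unfolding B_def by measurable
  have "prob (B - {x \<in> space M. T a x \<in> B} \<union> ({x \<in> space M. T a x \<in> B} - B)) = 0" for a
  proof -
    have "AE x in M. x \<notin> B - {x \<in> space M. T a x \<in> B} \<union> ({x \<in> space M. T a x \<in> B} - B)"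
      using inv[of a] by eventually_elim (auto simp: B_def T_space)
    moreover have "B - {x \<in> space M. T a x \<in> B} \<union> ({x \<in> space M. T a x \<in> B} - B) \<in> events" by measurable
    ultimately show ?thesis by (simp add: prob_eq_0)
  qed
  then have "prob B = 0 \<or> prob B = 1" using erg B unfolding ergodic_action_def by blast
  then have "(AE x in M. 0 \<le> h x - c) \<or> (AE x in M. 0 \<le> c - h x)"
  proof
    assume "prob B = 0"
    then have "AE x in M. x \<notin> B" using prob_eq_0[OF B] by simp
    then have "AE x in M. 0 \<le> h x - c" using AE_space by eventually_elim (auto simp: B_def)
    then show ?thesis by blast
  next
    assume "prob B = 1"
    then have "AE x in M. x \<in> B" by (simp add: AE_prob_1)
    then have "AE x in M. 0 \<le> c - h x" by eventually_elim (auto simp: B_def)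
    then show ?thesis by blast
  qed
  moreover have "expectation (\<lambda>x. h x - c) = 0" "expectation (\<lambda>x. c - h x) = 0"
    using h by (simp_all add: c_def prob_space)
  moreover have "integrable M (\<lambda>x. h x - c)" "integrable M (\<lambda>x. c - h x)" using h by simp_all
  ultimately have "(AE x in M. h x - c = 0) \<or> (AE x in M. c - h x = 0)"
    using integral_nonneg_eq_0_iff_AE by blast
  then show ?thesis unfolding c_def[symmetric] by (auto elim: eventually_mono)
qed

text \<open>The midpoints of a sequence of mixtures that minimizes the \<open>L\<^sup>2\<close> norm cannot have much smaller
  norm, so the parallelogram identity makes the sequence Cauchy and asymptotically invariant.\<close>

lemma mean_ergodic:
  fixes f :: "'x \<Rightarrow> real"
  assumes erg: ergodic_action and f: "f \<in> borel_measurable M" "integrable M (\<lambda>x. (f x)\<^sup>2)" and e: "e > 0"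
  shows "\<exists>u. mix f u \<and> expectation (\<lambda>x. \<bar>u x - expectation f\<bar>) < e"
proof -
  define S where "S = {expectation (\<lambda>x. (u x)\<^sup>2) |u. mix f u}"
  define m where "m = Inf S"
  have bdd: "bdd_below S" unfolding S_def by (rule bdd_belowI[of _ 0]) auto
  have ne: "S \<noteq> {}" unfolding S_def using mix.base by blast
  have low: "m \<le> expectation (\<lambda>x. (u x)\<^sup>2)" if "mix f u" for u
    unfolding m_def using that by (intro cInf_lower bdd) (auto simp: S_def)
  \<comment> \<open>The midpoint is again a mixture, so its square norm is at least m; the
    parallelogram identity leaves at most 2 (m + d^2) + 2 (m + d^2) - 4 m = 4 d^2.\<close>
  have close: "expectation (\<lambda>x. \<bar>u x - v x\<bar>) \<le> 3 * d"
    if uv: "mix f u" "mix f v" "expectation (\<lambda>x. (u x)\<^sup>2) \<le> m + d\<^sup>2" "expectation (\<lambda>x. (v x)\<^sup>2) \<le> m + d\<^sup>2"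
      and d: "d > 0" for u v d
  proof (rule expectation_abs_le[OF _ _ _ d])
    note p = mix_props[OF uv(1) f] mix_props[OF uv(2) f] mix_props[OF mix.mid[OF uv(1,2)] f]
    show "(\<lambda>x. u x - v x) \<in> borel_measurable M" using p by (intro borel_measurable_diff) auto
    have "integrable M (\<lambda>x. (1 * u x + (-1) * v x)\<^sup>2)"
      by (rule integrable_square_add) (use p in blast)+
    then show "integrable M (\<lambda>x. (u x - v x)\<^sup>2)" by simp
    have "(u x - v x)\<^sup>2 = 2 * (u x)\<^sup>2 + 2 * (v x)\<^sup>2 - 4 * ((u x + v x) / 2)\<^sup>2" for x
      by (simp add: power2_eq_square field_simps)
    then have "expectation (\<lambda>x. (u x - v x)\<^sup>2)
      = expectation (\<lambda>x. 2 * (u x)\<^sup>2 + 2 * (v x)\<^sup>2 - 4 * ((u x + v x) / 2)\<^sup>2)"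
      by presburger
    moreover have "integrable M (\<lambda>x. 2 * (u x)\<^sup>2)" "integrable M (\<lambda>x. 2 * (v x)\<^sup>2)"
      "integrable M (\<lambda>x. 4 * ((u x + v x) / 2)\<^sup>2)"
      by (rule integrable_mult_right, use p in blast)+
    ultimately have "expectation (\<lambda>x. (u x - v x)\<^sup>2)
      = 2 * expectation (\<lambda>x. (u x)\<^sup>2) + 2 * expectation (\<lambda>x. (v x)\<^sup>2) - 4 * expectation (\<lambda>x. ((u x + v x) / 2)\<^sup>2)"
      by (simp only: Bochner_Integration.integral_diff Bochner_Integration.integral_add
          Bochner_Integration.integrable_add integral_mult_right_zero)
    then show "expectation (\<lambda>x. (u x - v x)\<^sup>2) \<le> 4 * d\<^sup>2"
      using uv(3,4) low[OF mix.mid[OF uv(1,2)]] by linarith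
  qed
  \<comment> \<open>The excess is a squared power of 1/2 so that successive distances in mean are
    summable.\<close>
  have "\<exists>u. mix f u \<and> expectation (\<lambda>x. (u x)\<^sup>2) \<le> m + ((1/2) ^ k)\<^sup>2" for k :: nat
  proof -
    have "Inf S < m + ((1/2) ^ k)\<^sup>2" unfolding m_def by simp
    then obtain t where "t \<in> S" "t < m + ((1/2) ^ k)\<^sup>2" using cInf_less_iff[OF ne bdd] by blast
    then obtain u where "mix f u" "t = expectation (\<lambda>x. (u x)\<^sup>2)" unfolding S_def by blast
    with \<open>t < m + ((1/2) ^ k)\<^sup>2\<close> show ?thesis by (intro exI[of _ u] conjI) simp_all
  qed
  then have "\<forall>k. \<exists>u. mix f u \<and> expectation (\<lambda>x. (u x)\<^sup>2) \<le> m + ((1/2) ^ k)\<^sup>2" by (rule allI)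
  from choice[OF this] obtain u
    where uk: "\<forall>k. mix f (u k) \<and> expectation (\<lambda>x. (u k x)\<^sup>2) \<le> m + ((1/2) ^ k)\<^sup>2" by (rule exE)
  have u: "mix f (u k)" "expectation (\<lambda>x. (u k x)\<^sup>2) \<le> m + ((1/2) ^ k)\<^sup>2" for k
    by (rule conjunct1[OF spec[OF uk, of k]]) (rule conjunct2[OF spec[OF uk, of k]])
  have um [measurable]: "u k \<in> borel_measurable M" and ui: "integrable M (u k)"
    and ue: "expectation (u k) = expectation f" for k
  proof -
    have p: "u k \<in> borel_measurable M \<and> integrable M (\<lambda>x. (u k x)\<^sup>2) \<and> expectation (u k) = expectation f"
      by (rule mix_props[OF u(1) f])
    show "u k \<in> borel_measurable M" using p by (rule conjunct1)
    show "expectation (u k) = expectation f" using conjunct2[OF p] by (rule conjunct2)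
    show "integrable M (u k)" by (rule integrable_of_square[OF conjunct1[OF p] conjunct1[OF conjunct2[OF p]]])
  qed
  define \<delta> where "\<delta> k x = u (Suc k) x - u k x" for k x
  have \<delta>i: "integrable M (\<lambda>x. \<bar>\<delta> k x\<bar>)" for k unfolding \<delta>_def using ui by simp
  have \<delta>b: "expectation (\<lambda>x. \<bar>\<delta> k x\<bar>) \<le> 3 * (1/2) ^ k" for k
  proof -
    have "((1/2 :: real) ^ Suc k)\<^sup>2 \<le> ((1/2) ^ k)\<^sup>2" by (intro power_mono) auto
    then have "expectation (\<lambda>x. (u (Suc k) x)\<^sup>2) \<le> m + ((1/2) ^ k)\<^sup>2" using u(2)[of "Suc k"] by linarith
    then show ?thesis unfolding \<delta>_def using u by (intro close) auto
  qed
  have sum\<delta>: "summable (\<lambda>k. expectation (\<lambda>x. \<bar>\<delta> k x\<bar>))"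
    by (rule summable_comparison_test'[where g = "\<lambda>k. 3 * (1/2 :: real) ^ k"])
      (use \<delta>b in \<open>auto intro!: summable_mult summable_geometric simp: abs_of_nonneg\<close>)
  have AEs: "AE x in M. summable (\<lambda>k. \<bar>\<delta> k x\<bar>)"
  proof -
    have "(\<integral>\<^sup>+x. (\<Sum>k. ennreal \<bar>\<delta> k x\<bar>) \<partial>M) = (\<Sum>k. \<integral>\<^sup>+x. ennreal \<bar>\<delta> k x\<bar> \<partial>M)"
      by (rule nn_integral_suminf) (simp add: \<delta>_def)
    also have "\<dots> = (\<Sum>k. ennreal (expectation (\<lambda>x. \<bar>\<delta> k x\<bar>)))"
      using \<delta>i by (intro suminf_cong nn_integral_eq_integral) auto
    also have "\<dots> = ennreal (\<Sum>k. expectation (\<lambda>x. \<bar>\<delta> k x\<bar>))"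
      by (rule suminf_ennreal2) (use sum\<delta> in auto)
    finally have "(\<integral>\<^sup>+x. (\<Sum>k. ennreal \<bar>\<delta> k x\<bar>) \<partial>M) \<noteq> \<infinity>" by simp
    then have "AE x in M. (\<Sum>k. ennreal \<bar>\<delta> k x\<bar>) \<noteq> \<infinity>"
      by (intro nn_integral_PInf_AE) (auto simp: \<delta>_def)
    then show ?thesis by eventually_elim (auto intro: summable_suminf_not_top)
  qed
  define G where "G x = (\<Sum>k. \<bar>\<delta> k x\<bar>)" for x
  have Gi: "integrable M G"
    unfolding G_def using \<delta>i AEs sum\<delta> by (intro integrable_suminf) auto
  \<comment> \<open>The limit is a telescoping series: absolute convergence almost everywhere gives
    a measurable pointwise limit, and \<open>G\<close> dominates the deviations for dominated
    convergence.\<close>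
  define h where "h x = u 0 x + (\<Sum>k. \<delta> k x)" for x
  have hm [measurable]: "h \<in> borel_measurable M"
    unfolding h_def \<delta>_def by measurable
  have conv: "(\<lambda>n. u n x) \<longlonglongrightarrow> h x \<and> (\<forall>n. \<bar>u n x - h x\<bar> \<le> G x)" if s: "summable (\<lambda>k. \<bar>\<delta> k x\<bar>)" for x
  proof
    have s': "summable (\<lambda>k. \<delta> k x)" using s by (rule summable_rabs_cancel)
    have part: "(\<Sum>k<n. \<delta> k x) = u n x - u 0 x" for n
      unfolding \<delta>_def by (rule sum_lessThan_telescope)
    have "(\<lambda>n. u 0 x + (\<Sum>k<n. \<delta> k x)) \<longlonglongrightarrow> h x"
      unfolding h_def using summable_LIMSEQ[OF s'] by (intro tendsto_intros)
    then show "(\<lambda>n. u n x) \<longlonglongrightarrow> h x" unfolding part by simp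
    show "\<forall>n. \<bar>u n x - h x\<bar> \<le> G x"
    proof
      fix n
      have "h x - u n x = (\<Sum>k. \<delta> (k + n) x)"
        unfolding h_def using suminf_split_initial_segment[OF s', of n] part[of n] by simp
      also have "\<bar>\<dots>\<bar> \<le> (\<Sum>k. \<bar>\<delta> (k + n) x\<bar>)"
        by (rule summable_rabs[OF summable_ignore_initial_segment[OF s]])
      also have "\<dots> \<le> G x"
        unfolding G_def using suminf_split_initial_segment[OF s, of n] by (simp add: sum_nonneg)
      finally show "\<bar>u n x - h x\<bar> \<le> G x" by (simp add: abs_minus_commute)
    qed
  qed
  have L1: "(\<lambda>n. expectation (\<lambda>x. \<bar>u n x - h x\<bar>)) \<longlonglongrightarrow> 0"
  proof -
    have "(\<lambda>n. expectation (\<lambda>x. \<bar>u n x - h x\<bar>)) \<longlonglongrightarrow> expectation (\<lambda>x. 0)"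
    proof (rule integral_dominated_convergence[OF _ _ Gi])
      show "AE x in M. (\<lambda>n. \<bar>u n x - h x\<bar>) \<longlonglongrightarrow> 0"
        using AEs
      proof eventually_elim
        case (elim x)
        then have "(\<lambda>n. \<bar>u n x - h x\<bar>) \<longlonglongrightarrow> \<bar>h x - h x\<bar>" using conv[of x] by (intro tendsto_intros) auto
        then show ?case by simp
      qed
      show "AE x in M. norm \<bar>u n x - h x\<bar> \<le> G x" for n
        using AEs by eventually_elim (use conv in auto)
    qed measurable
    then show ?thesis by simp
  qed
  have dint: "integrable M (\<lambda>x. u n x - h x)" for n
  proof (rule Bochner_Integration.integrable_bound[OF Gi])
    show "AE x in M. norm (u n x - h x) \<le> norm (G x)"
      using AEs by eventually_elim (use conv in \<open>fastforce intro: order_trans[OF _ abs_ge_self]\<close>)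
  qed measurable
  have hi: "integrable M h" using Bochner_Integration.integrable_diff[OF ui dint, of 0 0] by simp
  have he: "expectation h = expectation f"
  proof -
    have "\<bar>expectation f - expectation h\<bar> \<le> expectation (\<lambda>x. \<bar>u n x - h x\<bar>)" for n
    proof -
      have "expectation f - expectation h = expectation (\<lambda>x. u n x - h x)" using ui hi ue by simp
      also have "\<bar>\<dots>\<bar> \<le> expectation (\<lambda>x. \<bar>u n x - h x\<bar>)" by (rule integral_abs_bound)
      finally show ?thesis .
    qed
    then have "\<bar>expectation f - expectation h\<bar> \<le> 0" by (intro LIMSEQ_le_const[OF L1]) auto
    then show ?thesis by simp
  qed
  have inv: "AE x in M. h (T a x) = h x" for a
  proof -
    have hTm [measurable]: "(\<lambda>x. h (T a x)) \<in> borel_measurable M" by measurable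
    have hTi: "integrable M (\<lambda>x. h (T a x))" by (rule integrable_T[OF hi])
    have uTi: "integrable M (\<lambda>x. u n (T a x))" for n by (rule integrable_T[OF ui])
    \<comment> \<open>A shifted mixture is a mixture of the same norm, so it is nearly minimal too
      and \<open>close\<close> makes it almost equal to the unshifted one.\<close>
    have bound: "expectation (\<lambda>x. \<bar>h (T a x) - h x\<bar>) \<le> 2 * expectation (\<lambda>x. \<bar>u n x - h x\<bar>) + 3 * (1/2) ^ n" for n
    proof -
      have "expectation (\<lambda>x. (u n (T a x))\<^sup>2) = expectation (\<lambda>x. (u n x)\<^sup>2)"
        by (rule integral_T[of "\<lambda>x. (u n x)\<^sup>2"]) measurable
      then have c: "expectation (\<lambda>x. \<bar>u n (T a x) - u n x\<bar>) \<le> 3 * (1/2) ^ n"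
        using u by (intro close mix.shift) auto
      have t: "expectation (\<lambda>x. \<bar>u n (T a x) - h (T a x)\<bar>) = expectation (\<lambda>x. \<bar>u n x - h x\<bar>)"
        by (rule integral_T[of "\<lambda>x. \<bar>u n x - h x\<bar>"]) measurable
      have "expectation (\<lambda>x. \<bar>h (T a x) - h x\<bar>)
        \<le> expectation (\<lambda>x. \<bar>u n (T a x) - h (T a x)\<bar> + \<bar>u n (T a x) - u n x\<bar> + \<bar>u n x - h x\<bar>)"
        using hi hTi ui uTi by (intro integral_mono) auto
      also have "\<dots> = expectation (\<lambda>x. \<bar>u n (T a x) - h (T a x)\<bar>) + expectation (\<lambda>x. \<bar>u n (T a x) - u n x\<bar>)
          + expectation (\<lambda>x. \<bar>u n x - h x\<bar>)"
        using hi hTi ui uTi by simp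
      finally show ?thesis using c t by simp
    qed
    have "(\<lambda>n. 2 * expectation (\<lambda>x. \<bar>u n x - h x\<bar>) + 3 * (1/2) ^ n) \<longlonglongrightarrow> 2 * 0 + 3 * 0"
      by (intro tendsto_intros L1 LIMSEQ_power_zero) simp
    then have "expectation (\<lambda>x. \<bar>h (T a x) - h x\<bar>) \<le> 0"
      using bound by (intro LIMSEQ_le_const) auto
    moreover have "expectation (\<lambda>x. \<bar>h (T a x) - h x\<bar>) \<ge> 0" by simp
    ultimately have "expectation (\<lambda>x. \<bar>h (T a x) - h x\<bar>) = 0" by linarith
    then have "AE x in M. \<bar>h (T a x) - h x\<bar> = 0"
      using hi hTi by (subst (asm) integral_nonneg_eq_0_iff_AE) auto
    then show ?thesis by eventually_elim auto
  qed
  have "AE x in M. h x = expectation f"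
    using invariant_AE_const[OF erg hi inv] he by simp
  then have "expectation (\<lambda>x. \<bar>u n x - expectation f\<bar>) = expectation (\<lambda>x. \<bar>u n x - h x\<bar>)" for n
    by (intro integral_cong_AE) (auto elim: eventually_mono)
  moreover have "eventually (\<lambda>n. expectation (\<lambda>x. \<bar>u n x - h x\<bar>) < e) sequentially"
    using order_tendstoD(2)[OF L1 e] .
  then obtain n where "expectation (\<lambda>x. \<bar>u n x - h x\<bar>) < e"
    by (auto simp: eventually_sequentially)
  ultimately show ?thesis using u(1) by metis
qed

end

section \<open>Comparing the Betti number of a region with those of its cells\<close>

lemma Kcx_iff:
  "\<sigma> \<in> Kcx \<kappa> \<Xi> t \<longleftrightarrow> (\<exists>\<tau>. \<sigma> = fst ` \<tau> \<and> \<tau> \<subseteq> \<Xi> \<and> \<tau> \<noteq> {} \<and> finite \<tau> \<and> \<kappa> \<tau> \<le> t)"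
  unfolding Kcx_def by blast

lemma Kcx_mono: "t \<le> u \<Longrightarrow> Kcx \<kappa> \<Xi> t \<subseteq> Kcx \<kappa> \<Xi> u"
  unfolding Kcx_def by force

lemma Kcx_subset: "\<sigma> \<in> Kcx \<kappa> \<Xi> t \<Longrightarrow> \<sigma> \<subseteq> fst ` \<Xi>"
  unfolding Kcx_iff by blast

lemma Kcx_finite: "\<sigma> \<in> Kcx \<kappa> \<Xi> t \<Longrightarrow> finite \<sigma>"
  unfolding Kcx_iff by blast

lemma Kcx_nonempty: "\<sigma> \<in> Kcx \<kappa> \<Xi> t \<Longrightarrow> \<sigma> \<noteq> {}"
  unfolding Kcx_iff by blast

lemma finite_Kcx:
  assumes "finite \<Xi>"
  shows "finite (Kcx \<kappa> \<Xi> t)"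
proof (rule finite_subset)
  show "Kcx \<kappa> \<Xi> t \<subseteq> Pow (fst ` \<Xi>)" using Kcx_subset by blast
qed (use assms in simp)

lemma Kcx_restr_filter:
  "{\<sigma> \<in> Kcx \<kappa> (restr \<xi> A) t. \<sigma> \<subseteq> B} = Kcx \<kappa> (restr \<xi> (A \<inter> B)) t"
proof (intro equalityI subsetI)
  fix \<sigma> assume "\<sigma> \<in> {\<sigma> \<in> Kcx \<kappa> (restr \<xi> A) t. \<sigma> \<subseteq> B}"
  then obtain \<tau> where \<tau>: "\<sigma> = fst ` \<tau>" "\<tau> \<subseteq> restr \<xi> A" "\<tau> \<noteq> {}" "finite \<tau>" "\<kappa> \<tau> \<le> t" "\<sigma> \<subseteq> B"
    unfolding Kcx_iff by blast
  then have "\<tau> \<subseteq> restr \<xi> (A \<inter> B)" unfolding restr_def by auto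
  then show "\<sigma> \<in> Kcx \<kappa> (restr \<xi> (A \<inter> B)) t" using \<tau> unfolding Kcx_iff by blast
next
  fix \<sigma> assume "\<sigma> \<in> Kcx \<kappa> (restr \<xi> (A \<inter> B)) t"
  then obtain \<tau> where \<tau>: "\<sigma> = fst ` \<tau>" "\<tau> \<subseteq> restr \<xi> (A \<inter> B)" "\<tau> \<noteq> {}" "finite \<tau>" "\<kappa> \<tau> \<le> t"
    unfolding Kcx_iff by blast
  then have "\<tau> \<subseteq> restr \<xi> A" "\<sigma> \<subseteq> B" unfolding restr_def by auto
  then show "\<sigma> \<in> {\<sigma> \<in> Kcx \<kappa> (restr \<xi> A) t. \<sigma> \<subseteq> B}" using \<tau> unfolding Kcx_iff by blast
qed

lemma card_small_subsets:
  assumes "finite \<Xi>"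
  shows "finite {\<sigma>. \<sigma> \<subseteq> fst ` \<Xi> \<and> \<sigma> \<noteq> {} \<and> card \<sigma> \<le> k}"
    and "card {\<sigma>. \<sigma> \<subseteq> fst ` \<Xi> \<and> \<sigma> \<noteq> {} \<and> card \<sigma> \<le> k} \<le> card \<Xi> ^ k"
proof -
  let ?X = "fst ` \<Xi>" and ?S = "{\<sigma>. \<sigma> \<subseteq> fst ` \<Xi> \<and> \<sigma> \<noteq> {} \<and> card \<sigma> \<le> k}"
  have finX: "finite ?X" using assms by simp
  show "finite ?S" by (rule finite_subset[of _ "Pow ?X"]) (use finX in auto)
  have sub: "?S \<subseteq> (\<lambda>f. f ` {..<k}) ` (\<Pi>\<^sub>E i\<in>{..<k}. ?X)"
  proof
    fix \<sigma> assume "\<sigma> \<in> ?S"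
    then have \<sigma>: "\<sigma> \<subseteq> ?X" "\<sigma> \<noteq> {}" "card \<sigma> \<le> k" by blast+
    have fin: "finite \<sigma>" by (rule finite_subset[OF \<sigma>(1) finX])
    obtain e where e: "bij_betw e {..<card \<sigma>} \<sigma>"
      using ex_bij_betw_nat_finite[OF fin] unfolding atLeast0LessThan by blast
    have pos: "0 < card \<sigma>" using fin \<sigma>(2) by (simp add: card_gt_0_iff)
    \<comment> \<open>An enumeration of the subset is padded to length \<open>k\<close> by repeating
      its first element, which exists because the subset is nonempty.\<close>
    define f where "f = (\<lambda>i\<in>{..<k}. if i < card \<sigma> then e i else e 0)"
    have im: "e ` {..<card \<sigma>} = \<sigma>" using e by (simp add: bij_betw_def)
    have mem: "e i \<in> \<sigma>" if "i < card \<sigma>" for i using im that by blast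
    have "f ` {..<k} = \<sigma>"
    proof (intro equalityI subsetI)
      fix x assume "x \<in> f ` {..<k}"
      then show "x \<in> \<sigma>" using mem pos unfolding f_def by auto
    next
      fix x assume "x \<in> \<sigma>"
      then obtain i where "i < card \<sigma>" "x = e i" using im by blast
      then have "i \<in> {..<k}" "x = f i" using \<sigma>(3) unfolding f_def by auto
      then show "x \<in> f ` {..<k}" by blast
    qed
    moreover have "f \<in> (\<Pi>\<^sub>E i\<in>{..<k}. ?X)"
      unfolding f_def restrict_PiE_iff using mem pos \<sigma>(1) by auto
    ultimately show "\<sigma> \<in> (\<lambda>f. f ` {..<k}) ` (\<Pi>\<^sub>E i\<in>{..<k}. ?X)" by blast
  qed
  have finP: "finite (\<Pi>\<^sub>E i\<in>{..<k}. ?X)" using finX by (intro finite_PiE) auto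
  have "card ?S \<le> card ((\<lambda>f. f ` {..<k}) ` (\<Pi>\<^sub>E i\<in>{..<k}. ?X))"
    by (rule card_mono[OF finite_imageI[OF finP] sub])
  also have "\<dots> \<le> card (\<Pi>\<^sub>E i\<in>{..<k}. ?X)" by (rule card_image_le[OF finP])
  also have "\<dots> = card ?X ^ k" by (simp add: card_PiE)
  also have "\<dots> \<le> card \<Xi> ^ k" by (intro power_mono card_image_le assms) simp
  finally show "card ?S \<le> card \<Xi> ^ k" .
qed

lemma card_shift: "card (shift a \<Xi>) = card \<Xi>"
  unfolding shift_def by (rule card_image[OF inj_Tr])

lemma card_restr_shift: "card (restr (shift (- z) \<xi>) A) = card (restr \<xi> ((\<lambda>x. x + z) ` A))"
  unfolding restr_shift card_shift by simp

lemma admissible_kappaD: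
  fixes \<kappa> :: "('a::euclidean_space \<times> 'm::polish_space) set \<Rightarrow> real"
  assumes "admissible_kappa \<kappa>"
  shows "finite A \<Longrightarrow> A \<noteq> {} \<Longrightarrow> \<kappa> A \<ge> 0"
    and "finite B \<Longrightarrow> A \<noteq> {} \<Longrightarrow> A \<subseteq> B \<Longrightarrow> \<kappa> A \<le> \<kappa> B"
    and "finite A \<Longrightarrow> A \<noteq> {} \<Longrightarrow> \<kappa> (Tr a ` A) = \<kappa> A"
    and "\<exists>\<rho>::real \<Rightarrow> real. mono_on {0..} \<rho> \<and> (\<forall>t\<ge>0. \<rho> t \<ge> 0) \<and>
        (\<forall>x m y n. dist x y \<le> \<rho> (\<kappa> {(x, m), (y, n)}))"
proof -
  note k = assms[unfolded admissible_kappa_def]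
  show "finite A \<Longrightarrow> A \<noteq> {} \<Longrightarrow> \<kappa> A \<ge> 0" using conjunct1[OF k] by simp
  note k = conjunct2[OF conjunct2[OF k]]
  show "finite B \<Longrightarrow> A \<noteq> {} \<Longrightarrow> A \<subseteq> B \<Longrightarrow> \<kappa> A \<le> \<kappa> B" using conjunct1[OF k] by simp
  note k = conjunct2[OF k]
  show "finite A \<Longrightarrow> A \<noteq> {} \<Longrightarrow> \<kappa> (Tr a ` A) = \<kappa> A" using conjunct1[OF k] by simp
  show "\<exists>\<rho>::real \<Rightarrow> real. mono_on {0..} \<rho> \<and> (\<forall>t\<ge>0. \<rho> t \<ge> 0) \<and>
        (\<forall>x m y n. dist x y \<le> \<rho> (\<kappa> {(x, m), (y, n)}))" by (rule conjunct2[OF k])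
qed

text \<open>By (K1) any two points of a simplex form a pair of no larger value, and (K3) bounds
  their distance. The final +1 makes the bound positive and strict.\<close>

lemma kappa_diameter:
  fixes \<kappa> :: "('a::euclidean_space \<times> 'm::polish_space) set \<Rightarrow> real"
  assumes "admissible_kappa \<kappa>"
  obtains \<rho> where "\<rho> > 0"
    "\<And>\<tau> p p'. finite \<tau> \<Longrightarrow> \<kappa> \<tau> \<le> s \<Longrightarrow> p \<in> \<tau> \<Longrightarrow> p' \<in> \<tau> \<Longrightarrow> dist (fst p) (fst p') < \<rho>"
proof -
  obtain \<rho> :: "real \<Rightarrow> real" where \<rho>: "mono_on {0..} \<rho>"
    "\<forall>x m y n. dist x y \<le> \<rho> (\<kappa> {(x, m), (y, n)})"
    using admissible_kappaD(4)[OF assms] by (elim exE conjE) (rule that)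
  note K0 = admissible_kappaD(1)[OF assms] and K1 = admissible_kappaD(2)[OF assms]
  have "dist (fst p) (fst p') < \<bar>\<rho> s\<bar> + 1" if \<tau>: "finite \<tau>" "\<kappa> \<tau> \<le> s" "p \<in> \<tau>" "p' \<in> \<tau>" for \<tau> p p'
  proof -
    have "\<kappa> {p, p'} \<le> \<kappa> \<tau>" using \<tau> by (intro K1) auto
    then have le: "\<kappa> {p, p'} \<le> s" using \<tau> by linarith
    have ge: "\<kappa> {p, p'} \<ge> 0" by (rule K0) auto
    have "dist (fst p) (fst p') \<le> \<rho> (\<kappa> {p, p'})" using \<rho>(2)[rule_format, of "fst p" "fst p'" "snd p" "snd p'"] by simp
    also have "\<dots> \<le> \<rho> s" using ge le by (intro mono_onD[OF \<rho>(1)]) auto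
    finally show ?thesis by simp
  qed
  then show thesis by (intro that[of "\<bar>\<rho> s\<bar> + 1"]) auto
qed

text \<open>Centres, in the unit lattice, of balls that meet the cell at the origin without lying in
  it. Every simplex that leaves its cell sits in such a ball, and the number of centres is of
  smaller order than the volume of the cell.\<close>

definition layer :: "real \<Rightarrow> real \<Rightarrow> 'a::euclidean_space set" where
  "layer M R = near_pts 1 R (cell M 0) - inner_pts 1 R (cell M 0)"

locale admissible_filtration =
  fixes F :: "'k::field itself" and \<kappa> :: "('a::euclidean_space \<times> 'm::polish_space) set \<Rightarrow> real"
    and r s :: real and q :: nat
  assumes \<kappa>: "admissible_kappa \<kappa>" and rs: "r \<le> s"
begin

definition betti :: "'a set \<Rightarrow> ('a \<times> 'm) set \<Rightarrow> real" where
  "betti A \<xi> = real (pbetti F (Kcx \<kappa> (restr \<xi> A) r) (Kcx \<kappa> (restr \<xi> A) s) q)"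

lemma betti_shift:
  assumes \<xi>: "\<xi> \<in> configs" and A: "bounded A"
  shows "betti A (shift a \<xi>) = betti ((\<lambda>x. x - a) ` A) \<xi>"
proof -
  define \<Xi> where "\<Xi> = restr \<xi> ((\<lambda>x. x - a) ` A)"
  have "bounded ((\<lambda>x. x - a) ` A)" using bounded_translation_minus[OF A, of a] by simp
  then have fin: "finite \<Xi>" unfolding \<Xi>_def by (rule finite_restr[OF \<xi>])
  have im: "fst ` Tr a ` \<tau> = (\<lambda>x. x + a) ` fst ` \<tau>" for \<tau> :: "('a \<times> 'm) set"
    unfolding Tr_def by force
  note K2 = admissible_kappaD(3)[OF \<kappa>, of _ a]
  have eq: "Kcx \<kappa> (shift a \<Xi>) t = (`) (\<lambda>x. x + a) ` Kcx \<kappa> \<Xi> t" for t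
  proof (intro equalityI subsetI)
    fix \<sigma> assume "\<sigma> \<in> Kcx \<kappa> (shift a \<Xi>) t"
    then obtain \<tau> where \<tau>: "\<sigma> = fst ` \<tau>" "\<tau> \<subseteq> Tr a ` \<Xi>" "\<tau> \<noteq> {}" "\<kappa> \<tau> \<le> t"
      unfolding Kcx_iff shift_def by blast
    obtain \<tau>' where \<tau>': "\<tau>' \<subseteq> \<Xi>" "\<tau> = Tr a ` \<tau>'" using \<tau>(2) by (meson subset_imageE)
    have "finite \<tau>'" by (rule finite_subset[OF \<tau>'(1) fin])
    moreover have "\<tau>' \<noteq> {}" using \<tau>(3) \<tau>'(2) by blast
    ultimately have "fst ` \<tau>' \<in> Kcx \<kappa> \<Xi> t" using \<tau>' \<tau>(4) K2[of \<tau>'] unfolding Kcx_iff by auto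
    then show "\<sigma> \<in> (`) (\<lambda>x. x + a) ` Kcx \<kappa> \<Xi> t" unfolding \<tau>(1) \<tau>'(2) im by blast
  next
    fix \<sigma> assume "\<sigma> \<in> (`) (\<lambda>x. x + a) ` Kcx \<kappa> \<Xi> t"
    then obtain \<sigma>' where \<sigma>': "\<sigma> = (\<lambda>x. x + a) ` \<sigma>'" "\<sigma>' \<in> Kcx \<kappa> \<Xi> t" by (rule imageE)
    then obtain \<tau> where \<tau>: "\<sigma> = (\<lambda>x. x + a) ` fst ` \<tau>" "\<tau> \<subseteq> \<Xi>" "\<tau> \<noteq> {}" "finite \<tau>" "\<kappa> \<tau> \<le> t"
      unfolding Kcx_iff by blast
    have "Tr a ` \<tau> \<subseteq> shift a \<Xi>" unfolding shift_def using \<tau>(2) by (rule image_mono)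
    then show "\<sigma> \<in> Kcx \<kappa> (shift a \<Xi>) t"
      unfolding Kcx_iff \<tau>(1) im[symmetric] using \<tau>(3-5) K2[OF \<tau>(4,3)]
      by (intro exI[of _ "Tr a ` \<tau>"]) auto
  qed
  have "pbetti F (Kcx \<kappa> (shift a \<Xi>) r) (Kcx \<kappa> (shift a \<Xi>) s) q = pbetti F (Kcx \<kappa> \<Xi> r) (Kcx \<kappa> \<Xi> s) q"
    unfolding eq
  proof (rule pbetti_relabel)
    show "finite (Kcx \<kappa> \<Xi> s)" by (rule finite_Kcx[OF fin])
    show "finite \<sigma>" if "\<sigma> \<in> Kcx \<kappa> \<Xi> s" for \<sigma> using that by (rule Kcx_finite)
    show "Kcx \<kappa> \<Xi> r \<subseteq> Kcx \<kappa> \<Xi> s" by (rule Kcx_mono[OF rs])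
    show "inj_on (\<lambda>x. x + a) (\<Union> (Kcx \<kappa> \<Xi> s))" by (simp add: inj_on_def)
  qed
  then show ?thesis unfolding betti_def restr_shift \<Xi>_def by simp
qed

text \<open>Removing all simplices leaves the Betti number 0, so \<open>pbetti_perturb\<close>
  bounds it by the number of simplices with q + 1 or q + 2 vertices.\<close>

lemma betti_bound:
  assumes \<xi>: "\<xi> \<in> configs" and A: "bounded A"
  shows "betti A \<xi> \<le> real (card (restr \<xi> A)) ^ (q + 2)"
proof -
  let ?K = "\<lambda>t. Kcx \<kappa> (restr \<xi> A) t"
  have fin: "finite (restr \<xi> A)" by (rule finite_restr[OF \<xi> A])
  have "\<bar>real (pbetti F (?K r) (?K s) q) - real (pbetti F {\<sigma> \<in> ?K r. False} {\<sigma> \<in> ?K s. False} q)\<bar>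
    \<le> real (card {\<sigma> \<in> ?K s. \<not> False \<and> (card \<sigma> = Suc q \<or> card \<sigma> = Suc (Suc q))})"
    by (rule pbetti_perturb[OF finite_Kcx[OF fin] Kcx_finite Kcx_mono[OF rs]])
  then have "betti A \<xi> \<le> real (card {\<sigma> \<in> ?K s. card \<sigma> = Suc q \<or> card \<sigma> = Suc (Suc q)})"
    unfolding betti_def by (simp add: pbetti_empty)
  also have "\<dots> \<le> real (card {\<sigma>. \<sigma> \<subseteq> fst ` restr \<xi> A \<and> \<sigma> \<noteq> {} \<and> card \<sigma> \<le> q + 2})"
  proof (intro of_nat_mono card_mono card_small_subsets(1)[OF fin])
    show "{\<sigma> \<in> ?K s. card \<sigma> = Suc q \<or> card \<sigma> = Suc (Suc q)}
      \<subseteq> {\<sigma>. \<sigma> \<subseteq> fst ` restr \<xi> A \<and> \<sigma> \<noteq> {} \<and> card \<sigma> \<le> q + 2}"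
      using Kcx_subset Kcx_nonempty by fastforce
  qed
  also have "\<dots> \<le> real (card (restr \<xi> A) ^ (q + 2))"
    by (intro of_nat_mono card_small_subsets(2)[OF fin])
  finally show ?thesis by simp
qed

lemma betti_cells:
  fixes M :: real
  assumes \<xi>: "\<xi> \<in> configs" and D: "finite D" "D \<subseteq> lattice M" and M: "M > 0"
  shows "(\<Sum>z\<in>D. betti (A \<inter> cell M z) \<xi>) =
    real (pbetti F (\<Union>z\<in>D. Kcx \<kappa> (restr \<xi> (A \<inter> cell M z)) r) (\<Union>z\<in>D. Kcx \<kappa> (restr \<xi> (A \<inter> cell M z)) s) q)"
proof -
  have "bounded (A \<inter> cell M z)" for z by (rule bounded_subset[OF bounded_cell[OF M, of z]]) blast
  then have fin: "finite (restr \<xi> (A \<inter> cell M z))" for z by (intro finite_restr \<xi>)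
  have "pbetti F (\<Union>z\<in>D. Kcx \<kappa> (restr \<xi> (A \<inter> cell M z)) r) (\<Union>z\<in>D. Kcx \<kappa> (restr \<xi> (A \<inter> cell M z)) s) q
    = (\<Sum>z\<in>D. pbetti F (Kcx \<kappa> (restr \<xi> (A \<inter> cell M z)) r) (Kcx \<kappa> (restr \<xi> (A \<inter> cell M z)) s) q)"
  proof (rule pbetti_UN[OF D(1) finite_Kcx[OF fin] Kcx_finite Kcx_mono[OF rs]])
    fix z w assume zw: "z \<in> D" "w \<in> D" "z \<noteq> w"
    have sub: "\<Union>(Kcx \<kappa> (restr \<xi> (A \<inter> cell M v)) s) \<subseteq> cell M v" for v
    proof -
      have "fst ` restr \<xi> (A \<inter> cell M v) \<subseteq> cell M v" unfolding restr_def by auto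
      then show ?thesis using Kcx_subset by blast
    qed
    have "cell M z \<inter> cell M w = {}"
      using cell_unique[OF M, of z w] zw D(2) by blast
    then show "\<Union>(Kcx \<kappa> (restr \<xi> (A \<inter> cell M z)) s) \<inter> \<Union>(Kcx \<kappa> (restr \<xi> (A \<inter> cell M w)) s) = {}"
      using sub[of z] sub[of w] by blast
  qed
  then show ?thesis unfolding betti_def by simp
qed

lemma betti_perturb_Q:
  assumes fin: "finite L" "\<And>\<sigma>. \<sigma> \<in> L \<Longrightarrow> finite \<sigma>" and KL: "K \<subseteq> L"
    and bad: "finite X" "{\<sigma> \<in> L. \<not> Q \<sigma> \<and> card \<sigma> \<le> q + 2} \<subseteq> X"
  shows "\<bar>real (pbetti F K L q) - real (pbetti F {\<sigma> \<in> K. Q \<sigma>} {\<sigma> \<in> L. Q \<sigma>} q)\<bar> \<le> card X"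
proof -
  have "card {\<sigma> \<in> L. \<not> Q \<sigma> \<and> (card \<sigma> = Suc q \<or> card \<sigma> = Suc (Suc q))} \<le> card X"
    using bad by (intro card_mono) auto
  then show ?thesis using pbetti_perturb[OF fin KL, where T = F and q = q and Q = Q] by linarith
qed

text \<open>The complex of \<open>A\<close> and the disjoint union of the complexes of the whole
  cells have a common part, the union over the cells intersected with \<open>A\<close>. Passing to
  it removes crossing simplices from the first and rim simplices from the second. \<open>D\<close>
  may be larger than the set of near points, which leaves room for shifting \<open>A\<close>
  later.\<close>

lemma betti_tiling:
  fixes M \<rho> :: real
  assumes \<xi>: "\<xi> \<in> configs" and A: "bounded A" and M: "M > 0"
    and \<rho>: "\<rho> > 0" "\<And>\<tau> p p'. finite \<tau> \<Longrightarrow> \<kappa> \<tau> \<le> s \<Longrightarrow> p \<in> \<tau> \<Longrightarrow> p' \<in> \<tau> \<Longrightarrow> dist (fst p) (fst p') < \<rho>"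
    and D: "finite D" "D \<subseteq> lattice M" "near_pts M (M * DIM('a)) A \<subseteq> D"
  defines "R \<equiv> real DIM('a) + \<rho>"
  shows "\<bar>betti A \<xi> - (\<Sum>z\<in>D. betti (cell M 0) (shift (- z) \<xi>))\<bar>
    \<le> (\<Sum>z\<in>D. \<Sum>c\<in>layer M R. real (card (restr (shift (- z) \<xi>) (ball c R))) ^ (q + 2))
      + (\<Sum>z\<in>D - inner_pts M (M * DIM('a)) A. real (card (restr (shift (- z) \<xi>) (cell M 0))) ^ (q + 2))"
proof -
  let ?K = "\<lambda>t. Kcx \<kappa> (restr \<xi> A) t" and ?K' = "\<lambda>t. \<Union>z\<in>D. Kcx \<kappa> (restr \<xi> (cell M z)) t"
  let ?K'' = "\<lambda>t. \<Union>z\<in>D. Kcx \<kappa> (restr \<xi> (A \<inter> cell M z)) t"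
  let ?small = "\<lambda>B. {\<sigma>. \<sigma> \<subseteq> fst ` restr \<xi> B \<and> \<sigma> \<noteq> {} \<and> card \<sigma> \<le> q + 2}"
  define I where "I = inner_pts M (M * DIM('a)) A"
  have R: "R > 0" unfolding R_def using \<rho>(1) by simp
  have finA: "finite (restr \<xi> A)" by (rule finite_restr[OF \<xi> A])
  have finC: "finite (restr \<xi> (cell M z))" for z by (rule finite_restr[OF \<xi> bounded_cell[OF M]])
  have finB: "finite (restr \<xi> (ball x R))" for x by (rule finite_restr[OF \<xi> bounded_ball])
  have finL: "finite (layer M R :: 'a set)"
    unfolding layer_def by (intro finite_Diff finite_near_pts bounded_cell M) simp
  have translate: "(\<lambda>x. x + z) ` cell M 0 = cell M z" "(\<lambda>x. x + z) ` ball c R = ball (z + c) R" for z c :: 'a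
  proof -
    have "x \<in> (\<lambda>x. x + z) ` cell M 0 \<longleftrightarrow> x - z \<in> cell M 0" for x by (force simp: image_iff)
    then show "(\<lambda>x. x + z) ` cell M 0 = cell M z" using cell_shift by blast
    have "(\<lambda>x. x + z) ` ball c R = (+) z ` ball c R" by (intro image_cong) (auto simp: add.commute)
    then show "(\<lambda>x. x + z) ` ball c R = ball (z + c) R" unfolding image_add_ball by (simp only: add.commute)
  qed
  have cross: "\<bar>betti A \<xi> - real (pbetti F (?K'' r) (?K'' s) q)\<bar>
    \<le> (\<Sum>z\<in>D. \<Sum>c\<in>layer M R. real (card (restr \<xi> (ball (z + c) R))) ^ (q + 2))"
  proof -
    let ?Q = "\<lambda>\<sigma>. \<exists>z\<in>D. \<sigma> \<subseteq> cell M z"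
    define X where "X = (\<Union>z\<in>D. \<Union>c\<in>layer M R. ?small (ball (z + c) R))"
    have finX: "finite X" unfolding X_def using D(1) finL card_small_subsets(1)[OF finB] by (intro finite_UN_I)
    have sub: "{\<sigma> \<in> ?K s. \<not> ?Q \<sigma> \<and> card \<sigma> \<le> q + 2} \<subseteq> X"
    proof
      fix \<sigma> assume "\<sigma> \<in> {\<sigma> \<in> ?K s. \<not> ?Q \<sigma> \<and> card \<sigma> \<le> q + 2}"
      then obtain \<tau> where \<tau>: "\<sigma> = fst ` \<tau>" "\<tau> \<subseteq> restr \<xi> A" "\<tau> \<noteq> {}" "finite \<tau>" "\<kappa> \<tau> \<le> s"
        and \<sigma>: "\<not> ?Q \<sigma>" "card \<sigma> \<le> q + 2"
        unfolding Kcx_iff by blast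
      obtain p where p: "p \<in> \<tau>" using \<tau>(3) by blast
      have pA: "fst p \<in> A" using p \<tau>(2) unfolding restr_def by auto
      obtain z where z: "z \<in> lattice M" "fst p \<in> cell M z" using ex_cell[OF M] by blast
      have "fst p \<in> ball z (M * DIM('a)) \<inter> A" using dist_cell[OF z(2) M] pA by simp
      then have "z \<in> near_pts M (M * DIM('a)) A" using z(1) unfolding near_pts_def by blast
      then have zD: "z \<in> D" using D(3) by blast
      obtain p' where p': "p' \<in> \<tau>" "fst p' \<notin> cell M z" using \<sigma>(1) zD \<tau>(1) by blast
      \<comment> \<open>The position of \<open>p\<close> relative to its cell is rounded to the unit
        lattice. The rounding error is below \<open>DIM('a)\<close> and the diameter of the simplex
        below \<rho>, which explains the radius \<open>R\<close>.\<close>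
      obtain c where c: "c \<in> lattice 1" "fst p - z \<in> cell 1 c" using ex_cell[of 1] by auto
      have dc: "dist (z + c) (fst p) < DIM('a)"
      proof -
        have "dist c (fst p - z) < DIM('a)" using dist_cell[OF c(2)] by simp
        moreover have "dist (z + c) (fst p) = dist c (fst p - z)" by (simp add: dist_norm algebra_simps)
        ultimately show ?thesis by simp
      qed
      have near: "dist (z + c) (fst p'') < R" if "p'' \<in> \<tau>" for p''
        using dist_triangle[of "z + c" "fst p''" "fst p"] dc \<rho>(2)[OF \<tau>(4,5) p that] unfolding R_def by linarith
      have cl: "dist c (x - z) < R \<longleftrightarrow> dist (z + c) x < R" for x
        by (simp add: dist_norm algebra_simps)
      have "fst p - z \<in> ball c R \<inter> cell M 0" using near[OF p] z(2) cell_shift[of "fst p" M z] cl by simp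
      then have "c \<in> near_pts 1 R (cell M 0)" using c(1) unfolding near_pts_def by blast
      moreover have "fst p' - z \<in> ball c R" "fst p' - z \<notin> cell M 0"
        using near[OF p'(1)] p'(2) cell_shift[of "fst p'" M z] cl by simp_all
      then have "c \<notin> inner_pts 1 R (cell M 0)" unfolding inner_pts_def by blast
      ultimately have cL: "c \<in> layer M R" unfolding layer_def by blast
      have "\<tau> \<subseteq> restr \<xi> (ball (z + c) R)"
        using near \<tau>(2) unfolding restr_def by auto
      then have "\<sigma> \<in> ?small (ball (z + c) R)" using \<tau>(1,3) \<sigma>(2) by auto
      then show "\<sigma> \<in> X" unfolding X_def using zD cL by blast
    qed
    have "\<bar>real (pbetti F (?K r) (?K s) q) - real (pbetti F {\<sigma> \<in> ?K r. ?Q \<sigma>} {\<sigma> \<in> ?K s. ?Q \<sigma>} q)\<bar> \<le> card X"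
      by (rule betti_perturb_Q[OF finite_Kcx[OF finA] Kcx_finite Kcx_mono[OF rs] finX sub])
    moreover have "{\<sigma> \<in> ?K t. ?Q \<sigma>} = ?K'' t" for t
      unfolding Kcx_restr_filter[symmetric] by blast
    ultimately have "\<bar>betti A \<xi> - real (pbetti F (?K'' r) (?K'' s) q)\<bar> \<le> card X" unfolding betti_def by simp
    also have "card X \<le> (\<Sum>z\<in>D. card (\<Union>c\<in>layer M R. ?small (ball (z + c) R)))"
      unfolding X_def by (rule card_UN_le[OF D(1)])
    also have "\<dots> \<le> (\<Sum>z\<in>D. \<Sum>c\<in>layer M R. card (?small (ball (z + c) R)))"
      by (intro sum_mono card_UN_le[OF finL])
    also have "\<dots> \<le> (\<Sum>z\<in>D. \<Sum>c\<in>layer M R. card (restr \<xi> (ball (z + c) R)) ^ (q + 2))"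
      by (intro sum_mono card_small_subsets(2)[OF finB])
    finally show ?thesis by simp
  qed
  \<comment> \<open>Here no simplex crosses a cell boundary; those removed leave \<open>A\<close>
    and therefore lie in cells at lattice points that are not inner.\<close>
  have bdry: "\<bar>real (pbetti F (?K' r) (?K' s) q) - real (pbetti F (?K'' r) (?K'' s) q)\<bar>
    \<le> (\<Sum>z\<in>D - I. real (card (restr \<xi> (cell M z))) ^ (q + 2))"
  proof -
    let ?Q = "\<lambda>\<sigma>. \<sigma> \<subseteq> A"
    define X where "X = (\<Union>z\<in>D - I. ?small (cell M z))"
    have finX: "finite X" unfolding X_def using D(1) card_small_subsets(1)[OF finC] by (intro finite_UN_I) auto
    have sub: "{\<sigma> \<in> ?K' s. \<not> ?Q \<sigma> \<and> card \<sigma> \<le> q + 2} \<subseteq> X"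
    proof
      fix \<sigma> assume "\<sigma> \<in> {\<sigma> \<in> ?K' s. \<not> ?Q \<sigma> \<and> card \<sigma> \<le> q + 2}"
      then obtain z where z: "z \<in> D" "\<sigma> \<in> Kcx \<kappa> (restr \<xi> (cell M z)) s" "\<not> \<sigma> \<subseteq> A" "card \<sigma> \<le> q + 2" by blast
      have sf: "\<sigma> \<subseteq> fst ` restr \<xi> (cell M z)" by (rule Kcx_subset[OF z(2)])
      have "fst ` restr \<xi> (cell M z) \<subseteq> cell M z" unfolding restr_def by auto
      moreover have "cell M z \<subseteq> ball z (M * DIM('a))" using dist_cell[OF _ M] by auto
      ultimately have "\<not> ball z (M * DIM('a)) \<subseteq> A" using sf z(3) by blast
      then have "z \<in> D - I" using z(1) unfolding I_def inner_pts_def by blast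
      moreover have "\<sigma> \<in> ?small (cell M z)" using sf Kcx_nonempty[OF z(2)] z(4) by blast
      ultimately show "\<sigma> \<in> X" unfolding X_def by blast
    qed
    have fK: "finite (?K' s)" using D(1) finite_Kcx[OF finC] by (intro finite_UN_I)
    have fm: "finite \<sigma>" if "\<sigma> \<in> ?K' s" for \<sigma> using that Kcx_finite by blast
    have mo: "?K' r \<subseteq> ?K' s" using Kcx_mono[OF rs] by (intro UN_mono) auto
    have "\<bar>real (pbetti F (?K' r) (?K' s) q) - real (pbetti F {\<sigma> \<in> ?K' r. ?Q \<sigma>} {\<sigma> \<in> ?K' s. ?Q \<sigma>} q)\<bar> \<le> card X"
      by (rule betti_perturb_Q[OF fK fm mo finX sub])
    moreover have "{\<sigma> \<in> ?K' t. ?Q \<sigma>} = ?K'' t" for t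
    proof -
      have "{\<sigma> \<in> ?K' t. ?Q \<sigma>} = (\<Union>z\<in>D. {\<sigma> \<in> Kcx \<kappa> (restr \<xi> (cell M z)) t. \<sigma> \<subseteq> A})" by blast
      then show ?thesis unfolding Kcx_restr_filter by (simp add: Int_commute)
    qed
    ultimately have "\<bar>real (pbetti F (?K' r) (?K' s) q) - real (pbetti F (?K'' r) (?K'' s) q)\<bar> \<le> card X" by simp
    also have "card X \<le> (\<Sum>z\<in>D - I. card (?small (cell M z)))"
      unfolding X_def by (rule card_UN_le) (use D(1) in simp)
    also have "\<dots> \<le> (\<Sum>z\<in>D - I. card (restr \<xi> (cell M z)) ^ (q + 2))"
      by (intro sum_mono card_small_subsets(2)[OF finC])
    finally show ?thesis by simp
  qed
  have "(\<Sum>z\<in>D. betti (cell M z) \<xi>) = real (pbetti F (?K' r) (?K' s) q)"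
    using betti_cells[OF \<xi> D(1,2) M, of UNIV] by simp
  then have "\<bar>betti A \<xi> - (\<Sum>z\<in>D. betti (cell M z) \<xi>)\<bar>
    \<le> (\<Sum>z\<in>D. \<Sum>c\<in>layer M R. real (card (restr \<xi> (ball (z + c) R))) ^ (q + 2))
      + (\<Sum>z\<in>D - I. real (card (restr \<xi> (cell M z))) ^ (q + 2))"
    using cross bdry by linarith
  moreover have "betti (cell M 0) (shift (- z) \<xi>) = betti (cell M z) \<xi>" for z
    using betti_shift[OF \<xi> bounded_cell[OF M], of 0 "- z"] translate(1)[of z] by simp
  ultimately show ?thesis
    unfolding card_restr_shift translate I_def by simp
qed

end

section \<open>Stationary processes\<close>

text \<open>The points where \<open>Q\<close> fails lie in an intersection of events of arbitrarily
  small probability. This form suits limits along uncountable nets, whose failure set may not be an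
  event.\<close>

lemma (in prob_space) AE_small_exceptions:
  assumes "\<And>d. d > 0 \<Longrightarrow> \<exists>E\<in>events. prob E \<le> d \<and> (\<forall>x\<in>space M - E. Q x)"
  shows "AE x in M. Q x"
proof -
  have "\<forall>k::nat. \<exists>E. E \<in> events \<and> prob E \<le> 1 / Suc k \<and> (\<forall>x\<in>space M - E. Q x)"
  proof
    fix k :: nat
    show "\<exists>E. E \<in> events \<and> prob E \<le> 1 / Suc k \<and> (\<forall>x\<in>space M - E. Q x)"
      using assms[of "1 / Suc k"] by auto
  qed
  from choice[OF this] obtain E where
    E: "\<forall>k::nat. E k \<in> events \<and> prob (E k) \<le> 1 / Suc k \<and> (\<forall>x\<in>space M - E k. Q x)" by (rule exE)
  define N where "N = (\<Inter>k. E k)"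
  have N: "N \<in> events" unfolding N_def using E by (intro sets.countable_INT) auto
  have "prob N \<le> 1 / Suc k" for k
  proof -
    have "prob N \<le> prob (E k)" using E N by (intro finite_measure_mono) (auto simp: N_def)
    then show ?thesis using E by (meson order_trans)
  qed
  then have "prob N \<le> 0" by (intro LIMSEQ_le_const[OF LIMSEQ_inverse_real_of_nat]) (auto simp: inverse_eq_divide)
  then have "prob N = 0" using measure_nonneg[of M N] by linarith
  then have "AE x in M. x \<notin> N" using N by (simp add: prob_eq_0)
  then show ?thesis using AE_space
  proof eventually_elim
    case (elim x)
    then obtain k where "x \<notin> E k" unfolding N_def by blast
    then show ?case using E elim(2) by blast
  qed
qed

lemma abs_average_le:
  fixes x y z a b c d c' d' :: real
  assumes "\<bar>x - y\<bar> \<le> a + c" "c \<le> c'" "\<bar>x - z\<bar> \<le> b + d" "d \<le> d'"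
  shows "\<bar>x - (y + z) / 2\<bar> \<le> (a + b) / 2 + (c' + d') / 2"
proof -
  have "x - (y + z) / 2 = ((x - y) + (x - z)) / 2" by (simp add: field_simps)
  then have "\<bar>x - (y + z) / 2\<bar> = \<bar>(x - y) + (x - z)\<bar> / 2" by (simp only: abs_divide abs_numeral)
  also have "\<dots> \<le> (\<bar>x - y\<bar> + \<bar>x - z\<bar>) / 2" by (intro divide_right_mono abs_triangle_ineq) simp
  also have "\<dots> \<le> (a + b) / 2 + (c' + d') / 2" using assms by (simp add: add_divide_distrib[symmetric])
  finally show ?thesis .
qed

text \<open>Common bookkeeping for means and for single configurations: v is the volume of the
  region, w that of a cell, N and t count the near and the rim cells, u is the value per cell,
  \<eta> * w the error per near cell and H the error per rim cell.\<close>

lemma density_estimate: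
  fixes w v N t H e \<eta> x u :: real
  assumes w: "w \<ge> 1" and l: "v > 0" and N: "v \<le> N * w" "N * w \<le> (1 + e) * v"
    and d: "t \<ge> 0" "t * w \<le> e * v" and nn: "H \<ge> 0" "\<eta> \<ge> 0" "e \<ge> 0"
    and x: "\<bar>x - N * u\<bar> \<le> N * (\<eta> * w) + t * H"
  shows "\<bar>x / v - u / w\<bar> \<le> \<eta> + e * (\<eta> + H + \<bar>u\<bar>)"
proof -
  have "N * (\<eta> * w) \<le> \<eta> * ((1 + e) * v)"
    using mult_left_mono[OF N(2) nn(2)] by (simp add: mult_ac)
  moreover have "t * H \<le> (e * v) * H"
  proof -
    have "t * 1 \<le> t * w" using d(1) w by (intro mult_left_mono) auto
    then show ?thesis using d nn by (intro mult_right_mono) auto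
  qed
  moreover have "\<bar>N * u - v / w * u\<bar> \<le> e * v * \<bar>u\<bar>"
  proof -
    have "N - v / w = (N * w - v) / w" using w by (simp add: diff_divide_distrib)
    moreover have "(N * w - v) / w \<le> N * w - v"
      using N(1) w by (simp add: divide_le_eq mult_le_cancel_left1)
    moreover have "N * w - v \<le> e * v" using N(2) by (simp add: algebra_simps)
    moreover have "0 \<le> (N * w - v) / w" using N(1) w by simp
    ultimately have "\<bar>N - v / w\<bar> \<le> e * v" by linarith
    then have "\<bar>N - v / w\<bar> * \<bar>u\<bar> \<le> e * v * \<bar>u\<bar>" by (intro mult_right_mono) auto
    then show ?thesis by (simp add: abs_mult[symmetric] left_diff_distrib)
  qed
  ultimately have "\<bar>x - v / w * u\<bar> \<le> \<eta> * ((1 + e) * v) + (e * v) * H + e * v * \<bar>u\<bar>"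
    using x by linarith
  also have "\<dots> = v * (\<eta> + e * (\<eta> + H + \<bar>u\<bar>))" by (simp add: algebra_simps)
  finally have "\<bar>x - v / w * u\<bar> / v \<le> \<eta> + e * (\<eta> + H + \<bar>u\<bar>)"
    using l by (simp add: pos_divide_le_eq mult.commute)
  moreover have "\<bar>x - v / w * u\<bar> / v = \<bar>x / v - u / w\<bar>"
  proof -
    have "x / v - u / w = (x - v / w * u) / v" using l w by (simp add: field_simps)
    then show ?thesis using l by (simp add: abs_divide)
  qed
  ultimately show ?thesis by simp
qed

text \<open>The rim estimate for the unit lattice, applied to the cell of side \<open>M\<close> as
  the convex set; its inradius is M / 2.\<close>

lemma layer_density:
  assumes R: "real DIM('a) \<le> R" and e: "e > 0"
  shows "\<exists>M::real\<ge>1. card (layer M R :: 'a::euclidean_space set) \<le> e * M ^ DIM('a)"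
proof -
  obtain \<rho>0 where \<rho>0: "2 * R < \<rho>0" "\<And>(A :: 'a set) c. A \<in> sets borel \<Longrightarrow> bounded A \<Longrightarrow> convex A \<Longrightarrow>
    ball c \<rho>0 \<subseteq> A \<Longrightarrow> measure lborel A > 0 \<and> measure lborel A \<le> card (near_pts 1 R A) * 1 ^ DIM('a) \<and>
      card (near_pts 1 R A) * 1 ^ DIM('a) \<le> (1 + e) * measure lborel A \<and>
      card (near_pts 1 R A - inner_pts 1 R A) * 1 ^ DIM('a) \<le> e * measure lborel A"
    using near_pts_asymptotics[of 1 R e, where 'a='a] R e by auto
  define M where "M = max 1 (2 * \<rho>0)"
  have M: "M \<ge> 1" "M > 0" "\<rho>0 \<le> M / 2" unfolding M_def by auto
  have "ball (0 + (\<Sum>b\<in>Basis. (M / 2) *\<^sub>R b)) \<rho>0 \<subseteq> cell M (0 :: 'a)"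
    using ball_in_cell[OF M(2), of "0 :: 'a"] subset_ball[OF M(3)] by blast
  from \<rho>0(2)[OF cell_measure(1)[OF M(2)] bounded_cell[OF M(2)] convex_cell this]
  have "card (layer M R :: 'a set) \<le> e * M ^ DIM('a)"
    unfolding layer_def by (simp add: cell_measure(3)[OF M(2)])
  then show ?thesis using M(1) by blast
qed

text \<open>The law of the process serves as the probability space, so that translations act on
  it.\<close>

locale stationary_filtration = admissible_filtration F \<kappa> r s q + prob_space \<mu>
  for F :: "'k::field itself" and \<kappa> :: "('a::euclidean_space \<times> 'm::polish_space) set \<Rightarrow> real"
    and r s :: real and q :: nat and \<mu> :: "('a \<times> 'm) set measure" +
  assumes sets_\<mu>: "sets \<mu> = sets config_space"
    and stationary: "distr \<mu> config_space (shift a) = \<mu>"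
    and moments: "A \<in> sets borel \<Longrightarrow> bounded A \<Longrightarrow> integrable \<mu> (\<lambda>\<xi>. real (card (restr \<xi> A)) ^ p)"
begin

lemma space_\<mu>: "space \<mu> = configs"
  using sets_eq_imp_space_eq[OF sets_\<mu>] by (simp add: space_config_space)

text \<open>The sign is chosen so that acting with \<open>z\<close> moves the cell at
  \<open>z\<close> to the origin.\<close>

sublocale pmp_action \<mu> "\<lambda>a. shift (- a)"
proof
  fix a :: 'a
  have "measurable \<mu> \<mu> = measurable config_space (config_space :: ('a \<times> 'm) set measure)"
    by (rule measurable_cong_sets[OF sets_\<mu> sets_\<mu>])
  then show "shift (- a) \<in> measurable \<mu> \<mu>" using measurable_shift by simp
  have "distr \<mu> \<mu> (shift (- a)) = distr \<mu> config_space (shift (- a))"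
    by (rule distr_cong[OF refl sets_\<mu> refl])
  then show "distr \<mu> \<mu> (shift (- a)) = \<mu>" using stationary by simp
next
  fix x :: "('a \<times> 'm) set" and a b :: 'a
  show "shift (- a) (shift (- b) x) = shift (- (a + b)) x" unfolding shift_shift by (simp add: add.commute)
qed

lemma betti_nonneg: "betti A \<xi> \<ge> 0"
  unfolding betti_def by simp

lemma betti_measurable:
  assumes "A \<in> sets borel" "bounded A"
  shows "betti A \<in> borel_measurable \<mu>"
proof -
  have "(\<lambda>\<xi>. real (pbetti F (Kcx \<kappa> (restr \<xi> A) r) (Kcx \<kappa> (restr \<xi> A) s) q)) \<in> borel_measurable config_space"
    by (rule measurable_compose[OF measurable_pbetti[OF \<kappa> rs assms]]) simp
  moreover have "betti A = (\<lambda>\<xi>. real (pbetti F (Kcx \<kappa> (restr \<xi> A) r) (Kcx \<kappa> (restr \<xi> A) s) q))"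
    unfolding betti_def by (rule ext) simp
  ultimately show ?thesis
    using measurable_cong_sets[OF sets_\<mu> refl, of "borel :: real measure"] by simp
qed

text \<open>\<open>mean_ergodic\<close> asks for square integrability of the cell functional, which
  consumes the moment of order 2 (q + 2).\<close>

lemma betti_square_integrable:
  assumes "A \<in> sets borel" "bounded A"
  shows "integrable \<mu> (\<lambda>\<xi>. (betti A \<xi>)\<^sup>2)"
proof (rule Bochner_Integration.integrable_bound[OF moments[OF assms, of "(q + 2) * 2"]])
  show "(\<lambda>\<xi>. (betti A \<xi>)\<^sup>2) \<in> borel_measurable \<mu>"
    using betti_measurable[OF assms] by (rule borel_measurable_power)
  show "AE \<xi> in \<mu>. norm ((betti A \<xi>)\<^sup>2) \<le> norm (real (card (restr \<xi> A)) ^ ((q + 2) * 2))"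
  proof (rule AE_I2)
    fix \<xi> assume "\<xi> \<in> space \<mu>"
    then have "(betti A \<xi>)\<^sup>2 \<le> (real (card (restr \<xi> A)) ^ (q + 2))\<^sup>2"
      using betti_bound[OF _ assms(2)] betti_nonneg by (intro power_mono) (auto simp: space_\<mu>)
    then have "(betti A \<xi>)\<^sup>2 \<le> real (card (restr \<xi> A)) ^ ((q + 2) * 2)" by (simp only: power_mult)
    then show "norm ((betti A \<xi>)\<^sup>2) \<le> norm (real (card (restr \<xi> A)) ^ ((q + 2) * 2))"
      unfolding real_norm_def abs_power2 by (rule order_trans[OF _ abs_ge_self])
  qed
qed

lemma betti_integrable:
  assumes "A \<in> sets borel" "bounded A"
  shows "integrable \<mu> (betti A)"
  by (rule integrable_of_square[OF betti_measurable[OF assms] betti_square_integrable[OF assms]])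

text \<open>Up to a boundary term, the Betti number of \<open>A\<close> is the sum of the shifts of \<open>u\<close> by the lattice
  points near \<open>A\<close>, with an error of mean at most \<open>\<epsilon>\<close> per lattice point.\<close>

definition approximates :: "real \<Rightarrow> real \<Rightarrow> (('a \<times> 'm) set \<Rightarrow> real) \<Rightarrow> bool" where
  "approximates M \<epsilon> u \<longleftrightarrow> (\<exists>R g h. M * DIM('a) \<le> R \<and> integrable \<mu> g \<and> (\<forall>\<xi>. g \<xi> \<ge> 0) \<and>
     integrable \<mu> h \<and> (\<forall>\<xi>. h \<xi> \<ge> 0) \<and> expectation g \<le> \<epsilon> \<and>
     (\<forall>\<xi>\<in>configs. \<forall>A D. bounded A \<longrightarrow> finite D \<longrightarrow> D \<subseteq> lattice M \<longrightarrow> near_pts M R A \<subseteq> D \<longrightarrow>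
        \<bar>betti A \<xi> - (\<Sum>z\<in>D. u (shift (- z) \<xi>))\<bar>
          \<le> (\<Sum>z\<in>D. g (shift (- z) \<xi>)) + (\<Sum>z\<in>D - inner_pts M R A. h (shift (- z) \<xi>))))"

lemma approximatesI:
  fixes M :: real
  assumes "M * DIM('a) \<le> R" "integrable \<mu> g" "\<And>\<xi>. g \<xi> \<ge> 0" "integrable \<mu> h" "\<And>\<xi>. h \<xi> \<ge> 0" "expectation g \<le> \<epsilon>"
    and "\<And>\<xi> A D. \<xi> \<in> configs \<Longrightarrow> bounded A \<Longrightarrow> finite D \<Longrightarrow> D \<subseteq> lattice M \<Longrightarrow> near_pts M R A \<subseteq> D \<Longrightarrow>
        \<bar>betti A \<xi> - (\<Sum>z\<in>D. u (shift (- z) \<xi>))\<bar>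
          \<le> (\<Sum>z\<in>D. g (shift (- z) \<xi>)) + (\<Sum>z\<in>D - inner_pts M R A. h (shift (- z) \<xi>))"
  shows "approximates M \<epsilon> u"
  unfolding approximates_def
  by (rule exI[of _ R], rule exI[of _ g], rule exI[of _ h]) (simp add: assms)

lemma approximatesE:
  fixes M :: real
  assumes "approximates M \<epsilon> u"
  obtains R g h where "M * DIM('a) \<le> R" "integrable \<mu> g" "\<And>\<xi>. g \<xi> \<ge> 0" "integrable \<mu> h" "\<And>\<xi>. h \<xi> \<ge> 0"
    "expectation g \<le> \<epsilon>"
    "\<And>\<xi> A D. \<xi> \<in> configs \<Longrightarrow> bounded A \<Longrightarrow> finite D \<Longrightarrow> D \<subseteq> lattice M \<Longrightarrow> near_pts M R A \<subseteq> D \<Longrightarrow>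
        \<bar>betti A \<xi> - (\<Sum>z\<in>D. u (shift (- z) \<xi>))\<bar>
          \<le> (\<Sum>z\<in>D. g (shift (- z) \<xi>)) + (\<Sum>z\<in>D - inner_pts M R A. h (shift (- z) \<xi>))"
proof -
  from assms obtain R g h where *: "M * DIM('a) \<le> R" "integrable \<mu> g" "\<forall>\<xi>. g \<xi> \<ge> 0"
    "integrable \<mu> h" "\<forall>\<xi>. h \<xi> \<ge> 0" "expectation g \<le> \<epsilon>"
    "\<forall>\<xi>\<in>configs. \<forall>A D. bounded A \<longrightarrow> finite D \<longrightarrow> D \<subseteq> lattice M \<longrightarrow> near_pts M R A \<subseteq> D \<longrightarrow>
        \<bar>betti A \<xi> - (\<Sum>z\<in>D. u (shift (- z) \<xi>))\<bar>
          \<le> (\<Sum>z\<in>D. g (shift (- z) \<xi>)) + (\<Sum>z\<in>D - inner_pts M R A. h (shift (- z) \<xi>))"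
    unfolding approximates_def by (elim exE conjE) (rule that)
  show thesis by (rule that[of R g h]) (use * in simp_all)
qed

text \<open>By stationarity the mean power of the point count of a ball of radius \<open>R\<close>
  is independent of its centre. Thus \<open>R\<close> and \<open>G\<close> do not depend on
  \<open>M\<close>, and the error grows only with the number of layer points.\<close>

lemma approximates_betti_cell:
  obtains R and G :: real where "real DIM('a) \<le> R"
    "\<And>M::real. M > 0 \<Longrightarrow> approximates M (card (layer M R :: 'a set) * G) (betti (cell M 0))"
proof -
  obtain \<rho> where \<rho>: "\<rho> > 0"
    "\<And>\<tau> p p'. finite \<tau> \<Longrightarrow> \<kappa> \<tau> \<le> s \<Longrightarrow> p \<in> \<tau> \<Longrightarrow> p' \<in> \<tau> \<Longrightarrow> dist (fst p) (fst p') < \<rho>"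
    by (rule kappa_diameter[OF \<kappa>, where s = s]) (rule that)
  define R where "R = real DIM('a) + \<rho>"
  define b where "b c \<xi> = real (card (restr \<xi> (ball c R))) ^ (q + 2)" for c :: 'a and \<xi> :: "('a \<times> 'm) set"
  have bi: "integrable \<mu> (b c)" for c
    using moments[of "ball c R" "q + 2"] unfolding b_def[abs_def] by simp
  have be: "expectation (b c) = expectation (b 0)" for c
  proof -
    have "b c \<xi> = b 0 (shift (- c) \<xi>)" for \<xi>
    proof -
      have "(\<lambda>x. x + c) ` ball 0 R = (+) c ` ball 0 R" by (intro image_cong) (auto simp: add.commute)
      then have "(\<lambda>x. x + c) ` ball 0 R = ball c R" unfolding image_add_ball by simp
      then show ?thesis unfolding b_def card_restr_shift by simp
    qed
    then have "expectation (b c) = expectation (\<lambda>\<xi>. b 0 (shift (- c) \<xi>))" by presburger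
    also have "\<dots> = expectation (b 0)" by (rule integral_T) (use bi in simp)
    finally show ?thesis .
  qed
  have "approximates M (card (layer M R :: 'a set) * expectation (b 0)) (betti (cell M 0))" if M: "M > 0" for M
  proof (rule approximatesI)
    show "M * DIM('a) \<le> M * DIM('a)" by simp
    show "integrable \<mu> (\<lambda>\<xi>. \<Sum>c\<in>layer M R. b c \<xi>)" using bi by (rule Bochner_Integration.integrable_sum)
    show "(\<Sum>c\<in>layer M R. b c \<xi>) \<ge> 0" for \<xi> unfolding b_def by (intro sum_nonneg) simp
    show "integrable \<mu> (\<lambda>\<xi>. real (card (restr \<xi> (cell M 0))) ^ (q + 2))"
      by (rule moments[OF cell_measure(1)[OF M] bounded_cell[OF M]])
    show "real (card (restr \<xi> (cell M 0))) ^ (q + 2) \<ge> 0" for \<xi> by simp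
    show "expectation (\<lambda>\<xi>. \<Sum>c\<in>layer M R. b c \<xi>) \<le> card (layer M R :: 'a set) * expectation (b 0)"
    proof -
      have "expectation (\<lambda>\<xi>. \<Sum>c\<in>layer M R. b c \<xi>) = (\<Sum>c\<in>layer M R. expectation (b c))"
        using bi by (rule Bochner_Integration.integral_sum)
      also have "\<dots> = (\<Sum>c\<in>(layer M R :: 'a set). expectation (b 0))" by (rule sum.cong[OF refl be])
      finally show ?thesis by simp
    qed
    show "\<bar>betti A \<xi> - (\<Sum>z\<in>D. betti (cell M 0) (shift (- z) \<xi>))\<bar>
      \<le> (\<Sum>z\<in>D. \<Sum>c\<in>layer M R. b c (shift (- z) \<xi>))
        + (\<Sum>z\<in>D - inner_pts M (M * DIM('a)) A. real (card (restr (shift (- z) \<xi>) (cell M 0))) ^ (q + 2))"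
      if "\<xi> \<in> configs" "bounded A" "finite D" "D \<subseteq> lattice M" "near_pts M (M * DIM('a)) A \<subseteq> D" for \<xi> A D
      using betti_tiling[OF that(1,2) M \<rho> that(3-5)] unfolding b_def R_def .
  qed
  moreover have "real DIM('a) \<le> R" unfolding R_def using \<rho>(1) by simp
  ultimately show thesis using that by blast
qed

lemma approximates_mono: "approximates M \<epsilon> u \<Longrightarrow> \<epsilon> \<le> \<epsilon>' \<Longrightarrow> approximates M \<epsilon>' u"
proof (erule approximatesE)
  fix R g h assume e: "\<epsilon> \<le> \<epsilon>'" and *: "M * DIM('a) \<le> R" "integrable \<mu> g" "\<And>\<xi>. g \<xi> \<ge> 0" "integrable \<mu> h" "\<And>\<xi>. h \<xi> \<ge> 0"
    "expectation g \<le> \<epsilon>"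
    "\<And>\<xi> A D. \<xi> \<in> configs \<Longrightarrow> bounded A \<Longrightarrow> finite D \<Longrightarrow> D \<subseteq> lattice M \<Longrightarrow> near_pts M R A \<subseteq> D \<Longrightarrow>
        \<bar>betti A \<xi> - (\<Sum>z\<in>D. u (shift (- z) \<xi>))\<bar>
          \<le> (\<Sum>z\<in>D. g (shift (- z) \<xi>)) + (\<Sum>z\<in>D - inner_pts M R A. h (shift (- z) \<xi>))"
  show "approximates M \<epsilon>' u" by (rule approximatesI[OF *(1-5) order_trans[OF *(6) e] *(7)])
qed

lemma ex_good_tiling:
  assumes "\<eta> > 0"
  shows "\<exists>M::real\<ge>1. approximates M (\<eta> * M ^ DIM('a)) (betti (cell M 0))"
proof -
  obtain R and G :: real where RG: "real DIM('a) \<le> R"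
    "\<And>M::real. M > 0 \<Longrightarrow> approximates M (card (layer M R :: 'a set) * G) (betti (cell M 0))"
    by (rule approximates_betti_cell) (rule that)
  define e where "e = \<eta> / (\<bar>G\<bar> + 1)"
  have e: "e > 0" "e * \<bar>G\<bar> \<le> \<eta>" unfolding e_def using assms by (simp_all add: field_simps)
  obtain M where M: "M \<ge> 1" "card (layer M R :: 'a set) \<le> e * M ^ DIM('a)"
    using layer_density[OF RG(1) e(1)] by blast
  have "card (layer M R :: 'a set) * G \<le> card (layer M R :: 'a set) * \<bar>G\<bar>" by (intro mult_left_mono) auto
  also have "\<dots> \<le> e * M ^ DIM('a) * \<bar>G\<bar>" using M(2) by (intro mult_right_mono) auto
  also have "\<dots> = e * \<bar>G\<bar> * M ^ DIM('a)" by simp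
  also have "\<dots> \<le> \<eta> * M ^ DIM('a)" using e(2) M(1) by (intro mult_right_mono) auto
  finally have "card (layer M R :: 'a set) * G \<le> \<eta> * M ^ DIM('a)" .
  moreover have "M > 0" using M(1) by simp
  ultimately show ?thesis using approximates_mono[OF RG(2)] M(1) by blast
qed

lemma near_pts_radius_mono: "R \<le> R' \<Longrightarrow> near_pts M R A \<subseteq> near_pts M R' (A :: 'a set)"
  unfolding near_pts_def using subset_ball by blast

lemma inner_pts_radius_mono: "R \<le> R' \<Longrightarrow> inner_pts M R' A \<subseteq> inner_pts M R (A :: 'a set)"
  unfolding inner_pts_def using subset_ball by blast

text \<open>A shift of the functional is absorbed by translating both the region and the
  configuration, at the cost of increasing the radius by \<open>norm a\<close>; for a midpoint the
  two estimates are averaged with the larger radius. The mean error per cell does not grow.\<close>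

lemma approximates_mix:
  assumes "mix f u" "approximates M \<epsilon> f"
  shows "approximates M \<epsilon> u"
  using assms
proof (induction rule: mix.induct)
  case (shift u a)
  obtain R g h where *: "M * DIM('a) \<le> R" "integrable \<mu> g" "\<And>\<xi>. g \<xi> \<ge> 0" "integrable \<mu> h" "\<And>\<xi>. h \<xi> \<ge> 0"
    "expectation g \<le> \<epsilon>"
    "\<And>\<xi> A D. \<xi> \<in> configs \<Longrightarrow> bounded A \<Longrightarrow> finite D \<Longrightarrow> D \<subseteq> lattice M \<Longrightarrow> near_pts M R A \<subseteq> D \<Longrightarrow>
        \<bar>betti A \<xi> - (\<Sum>z\<in>D. u (Defs.shift (- z) \<xi>))\<bar>
          \<le> (\<Sum>z\<in>D. g (Defs.shift (- z) \<xi>)) + (\<Sum>z\<in>D - inner_pts M R A. h (Defs.shift (- z) \<xi>))"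
    by (rule approximatesE[OF shift.IH[OF shift.prems]]) (rule that)
  have comm: "Defs.shift (- a) (Defs.shift (- z) \<xi>) = Defs.shift (- z) (Defs.shift (- a) \<xi>)" for z and \<xi> :: "('a \<times> 'm) set"
    unfolding shift_shift by (simp add: add.commute)
  show ?case
  proof (rule approximatesI)
    show "M * DIM('a) \<le> R + norm a" using *(1) norm_ge_zero[of a] by linarith
    show "integrable \<mu> (\<lambda>\<xi>. g (Defs.shift (- a) \<xi>))" "integrable \<mu> (\<lambda>\<xi>. h (Defs.shift (- a) \<xi>))"
      by (rule integrable_T, rule *)+
    show "g (Defs.shift (- a) \<xi>) \<ge> 0" "h (Defs.shift (- a) \<xi>) \<ge> 0" for \<xi> by (rule *)+
    show "expectation (\<lambda>\<xi>. g (Defs.shift (- a) \<xi>)) \<le> \<epsilon>"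
      using integral_T[of g a] *(2,6) by simp
    fix \<xi> :: "('a \<times> 'm) set" and A D :: "'a set"
    assume \<xi>: "\<xi> \<in> configs" and A: "bounded A" and D: "finite D" "D \<subseteq> lattice M" "near_pts M (R + norm a) A \<subseteq> D"
    define A' where "A' = (\<lambda>x. x - a) ` A"
    have bA': "bounded A'" unfolding A'_def using bounded_translation_minus[OF A, of a] by simp
    have inv: "(\<lambda>x. x - - a) ` A' = A" unfolding A'_def by (simp add: image_image)
    have nb: "near_pts M R A' \<subseteq> near_pts M (R + norm a) A"
    proof
      fix z assume "z \<in> near_pts M R A'"
      then obtain y where y: "z \<in> lattice M" "y \<in> A" "dist z (y - a) < R"
        unfolding near_pts_def A'_def by auto
      have "dist z y < R + norm a"
        using dist_triangle[of z y "y - a"] y(3) by (simp add: dist_norm)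
      then show "z \<in> near_pts M (R + norm a) A" using y(1,2) unfolding near_pts_def by auto
    qed
    have ib: "inner_pts M (R + norm a) A \<subseteq> inner_pts M R A'"
    proof
      fix z assume z: "z \<in> inner_pts M (R + norm a) A"
      have "y \<in> A'" if "dist z y < R" for y
      proof -
        have "dist z (y + a) < R + norm a"
          using dist_triangle[of z "y + a" y] that by (simp add: dist_norm)
        then have "y + a \<in> A" using z unfolding inner_pts_def by auto
        then show ?thesis unfolding A'_def by force
      qed
      then show "z \<in> inner_pts M R A'" using z unfolding inner_pts_def by auto
    qed
    have "betti A' (Defs.shift (- a) \<xi>) = betti A \<xi>"
      using betti_shift[OF \<xi> bA', of "- a"] unfolding inv .
    moreover have "\<bar>betti A' (Defs.shift (- a) \<xi>) - (\<Sum>z\<in>D. u (Defs.shift (- z) (Defs.shift (- a) \<xi>)))\<bar>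
      \<le> (\<Sum>z\<in>D. g (Defs.shift (- z) (Defs.shift (- a) \<xi>))) + (\<Sum>z\<in>D - inner_pts M R A'. h (Defs.shift (- z) (Defs.shift (- a) \<xi>)))"
      by (rule *(7)[OF shift_configs[OF \<xi>] bA' D(1,2) subset_trans[OF nb D(3)]])
    moreover have "(\<Sum>z\<in>D - inner_pts M R A'. h (Defs.shift (- z) (Defs.shift (- a) \<xi>)))
      \<le> (\<Sum>z\<in>D - inner_pts M (R + norm a) A. h (Defs.shift (- z) (Defs.shift (- a) \<xi>)))"
      using D(1) ib *(5) by (intro sum_mono2) auto
    ultimately show "\<bar>betti A \<xi> - (\<Sum>z\<in>D. u (Defs.shift (- a) (Defs.shift (- z) \<xi>)))\<bar>
      \<le> (\<Sum>z\<in>D. g (Defs.shift (- a) (Defs.shift (- z) \<xi>)))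
        + (\<Sum>z\<in>D - inner_pts M (R + norm a) A. h (Defs.shift (- a) (Defs.shift (- z) \<xi>)))"
      unfolding comm by linarith
  qed
next
  case (mid u v)
  obtain R1 g1 h1 where *: "M * DIM('a) \<le> R1" "integrable \<mu> g1" "\<And>\<xi>. g1 \<xi> \<ge> 0" "integrable \<mu> h1" "\<And>\<xi>. h1 \<xi> \<ge> 0"
    "expectation g1 \<le> \<epsilon>"
    "\<And>\<xi> A D. \<xi> \<in> configs \<Longrightarrow> bounded A \<Longrightarrow> finite D \<Longrightarrow> D \<subseteq> lattice M \<Longrightarrow> near_pts M R1 A \<subseteq> D \<Longrightarrow>
        \<bar>betti A \<xi> - (\<Sum>z\<in>D. u (Defs.shift (- z) \<xi>))\<bar>
          \<le> (\<Sum>z\<in>D. g1 (Defs.shift (- z) \<xi>)) + (\<Sum>z\<in>D - inner_pts M R1 A. h1 (Defs.shift (- z) \<xi>))"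
    by (rule approximatesE[OF mid.IH(1)[OF mid.prems]]) (rule that)
  obtain R2 g2 h2 where **: "M * DIM('a) \<le> R2" "integrable \<mu> g2" "\<And>\<xi>. g2 \<xi> \<ge> 0" "integrable \<mu> h2" "\<And>\<xi>. h2 \<xi> \<ge> 0"
    "expectation g2 \<le> \<epsilon>"
    "\<And>\<xi> A D. \<xi> \<in> configs \<Longrightarrow> bounded A \<Longrightarrow> finite D \<Longrightarrow> D \<subseteq> lattice M \<Longrightarrow> near_pts M R2 A \<subseteq> D \<Longrightarrow>
        \<bar>betti A \<xi> - (\<Sum>z\<in>D. v (Defs.shift (- z) \<xi>))\<bar>
          \<le> (\<Sum>z\<in>D. g2 (Defs.shift (- z) \<xi>)) + (\<Sum>z\<in>D - inner_pts M R2 A. h2 (Defs.shift (- z) \<xi>))"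
    by (rule approximatesE[OF mid.IH(2)[OF mid.prems]]) (rule that)
  define R where "R = max R1 R2"
  have R: "R1 \<le> R" "R2 \<le> R" unfolding R_def by auto
  show ?case
  proof (rule approximatesI)
    show "M * DIM('a) \<le> R" using *(1) R(1) by linarith
    show "integrable \<mu> (\<lambda>\<xi>. (g1 \<xi> + g2 \<xi>) / 2)" "integrable \<mu> (\<lambda>\<xi>. (h1 \<xi> + h2 \<xi>) / 2)"
      using *(2,4) **(2,4) by simp_all
    show "(g1 \<xi> + g2 \<xi>) / 2 \<ge> 0" "(h1 \<xi> + h2 \<xi>) / 2 \<ge> 0" for \<xi>
      using *(3,5)[of \<xi>] **(3,5)[of \<xi>] by simp_all
    show "expectation (\<lambda>\<xi>. (g1 \<xi> + g2 \<xi>) / 2) \<le> \<epsilon>" using *(2,6) **(2,6) by simp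
    fix \<xi> :: "('a \<times> 'm) set" and A D :: "'a set"
    assume \<xi>: "\<xi> \<in> configs" and A: "bounded A" and D: "finite D" "D \<subseteq> lattice M" "near_pts M R A \<subseteq> D"
    let ?t = "\<lambda>z. Defs.shift (- z) \<xi>" and ?I = "D - inner_pts M R A"
    have half: "(\<Sum>z\<in>S. (a z + b z) / 2) = ((\<Sum>z\<in>S. a z) + (\<Sum>z\<in>S. b z)) / 2" for S :: "'a set" and a b :: "'a \<Rightarrow> real"
      by (simp add: sum_divide_distrib[symmetric] sum.distrib)
    have "\<bar>betti A \<xi> - (\<Sum>z\<in>D. u (?t z))\<bar> \<le> (\<Sum>z\<in>D. g1 (?t z)) + (\<Sum>z\<in>D - inner_pts M R1 A. h1 (?t z))"
      by (rule *(7)[OF \<xi> A D(1,2) subset_trans[OF near_pts_radius_mono[OF R(1)] D(3)]])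
    moreover have "(\<Sum>z\<in>D - inner_pts M R1 A. h1 (?t z)) \<le> (\<Sum>z\<in>?I. h1 (?t z))"
      using D(1) inner_pts_radius_mono[OF R(1), of M A] *(5) by (intro sum_mono2) auto
    moreover have "\<bar>betti A \<xi> - (\<Sum>z\<in>D. v (?t z))\<bar> \<le> (\<Sum>z\<in>D. g2 (?t z)) + (\<Sum>z\<in>D - inner_pts M R2 A. h2 (?t z))"
      by (rule **(7)[OF \<xi> A D(1,2) subset_trans[OF near_pts_radius_mono[OF R(2)] D(3)]])
    moreover have "(\<Sum>z\<in>D - inner_pts M R2 A. h2 (?t z)) \<le> (\<Sum>z\<in>?I. h2 (?t z))"
      using D(1) inner_pts_radius_mono[OF R(2), of M A] **(5) by (intro sum_mono2) auto
    ultimately show "\<bar>betti A \<xi> - (\<Sum>z\<in>D. (u (?t z) + v (?t z)) / 2)\<bar>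
      \<le> (\<Sum>z\<in>D. (g1 (?t z) + g2 (?t z)) / 2) + (\<Sum>z\<in>?I. (h1 (?t z) + h2 (?t z)) / 2)"
      unfolding half by (rule abs_average_le)
  qed
qed

section \<open>The limiting density\<close>

text \<open>Integrating the lattice approximation \<open>approximates\<close> bounds the mean density of every convex
  set of large inradius, which makes the densities of balls a Cauchy sequence.\<close>

lemma mean_density_estimate:
  fixes M :: real
  assumes M: "M \<ge> 1" and appr: "approximates M (\<eta> * M ^ DIM('a)) u" and u: "integrable \<mu> u"
    and \<eta>: "\<eta> \<ge> 0" and d: "d > 0"
  shows "\<exists>\<rho>0. \<forall>(A :: 'a set) c. A \<in> sets borel \<longrightarrow> bounded A \<longrightarrow> convex A \<longrightarrow> ball c \<rho>0 \<subseteq> A \<longrightarrow>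
    \<bar>expectation (betti A) / measure lborel A - expectation u / M ^ DIM('a)\<bar> \<le> \<eta> + d"
proof -
  obtain R g h where *: "M * DIM('a) \<le> R" "integrable \<mu> g" "\<And>\<xi>. g \<xi> \<ge> 0" "integrable \<mu> h" "\<And>\<xi>. h \<xi> \<ge> 0"
    "expectation g \<le> \<eta> * M ^ DIM('a)"
    "\<And>\<xi> A D. \<xi> \<in> configs \<Longrightarrow> bounded A \<Longrightarrow> finite D \<Longrightarrow> D \<subseteq> lattice M \<Longrightarrow> near_pts M R A \<subseteq> D \<Longrightarrow>
        \<bar>betti A \<xi> - (\<Sum>z\<in>D. u (Defs.shift (- z) \<xi>))\<bar>
          \<le> (\<Sum>z\<in>D. g (Defs.shift (- z) \<xi>)) + (\<Sum>z\<in>D - inner_pts M R A. h (Defs.shift (- z) \<xi>))"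
    by (rule approximatesE[OF appr]) (rule that)
  have M0: "M > 0" using M by simp
  define H where "H = expectation h"
  have H: "H \<ge> 0" unfolding H_def using *(5) by (intro Bochner_Integration.integral_nonneg)
  define k where "k = \<eta> + H + \<bar>expectation u\<bar>"
  have k: "k \<ge> 0" unfolding k_def using \<eta> H by simp
  \<comment> \<open>\<open>k\<close> collects the quantities multiplied by the relative rim error in
    \<open>density_estimate\<close>; adding 1 avoids division by 0.\<close>
  define e where "e = d / (k + 1)"
  have e: "e > 0" "e * k \<le> d" unfolding e_def using d k by (simp_all add: field_simps)
  obtain \<rho>0 where \<rho>0: "2 * R < \<rho>0" "\<And>(A :: 'a set) c. A \<in> sets borel \<Longrightarrow> bounded A \<Longrightarrow> convex A \<Longrightarrow>
    ball c \<rho>0 \<subseteq> A \<Longrightarrow> measure lborel A > 0 \<and> measure lborel A \<le> card (near_pts M R A) * M ^ DIM('a) \<and>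
      card (near_pts M R A) * M ^ DIM('a) \<le> (1 + e) * measure lborel A \<and>
      card (near_pts M R A - inner_pts M R A) * M ^ DIM('a) \<le> e * measure lborel A"
    by (rule near_pts_asymptotics[OF M0 *(1) e(1)]) (rule that)
  have "\<bar>expectation (betti A) / measure lborel A - expectation u / M ^ DIM('a)\<bar> \<le> \<eta> + d"
    if A: "A \<in> sets borel" "bounded A" "convex A" "ball c \<rho>0 \<subseteq> A" for A c
  proof -
    let ?D = "near_pts M R A" and ?B = "near_pts M R A - inner_pts M R A"
    note vol = \<rho>0(2)[OF A]
    have fin: "finite ?D" by (rule finite_near_pts[OF M0 A(2)])
    have i: "integrable \<mu> (\<lambda>\<xi>. \<Sum>z\<in>S. v (Defs.shift (- z) \<xi>))" if "integrable \<mu> v" for v :: "('a \<times> 'm) set \<Rightarrow> real" and S :: "'a set"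
      by (rule Bochner_Integration.integrable_sum) (rule integrable_T[OF that])
    have ex: "expectation (\<lambda>\<xi>. \<Sum>z\<in>S. v (Defs.shift (- z) \<xi>)) = card S * expectation v"
      if "integrable \<mu> v" for v :: "('a \<times> 'm) set \<Rightarrow> real" and S :: "'a set"
    proof -
      have "expectation (\<lambda>\<xi>. \<Sum>z\<in>S. v (Defs.shift (- z) \<xi>)) = (\<Sum>z\<in>S. expectation (\<lambda>\<xi>. v (Defs.shift (- z) \<xi>)))"
        by (rule Bochner_Integration.integral_sum) (rule integrable_T[OF that])
      also have "\<dots> = (\<Sum>z\<in>S. expectation v)"
        using that by (intro sum.cong refl integral_T) simp
      finally show ?thesis by simp
    qed
    have bi: "integrable \<mu> (betti A)" by (rule betti_integrable[OF A(1,2)])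
    have "\<bar>expectation (betti A) - card ?D * expectation u\<bar>
      = \<bar>expectation (\<lambda>\<xi>. betti A \<xi> - (\<Sum>z\<in>?D. u (Defs.shift (- z) \<xi>)))\<bar>"
      using Bochner_Integration.integral_diff[OF bi i[OF u]] ex[OF u] by simp
    also have "\<dots> \<le> expectation (\<lambda>\<xi>. \<bar>betti A \<xi> - (\<Sum>z\<in>?D. u (Defs.shift (- z) \<xi>))\<bar>)"
      by (rule integral_abs_bound)
    also have "\<dots> \<le> expectation (\<lambda>\<xi>. (\<Sum>z\<in>?D. g (Defs.shift (- z) \<xi>)) + (\<Sum>z\<in>?B. h (Defs.shift (- z) \<xi>)))"
    proof (rule integral_mono)
      show "integrable \<mu> (\<lambda>\<xi>. \<bar>betti A \<xi> - (\<Sum>z\<in>?D. u (Defs.shift (- z) \<xi>))\<bar>)"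
        by (intro integrable_abs Bochner_Integration.integrable_diff bi i u)
      show "integrable \<mu> (\<lambda>\<xi>. (\<Sum>z\<in>?D. g (Defs.shift (- z) \<xi>)) + (\<Sum>z\<in>?B. h (Defs.shift (- z) \<xi>)))"
        by (intro Bochner_Integration.integrable_add i *)
      fix \<xi> assume "\<xi> \<in> space \<mu>"
      then show "\<bar>betti A \<xi> - (\<Sum>z\<in>?D. u (Defs.shift (- z) \<xi>))\<bar>
        \<le> (\<Sum>z\<in>?D. g (Defs.shift (- z) \<xi>)) + (\<Sum>z\<in>?B. h (Defs.shift (- z) \<xi>))"
        unfolding space_\<mu> by (rule *(7)[OF _ A(2) fin near_pts_subset_lattice subset_refl])
    qed
    also have "\<dots> = card ?D * expectation g + card ?B * H"
      unfolding H_def using Bochner_Integration.integral_add[OF i[OF *(2)] i[OF *(4)]] ex[OF *(2)] ex[OF *(4)] by simp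
    also have "\<dots> \<le> card ?D * (\<eta> * M ^ DIM('a)) + card ?B * H"
      using *(6) by (intro add_right_mono mult_left_mono) auto
    finally have "\<bar>expectation (betti A) / measure lborel A - expectation u / M ^ DIM('a)\<bar>
      \<le> \<eta> + e * (\<eta> + H + \<bar>expectation u\<bar>)"
      using vol H \<eta> e(1) M
      by (intro density_estimate[where N = "card ?D" and t = "card ?B"]) (auto simp: one_le_power)
    then show ?thesis using e(2) unfolding k_def by linarith
  qed
  then show ?thesis by blast
qed

text \<open>Convergence uniform over all convex sets with a large inscribed ball, so that one number
  serves all nets.\<close>

definition mean_density :: "real \<Rightarrow> bool" where
  "mean_density b \<longleftrightarrow> (\<forall>d>0. \<exists>\<rho>0. \<forall>(A :: 'a set) c. A \<in> sets borel \<longrightarrow> bounded A \<longrightarrow> convex A \<longrightarrow>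
     ball c \<rho>0 \<subseteq> A \<longrightarrow> \<bar>expectation (betti A) / measure lborel A - b\<bar> \<le> d)"

lemma ex_tiling_density:
  assumes "d > 0"
  shows "\<exists>(M::real)\<ge>1. approximates M (d * M ^ DIM('a)) (betti (cell M 0)) \<and>
    (\<exists>\<rho>0. \<forall>(A :: 'a set) c. A \<in> sets borel \<longrightarrow> bounded A \<longrightarrow> convex A \<longrightarrow> ball c \<rho>0 \<subseteq> A \<longrightarrow>
      \<bar>expectation (betti A) / measure lborel A - expectation (betti (cell M 0)) / M ^ DIM('a)\<bar> \<le> 2 * d)"
proof -
  obtain M :: real where M: "M \<ge> 1" "approximates M (d * M ^ DIM('a)) (betti (cell M 0))"
    using ex_good_tiling[OF assms] by blast
  have M0: "M > 0" using M(1) by simp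
  have "integrable \<mu> (betti (cell M 0))"
    by (rule betti_integrable[OF cell_measure(1)[OF M0] bounded_cell[OF M0]])
  from mean_density_estimate[OF M this less_imp_le[OF assms] assms] M show ?thesis by auto
qed

lemma ex_mean_density: "\<exists>b\<ge>0. mean_density b"
proof -
  define v where "v n = expectation (betti (ball 0 (real n))) / measure lborel (ball (0::'a) (real n))" for n :: nat
  have near: "\<exists>m. (\<exists>N. \<forall>n\<ge>N. \<bar>v n - m\<bar> \<le> 2 * d) \<and> (\<exists>\<rho>0. \<forall>(A :: 'a set) c. A \<in> sets borel \<longrightarrow> bounded A \<longrightarrow>
      convex A \<longrightarrow> ball c \<rho>0 \<subseteq> A \<longrightarrow> \<bar>expectation (betti A) / measure lborel A - m\<bar> \<le> 2 * d)"
    if d: "d > 0" for d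
  proof -
    obtain M :: real and \<rho>0 where \<rho>0: "\<forall>(A :: 'a set) c. A \<in> sets borel \<longrightarrow> bounded A \<longrightarrow> convex A \<longrightarrow> ball c \<rho>0 \<subseteq> A \<longrightarrow>
      \<bar>expectation (betti A) / measure lborel A - expectation (betti (cell M 0)) / M ^ DIM('a)\<bar> \<le> 2 * d"
      using ex_tiling_density[OF d] by blast
    have "\<bar>v n - expectation (betti (cell M 0)) / M ^ DIM('a)\<bar> \<le> 2 * d" if n: "n \<ge> nat \<lceil>\<rho>0\<rceil>" for n
    proof -
      have "\<rho>0 \<le> real n" using n by linarith
      then have "ball (0 :: 'a) \<rho>0 \<subseteq> ball 0 (real n)" by (rule subset_ball)
      then show ?thesis unfolding v_def using \<rho>0[rule_format, of "ball 0 (real n)" 0] by simp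
    qed
    then show ?thesis using \<rho>0 by blast
  qed
  have "Cauchy v"
  proof (rule metric_CauchyI)
    fix e :: real assume e: "e > 0"
    obtain m N where N: "\<forall>n\<ge>N. \<bar>v n - m\<bar> \<le> 2 * (e / 8)" using near[of "e / 8"] e by auto
    have "dist (v i) (v j) < e" if "i \<ge> N" "j \<ge> N" for i j
      using N[rule_format, OF that(1)] N[rule_format, OF that(2)] e unfolding dist_real_def by linarith
    then show "\<exists>M. \<forall>m\<ge>M. \<forall>n\<ge>M. dist (v m) (v n) < e" by blast
  qed
  then obtain b where b: "v \<longlonglongrightarrow> b" using Cauchy_convergent convergent_def by blast
  have "v n \<ge> 0" for n
    unfolding v_def by (intro divide_nonneg_nonneg Bochner_Integration.integral_nonneg betti_nonneg measure_nonneg)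
  then have "b \<ge> 0" by (intro LIMSEQ_le_const[OF b]) auto
  moreover have "mean_density b"
    unfolding mean_density_def
  proof (intro allI impI)
    fix d :: real assume d: "d > 0"
    obtain m N \<rho>0 where m: "\<forall>n\<ge>N. \<bar>v n - m\<bar> \<le> 2 * (d / 4)"
      and \<rho>0: "\<forall>(A :: 'a set) c. A \<in> sets borel \<longrightarrow> bounded A \<longrightarrow>
      convex A \<longrightarrow> ball c \<rho>0 \<subseteq> A \<longrightarrow> \<bar>expectation (betti A) / measure lborel A - m\<bar> \<le> 2 * (d / 4)"
      using near[of "d / 4"] d by auto
    have "(\<lambda>n. \<bar>v n - m\<bar>) \<longlonglongrightarrow> \<bar>b - m\<bar>" by (intro tendsto_intros b)
    then have "\<bar>b - m\<bar> \<le> 2 * (d / 4)" by (rule LIMSEQ_le_const2) (use m in blast)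
    then have "\<bar>x - b\<bar> \<le> d" if "\<bar>x - m\<bar> \<le> 2 * (d / 4)" for x using that by linarith
    then show "\<exists>\<rho>0. \<forall>(A :: 'a set) c. A \<in> sets borel \<longrightarrow> bounded A \<longrightarrow> convex A \<longrightarrow>
     ball c \<rho>0 \<subseteq> A \<longrightarrow> \<bar>expectation (betti A) / measure lborel A - b\<bar> \<le> d" using \<rho>0 by blast
  qed
  ultimately show ?thesis by blast
qed

section \<open>Convergence of means along nets\<close>

lemma net_eventually_ball:
  assumes "convex_averaging_net A"
  shows "eventually (\<lambda>n. \<exists>c. ball c \<rho> \<subseteq> A n) at_top"
proof -
  obtain N c where "ball c \<rho> \<subseteq> A N" using assms unfolding convex_averaging_net_def by blast
  moreover have "A N \<subseteq> A n" if "N \<le> n" for n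
    using assms that unfolding convex_averaging_net_def mono_def by blast
  ultimately show ?thesis
    unfolding eventually_at_top_linorder by blast
qed

lemma net_sets:
  assumes "convex_averaging_net A"
  shows "A n \<in> sets borel" "bounded (A n)" "convex (A n)"
  using assms unfolding convex_averaging_net_def by simp_all

lemma expectation_density_tendsto:
  fixes A :: "'n::linorder \<Rightarrow> 'a set"
  assumes b: "mean_density b" and A: "convex_averaging_net A"
  shows "((\<lambda>n. expectation (betti (A n)) / measure lborel (A n)) \<longlongrightarrow> b) at_top"
proof (rule tendstoI)
  fix e :: real assume e: "e > 0"
  obtain \<rho>0 where \<rho>0: "\<forall>(A :: 'a set) c. A \<in> sets borel \<longrightarrow> bounded A \<longrightarrow> convex A \<longrightarrow>
     ball c \<rho>0 \<subseteq> A \<longrightarrow> \<bar>expectation (betti A) / measure lborel A - b\<bar> \<le> e / 2"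
    using b e unfolding mean_density_def by (metis half_gt_zero)
  show "eventually (\<lambda>n. dist (expectation (betti (A n)) / measure lborel (A n)) b < e) at_top"
    using net_eventually_ball[OF A, of \<rho>0]
  proof eventually_elim
    case (elim n)
    then show ?case using \<rho>0 net_sets[OF A, of n] e unfolding dist_real_def by fastforce
  qed
qed

text \<open>Truncation for the rim term: below \<open>c\<close> it is bounded by \<open>c\<close>
  per rim cell, and the excess has a mean so small that it may be summed over all near
  cells.\<close>

lemma integrable_excess_small:
  fixes h :: "('a \<times> 'm) set \<Rightarrow> real"
  assumes h: "integrable \<mu> h" "\<And>\<xi>. h \<xi> \<ge> 0" and d: "d > 0"
  shows "\<exists>c\<ge>0. expectation (\<lambda>\<xi>. max (h \<xi> - c) 0) < d"
proof -
  have "(\<lambda>n::nat. expectation (\<lambda>\<xi>. max (h \<xi> - real n) 0)) \<longlonglongrightarrow> expectation (\<lambda>\<xi>. 0)"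
  proof (rule integral_dominated_convergence[OF _ _ h(1)])
    show "(\<lambda>\<xi>. max (h \<xi> - real n) 0) \<in> borel_measurable \<mu>" for n using h(1) by simp
    show "AE \<xi> in \<mu>. norm (max (h \<xi> - real n) 0) \<le> h \<xi>" for n using h(2) by simp
    show "AE \<xi> in \<mu>. (\<lambda>n. max (h \<xi> - real n) 0) \<longlonglongrightarrow> 0"
    proof (rule AE_I2)
      fix \<xi>
      have "max (h \<xi> - real n) 0 = 0" if "n \<ge> nat \<lceil>h \<xi>\<rceil>" for n
        using that by linarith
      then show "(\<lambda>n. max (h \<xi> - real n) 0) \<longlonglongrightarrow> 0"
        by (intro tendsto_eventually eventually_sequentiallyI)
    qed
  qed simp
  then have "eventually (\<lambda>n::nat. expectation (\<lambda>\<xi>. max (h \<xi> - real n) 0) < d) sequentially"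
    using d by (intro order_tendstoD(2)) simp_all
  then obtain n :: nat where "expectation (\<lambda>\<xi>. max (h \<xi> - real n) 0) < d" by (auto simp: eventually_sequentially)
  then show ?thesis by (intro exI[of _ "real n"]) simp
qed

end

section \<open>Almost sure convergence\<close>

context stationary_filtration
begin

text \<open>The ergodic theorem enters only through \<open>mean_ergodic\<close>: a mixture \<open>u\<close> of shifts of the cell Betti
  number is close in mean to a constant, and the maximal inequality makes the remaining errors
  simultaneously small for all sets of the chain.\<close>

lemma density_exceptional_set:
  fixes \<A> :: "'a set set"
  assumes erg: ergodic_action and b: "mean_density b"
    and \<A>: "\<And>A. A \<in> \<A> \<Longrightarrow> A \<in> sets borel \<and> bounded A \<and> convex A"
    and chain: "\<And>A B. A \<in> \<A> \<Longrightarrow> B \<in> \<A> \<Longrightarrow> A \<subseteq> B \<or> B \<subseteq> A"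
    and l: "l > 0" and d: "d > 0"
  shows "\<exists>\<rho>0. \<exists>E\<in>events. prob E \<le> d \<and> (\<forall>\<xi>\<in>space \<mu> - E. \<forall>A\<in>\<A>. \<forall>c. ball c \<rho>0 \<subseteq> A \<longrightarrow>
    \<bar>betti A \<xi> / measure lborel A - b\<bar> \<le> l)"
proof -
  \<comment> \<open>The constant of the maximal inequality for the doubling constant of
    \<open>near_pts_doubling\<close>.\<close>
  define C :: real where "C = real (4 ^ DIM('a)) ^ 3"
  have C: "C > 0" unfolding C_def by simp
  \<comment> \<open>The first bound keeps the distance 3 * \<eta> between m / w and \<open>b\<close>
    below l / 4; the second makes the maximal inequality at level l / 4 * w give probability at most
    \<open>d\<close>.\<close>
  define \<eta> where "\<eta> = min (l / 12) (d * l / (12 * C))"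
  have \<eta>: "\<eta> > 0" "\<eta> \<le> l / 12" "\<eta> \<le> d * l / (12 * C)" unfolding \<eta>_def using l d C by auto
  obtain M :: real and \<rho>1 where M: "M \<ge> 1" and appr: "approximates M (\<eta> * M ^ DIM('a)) (betti (cell M 0))"
    and \<rho>1: "\<forall>(A :: 'a set) c. A \<in> sets borel \<longrightarrow> bounded A \<longrightarrow> convex A \<longrightarrow> ball c \<rho>1 \<subseteq> A \<longrightarrow>
      \<bar>expectation (betti A) / measure lborel A - expectation (betti (cell M 0)) / M ^ DIM('a)\<bar> \<le> 2 * \<eta>"
    using ex_tiling_density[OF \<eta>(1)] by blast
  have M0: "M > 0" using M by simp
  define w where "w = M ^ DIM('a)"
  have w: "w \<ge> 1" unfolding w_def using M by (rule one_le_power)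
  define f where "f = betti (cell M (0 :: 'a))"
  define m where "m = expectation f"
  have mb: "\<bar>m / w - b\<bar> \<le> 3 * \<eta>"
  proof -
    obtain \<rho>2 where \<rho>2: "\<forall>(A :: 'a set) c. A \<in> sets borel \<longrightarrow> bounded A \<longrightarrow> convex A \<longrightarrow>
     ball c \<rho>2 \<subseteq> A \<longrightarrow> \<bar>expectation (betti A) / measure lborel A - b\<bar> \<le> \<eta>"
      using b \<eta>(1) unfolding mean_density_def by blast
    define A where "A = ball (0 :: 'a) (max \<rho>1 \<rho>2)"
    have A: "A \<in> sets borel" "bounded A" "convex A" "ball 0 \<rho>1 \<subseteq> A" "ball 0 \<rho>2 \<subseteq> A"
      unfolding A_def by (auto intro!: subset_ball)
    have "\<bar>expectation (betti A) / measure lborel A - m / w\<bar> \<le> 2 * \<eta>"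
      using \<rho>1 A unfolding m_def f_def w_def by blast
    moreover have "\<bar>expectation (betti A) / measure lborel A - b\<bar> \<le> \<eta>" using \<rho>2 A by blast
    ultimately show ?thesis by linarith
  qed
  have f: "f \<in> borel_measurable \<mu>" "integrable \<mu> (\<lambda>\<xi>. (f \<xi>)\<^sup>2)"
    unfolding f_def
    by (rule betti_measurable[OF cell_measure(1)[OF M0] bounded_cell[OF M0]])
      (rule betti_square_integrable[OF cell_measure(1)[OF M0] bounded_cell[OF M0]])
  have \<eta>w: "\<eta> * w > 0" using \<eta>(1) w by simp
  obtain u where u: "mix f u" "expectation (\<lambda>\<xi>. \<bar>u \<xi> - expectation f\<bar>) < \<eta> * w"
    using mean_ergodic[OF erg f \<eta>w] by blast
  have um: "u \<in> borel_measurable \<mu> \<and> integrable \<mu> (\<lambda>\<xi>. (u \<xi>)\<^sup>2) \<and> expectation u = expectation f"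
    by (rule mix_props[OF u(1) f])
  have ui: "integrable \<mu> u" by (rule integrable_of_square[OF conjunct1[OF um] conjunct1[OF conjunct2[OF um]]])
  obtain R g h where *: "M * DIM('a) \<le> R" "integrable \<mu> g" "\<And>\<xi>. g \<xi> \<ge> 0" "integrable \<mu> h" "\<And>\<xi>. h \<xi> \<ge> 0"
    "expectation g \<le> \<eta> * M ^ DIM('a)"
    "\<And>\<xi> A D. \<xi> \<in> configs \<Longrightarrow> bounded A \<Longrightarrow> finite D \<Longrightarrow> D \<subseteq> lattice M \<Longrightarrow> near_pts M R A \<subseteq> D \<Longrightarrow>
        \<bar>betti A \<xi> - (\<Sum>z\<in>D. u (Defs.shift (- z) \<xi>))\<bar>
          \<le> (\<Sum>z\<in>D. g (Defs.shift (- z) \<xi>)) + (\<Sum>z\<in>D - inner_pts M R A. h (Defs.shift (- z) \<xi>))"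
    by (rule approximatesE[OF approximates_mix[OF u(1) appr[folded f_def]]]) (rule that)
  obtain c0 where c0: "c0 \<ge> 0" "expectation (\<lambda>\<xi>. max (h \<xi> - c0) 0) < \<eta> * w"
    using integrable_excess_small[OF *(4,5) \<eta>w] by blast
  \<comment> \<open>All errors that are summed over every near cell, each of mean at most \<eta> *
    w: the deviation from ergodicity, the crossing simplices and the excess of the rim term.\<close>
  define G where "G \<xi> = \<bar>u \<xi> - m\<bar> + g \<xi> + max (h \<xi> - c0) 0" for \<xi>
  have Gnn: "G \<xi> \<ge> 0" for \<xi> unfolding G_def using *(3)[of \<xi>] by simp
  have i3: "integrable \<mu> (\<lambda>\<xi>. \<bar>u \<xi> - m\<bar>)" "integrable \<mu> (\<lambda>\<xi>. max (h \<xi> - c0) 0)"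
    using ui *(4) by (auto intro!: integrable_max)
  have Gi: "integrable \<mu> G" unfolding G_def[abs_def] by (intro Bochner_Integration.integrable_add i3 *(2))
  have "expectation G = expectation (\<lambda>\<xi>. \<bar>u \<xi> - m\<bar>) + expectation g + expectation (\<lambda>\<xi>. max (h \<xi> - c0) 0)"
    unfolding G_def[abs_def] using i3 *(2) by simp
  then have EG: "expectation G \<le> 3 * \<eta> * w"
    using u(2) *(6) c0(2) unfolding m_def w_def by linarith
  define k where "k = l / 4 + c0 + \<bar>m\<bar>"
  have k: "k > 0" unfolding k_def using l c0 by simp
  define e where "e = l / (4 * k)"
  have e: "e > 0" "e * k = l / 4" unfolding e_def using l k by (simp_all add: field_simps)
  obtain \<rho>0 where \<rho>0: "2 * R < \<rho>0" "\<And>(A :: 'a set) c. A \<in> sets borel \<Longrightarrow> bounded A \<Longrightarrow> convex A \<Longrightarrow>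
    ball c \<rho>0 \<subseteq> A \<Longrightarrow> measure lborel A > 0 \<and> measure lborel A \<le> card (near_pts M R A) * M ^ DIM('a) \<and>
      card (near_pts M R A) * M ^ DIM('a) \<le> (1 + e) * measure lborel A \<and>
      card (near_pts M R A - inner_pts M R A) * M ^ DIM('a) \<le> e * measure lborel A"
    by (rule near_pts_asymptotics[OF M0 *(1) e(1)]) (rule that)
  \<comment> \<open>Small regions are discarded because doubling and nonemptiness of the near points
    require a large inscribed ball.\<close>
  define \<A>0 where "\<A>0 = {A \<in> \<A>. \<exists>c. ball c \<rho>0 \<subseteq> A}"
  define \<D> where "\<D> = near_pts M R ` \<A>0"
  define E where "E = exceed G (l / 4 * w) \<D>"
  have lw: "l / 4 * w > 0" using l w by simp
  have chainD: "D \<subseteq> D' \<or> D' \<subseteq> D" if D: "D \<in> \<D>" "D' \<in> \<D>" for D D'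
  proof -
    obtain A B where AB: "D = near_pts M R A" "D' = near_pts M R B" "A \<in> \<A>" "B \<in> \<A>"
      using D unfolding \<D>_def \<A>0_def by blast
    then show ?thesis using chain[OF AB(3,4)] near_pts_mono by metis
  qed
  have D: "finite D \<and> D \<noteq> {}" "card {x + y |x y. x \<in> D \<and> y \<in> D} \<le> 4 ^ DIM('a) * card D" if D: "D \<in> \<D>" for D
  proof -
    obtain A c where A: "D = near_pts M R A" "A \<in> \<A>" "ball c \<rho>0 \<subseteq> A"
      using D unfolding \<D>_def \<A>0_def by blast
    have A': "A \<in> sets borel" "bounded A" "convex A" using \<A>[OF A(2)] by simp_all
    show "finite D \<and> D \<noteq> {}"
      unfolding A(1) using finite_near_pts[OF M0 A'(2)] near_pts_nonempty[OF A' M0 *(1) A(3) \<rho>0(1)] by simp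
    show "card {x + y |x y. x \<in> D \<and> y \<in> D} \<le> 4 ^ DIM('a) * card D"
      unfolding A(1) by (rule near_pts_doubling[OF A' M0 *(1) A(3) \<rho>0(1)])
  qed
  note max = maximal_inequality[OF Gi Gnn lw, where \<D> = \<D>, OF D(1) chainD D(2), folded E_def]
  have "prob E \<le> d"
  proof -
    have "l / 4 * w * prob E \<le> C * (3 * \<eta> * w)"
      using max(2) mult_left_mono[OF EG less_imp_le[OF C]] unfolding C_def by linarith
    also have "C * (3 * \<eta> * w) \<le> C * (3 * (d * l / (12 * C)) * w)"
      using \<eta>(3) C w by (intro mult_left_mono mult_right_mono) auto
    also have "\<dots> = l / 4 * w * d" using C by simp
    finally show ?thesis using lw by (simp add: mult_le_cancel_left_pos)
  qed
  moreover have "\<bar>betti A \<xi> / measure lborel A - b\<bar> \<le> l"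
    if \<xi>: "\<xi> \<in> space \<mu> - E" and A: "A \<in> \<A>" and c: "ball c \<rho>0 \<subseteq> A" for \<xi> A c
  proof -
    let ?D = "near_pts M R A" and ?B = "near_pts M R A - inner_pts M R A" and ?t = "\<lambda>z. Defs.shift (- z) \<xi>"
    have A': "A \<in> sets borel" "bounded A" "convex A" using \<A>[OF A] by simp_all
    have fin: "finite ?D" by (rule finite_near_pts[OF M0 A'(2)])
    note vol = \<rho>0(2)[OF A' c]
    have "?D \<in> \<D>" unfolding \<D>_def \<A>0_def using A c by blast
    then have ex: "(\<Sum>z\<in>?D. G (?t z)) \<le> l / 4 * w * card ?D"
      using \<xi> unfolding E_def exceed_def by (force simp: not_less)
    have "\<xi> \<in> configs" using \<xi> space_\<mu> by simp
    then have "\<bar>betti A \<xi> - (\<Sum>z\<in>?D. u (?t z))\<bar> \<le> (\<Sum>z\<in>?D. g (?t z)) + (\<Sum>z\<in>?B. h (?t z))"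
      by (rule *(7)[OF _ A'(2) fin near_pts_subset_lattice subset_refl])
    moreover have "\<bar>(\<Sum>z\<in>?D. u (?t z)) - card ?D * m\<bar> \<le> (\<Sum>z\<in>?D. \<bar>u (?t z) - m\<bar>)"
    proof -
      have "(\<Sum>z\<in>?D. u (?t z)) - card ?D * m = (\<Sum>z\<in>?D. u (?t z) - m)" by (simp add: sum_subtractf)
      then show ?thesis by (simp only: sum_abs)
    qed
    moreover have "(\<Sum>z\<in>?B. h (?t z)) \<le> (\<Sum>z\<in>?D. max (h (?t z) - c0) 0) + card ?B * c0"
    proof -
      have "(\<Sum>z\<in>?B. h (?t z)) \<le> (\<Sum>z\<in>?B. max (h (?t z) - c0) 0 + c0)" by (intro sum_mono) simp
      also have "\<dots> = (\<Sum>z\<in>?B. max (h (?t z) - c0) 0) + card ?B * c0" by (simp add: sum.distrib)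
      also have "(\<Sum>z\<in>?B. max (h (?t z) - c0) 0) \<le> (\<Sum>z\<in>?D. max (h (?t z) - c0) 0)"
        using fin by (intro sum_mono2) auto
      finally show ?thesis by simp
    qed
    moreover have "(\<Sum>z\<in>?D. G (?t z)) = (\<Sum>z\<in>?D. \<bar>u (?t z) - m\<bar>) + (\<Sum>z\<in>?D. g (?t z)) + (\<Sum>z\<in>?D. max (h (?t z) - c0) 0)"
      unfolding G_def by (simp add: sum.distrib)
    ultimately have "\<bar>betti A \<xi> - card ?D * m\<bar> \<le> card ?D * (l / 4 * w) + card ?B * c0"
      using ex by (simp add: mult.commute)
    then have "\<bar>betti A \<xi> / measure lborel A - m / w\<bar> \<le> l / 4 + e * (l / 4 + c0 + \<bar>m\<bar>)"
      using vol l c0(1) e(1) w unfolding w_def[symmetric]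
      by (intro density_estimate[where N = "card ?D" and t = "card ?B"]) auto
    then have "\<bar>betti A \<xi> / measure lborel A - m / w\<bar> \<le> l / 2" using e(2) unfolding k_def by simp
    then show ?thesis using mb \<eta>(2) by linarith
  qed
  ultimately show ?thesis using max(1) by blast
qed

text \<open>For a fixed tolerance the exceptional event does not depend on the index, so only the
  tolerances 1 / (k + 1) have to be combined, countably many whatever the index set is.\<close>

lemma AE_density_tendsto:
  fixes A :: "'n::linorder \<Rightarrow> 'a set"
  assumes erg: ergodic_action and b: "mean_density b" and A: "convex_averaging_net A"
  shows "AE \<xi> in \<mu>. ((\<lambda>n. betti (A n) \<xi> / measure lborel (A n)) \<longlongrightarrow> b) at_top"
proof -
  have AEl: "AE \<xi> in \<mu>. eventually (\<lambda>n. \<bar>betti (A n) \<xi> / measure lborel (A n) - b\<bar> \<le> l) at_top" if l: "l > 0" for l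
  proof (rule AE_small_exceptions)
    fix d :: real assume d: "d > 0"
    have chain: "B \<subseteq> B' \<or> B' \<subseteq> B" if "B \<in> range A" "B' \<in> range A" for B B'
    proof -
      obtain i j where ij: "B = A i" "B' = A j" using \<open>B \<in> range A\<close> \<open>B' \<in> range A\<close> by blast
      have "mono A" using A unfolding convex_averaging_net_def by (rule conjunct1)
      then show ?thesis unfolding ij using linear[of i j] monoD[of A i j] monoD[of A j i] by blast
    qed
    have good: "B \<in> sets borel \<and> bounded B \<and> convex B" if "B \<in> range A" for B
      using that net_sets[OF A] by blast
    have "\<exists>\<rho>0. \<exists>E\<in>events. prob E \<le> d \<and> (\<forall>\<xi>\<in>space \<mu> - E. \<forall>B\<in>range A. \<forall>c. ball c \<rho>0 \<subseteq> B \<longrightarrow>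
      \<bar>betti B \<xi> / measure lborel B - b\<bar> \<le> l)"
      by (rule density_exceptional_set[OF erg b good chain l d])
    then obtain \<rho>0 E where E: "E \<in> events" "prob E \<le> d"
      "\<forall>\<xi>\<in>space \<mu> - E. \<forall>B\<in>range A. \<forall>c. ball c \<rho>0 \<subseteq> B \<longrightarrow> \<bar>betti B \<xi> / measure lborel B - b\<bar> \<le> l"
      by (elim exE bexE conjE) (rule that)
    have "eventually (\<lambda>n. \<bar>betti (A n) \<xi> / measure lborel (A n) - b\<bar> \<le> l) at_top" if \<xi>: "\<xi> \<in> space \<mu> - E" for \<xi>
      using net_eventually_ball[OF A, of \<rho>0] 
    proof eventually_elim
      case (elim n)
      then obtain c where "ball c \<rho>0 \<subseteq> A n" by (rule exE)
      then show ?case using E(3)[rule_format, OF \<xi> rangeI] by blast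
    qed
    then show "\<exists>E\<in>events. prob E \<le> d \<and>
      (\<forall>\<xi>\<in>space \<mu> - E. eventually (\<lambda>n. \<bar>betti (A n) \<xi> / measure lborel (A n) - b\<bar> \<le> l) at_top)"
      using E(1,2) by blast
  qed
  have "AE \<xi> in \<mu>. \<forall>k::nat. eventually (\<lambda>n. \<bar>betti (A n) \<xi> / measure lborel (A n) - b\<bar> \<le> 1 / Suc k) at_top"
    unfolding AE_all_countable by (intro allI AEl) simp
  then show ?thesis
  proof eventually_elim
    case (elim \<xi>)
    show ?case
    proof (rule tendstoI)
      fix e :: real assume "e > 0"
      then obtain k :: nat where k: "1 / Suc k < e" using nat_approx_posE by blast
      from elim[rule_format, of k]
      show "eventually (\<lambda>n. dist (betti (A n) \<xi> / measure lborel (A n)) b < e) at_top"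
        by eventually_elim (use k in \<open>simp add: dist_real_def\<close>)
    qed
  qed
qed

end

lemma stationary_filtration_distr:
  fixes P :: "'w measure"
    and \<Phi> :: "'w \<Rightarrow> ('a::euclidean_space \<times> 'm::polish_space) set"
  assumes P: "prob_space P" and \<Phi>: "\<Phi> \<in> measurable P config_space"
    and stat: "stationary_mpp P \<Phi>" and mom: "finite_moments P \<Phi>"
    and \<kappa>: "admissible_kappa \<kappa>" and rs: "r \<le> s"
  shows "stationary_filtration \<kappa> r s (distr P config_space \<Phi>)"
proof -
  interpret P: prob_space P by (rule P)
  show ?thesis
  proof (intro stationary_filtration.intro stationary_filtration_axioms.intro admissible_filtration.intro \<kappa> rs)
    show "prob_space (distr P config_space \<Phi>)" by (rule P.prob_space_distr[OF \<Phi>])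
    show "sets (distr P config_space \<Phi>) = sets config_space" by simp
    show "distr (distr P config_space \<Phi>) config_space (shift a) = distr P config_space \<Phi>" for a
      using stat distr_distr[OF measurable_shift \<Phi>, of a] unfolding stationary_mpp_def by (simp add: comp_def)
    fix A :: "'a set" and p :: nat
    assume A: "A \<in> sets borel" "bounded A"
    have m: "(\<lambda>\<xi>. real (card (restr \<xi> A)) ^ p) \<in> borel_measurable (config_space :: ('a \<times> 'm) set measure)"
      by (rule measurable_compose[OF measurable_card_restr[OF A]]) simp
    have "integrable P (\<lambda>\<omega>. real (card (restr (\<Phi> \<omega>) A)) ^ p)"
    proof (cases "p = 0")
      case False
      have "(\<integral>\<^sup>+\<omega>. ennreal (real (card (restr (\<Phi> \<omega>) A)) ^ p) \<partial>P) < \<infinity>"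
        using mom A False unfolding finite_moments_def by (simp add: Suc_le_eq)
      then show ?thesis using measurable_compose[OF \<Phi> m] by (intro integrableI_nonneg) auto
    qed simp
    then show "integrable (distr P config_space \<Phi>) (\<lambda>\<xi>. real (card (restr \<xi> A)) ^ p)"
      using integrable_distr_eq[OF \<Phi> m] by simp
  qed
qed

theorem mainTheorem2:
  fixes P :: "'w measure"
    and \<Phi> :: "'w \<Rightarrow> ('a::euclidean_space \<times> 'm::polish_space) set"
    and \<kappa> :: "('a \<times> 'm) set \<Rightarrow> real"
    and F :: "'k::field itself"
    and r s :: real and q :: nat
  assumes "prob_space P"
    and "\<Phi> \<in> measurable P config_space"
    and "stationary_mpp P \<Phi>"
    and "finite_moments P \<Phi>"
    and "admissible_kappa \<kappa>"
    and "0 \<le> r" and "r \<le> s"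
  shows "\<exists>b::real. b \<ge> 0 \<and>
    (\<forall>A :: nat \<Rightarrow> 'a set. convex_averaging_net A \<longrightarrow>
       ((\<lambda>n. (\<integral>\<omega>. real (pbetti F (Kcx \<kappa> (restr (\<Phi> \<omega>) (A n)) r) (Kcx \<kappa> (restr (\<Phi> \<omega>) (A n)) s) q) \<partial>P)
              / measure lborel (A n)) \<longlongrightarrow> b) at_top \<and>
       (ergodic_mpp P \<Phi> \<longrightarrow>
          (AE \<omega> in P. ((\<lambda>n. real (pbetti F (Kcx \<kappa> (restr (\<Phi> \<omega>) (A n)) r) (Kcx \<kappa> (restr (\<Phi> \<omega>) (A n)) s) q)
              / measure lborel (A n)) \<longlongrightarrow> b) at_top))) \<and>
    (\<forall>A :: 'n::linorder \<Rightarrow> 'a set. convex_averaging_net A \<longrightarrow>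
       ((\<lambda>n. (\<integral>\<omega>. real (pbetti F (Kcx \<kappa> (restr (\<Phi> \<omega>) (A n)) r) (Kcx \<kappa> (restr (\<Phi> \<omega>) (A n)) s) q) \<partial>P)
              / measure lborel (A n)) \<longlongrightarrow> b) at_top \<and>
       (ergodic_mpp P \<Phi> \<longrightarrow>
          (AE \<omega> in P. ((\<lambda>n. real (pbetti F (Kcx \<kappa> (restr (\<Phi> \<omega>) (A n)) r) (Kcx \<kappa> (restr (\<Phi> \<omega>) (A n)) s) q)
              / measure lborel (A n)) \<longlongrightarrow> b) at_top)))"
proof -
  define \<mu> where "\<mu> = distr P config_space \<Phi>"
  interpret stationary_filtration F \<kappa> r s q \<mu>
    unfolding \<mu>_def by (rule stationary_filtration_distr[OF assms(1-5,7)])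
  obtain b where b: "b \<ge> 0" "mean_density b" using ex_mean_density by blast
  have eq: "real (pbetti F (Kcx \<kappa> (restr \<xi> A) r) (Kcx \<kappa> (restr \<xi> A) s) q) = betti A \<xi>" for A \<xi>
    unfolding betti_def ..
  have int: "(\<integral>\<omega>. betti A (\<Phi> \<omega>) \<partial>P) = (\<integral>\<xi>. betti A \<xi> \<partial>\<mu>)"
    if "A \<in> sets borel" "bounded A" for A
  proof -
    have "betti A \<in> borel_measurable config_space"
      using betti_measurable[OF that] measurable_cong_sets[OF sets_\<mu> refl, of "borel :: real measure"] by simp
    from integral_distr[OF assms(2) this] show ?thesis unfolding \<mu>_def by simp
  qed
  have erg: ergodic_action if e: "ergodic_mpp P \<Phi>"
    unfolding ergodic_action_def
  proof (intro ballI impI)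
    fix B assume B: "B \<in> events"
      and inv: "\<forall>a. prob (B - {x \<in> space \<mu>. shift (- a) x \<in> B} \<union> ({x \<in> space \<mu>. shift (- a) x \<in> B} - B)) = 0"
    have "B \<in> sets config_space" using B sets_\<mu> by simp
    \<comment> \<open>The action uses the opposite sign, and invariance under all translations is
      unaffected by it.\<close>
    moreover have "prob (B - {\<xi> \<in> configs. shift a \<xi> \<in> B} \<union> ({\<xi> \<in> configs. shift a \<xi> \<in> B} - B)) = 0" for a
      using inv[rule_format, of "- a"] unfolding space_\<mu> minus_minus .
    ultimately show "prob B = 0 \<or> prob B = 1"
      using e unfolding ergodic_mpp_def \<mu>_def by blast
  qed
  \<comment> \<open>The index type is generic here, so the same fact covers sequences and nets over
    \<open>'n\<close> with one \<open>b\<close>.\<close>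
  have expect: "((\<lambda>n. (\<integral>\<omega>. betti (A n) (\<Phi> \<omega>) \<partial>P) / measure lborel (A n)) \<longlongrightarrow> b) at_top"
    if "convex_averaging_net A" for A :: "'i::linorder \<Rightarrow> 'a set"
    using expectation_density_tendsto[OF b(2) that] int[OF net_sets(1,2)[OF that]] by simp
  have as: "AE \<omega> in P. ((\<lambda>n. betti (A n) (\<Phi> \<omega>) / measure lborel (A n)) \<longlongrightarrow> b) at_top"
    if "convex_averaging_net A" "ergodic_mpp P \<Phi>" for A :: "'i::linorder \<Rightarrow> 'a set"
    by (rule AE_distrD[OF assms(2) AE_density_tendsto[OF erg[OF that(2)] b(2) that(1), unfolded \<mu>_def]])
  show ?thesis
    unfolding eq by (intro exI[of _ b] conjI allI impI b(1) expect as)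
qed

end
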